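(* Let $t_0>1$ and let $a,b,c$ be positive real constants that satisfy $$|S_1(t_2)-S_1(t_1)|\leq a+b\log\log t_2+c\log t_2\qquad\text{for all } t_2>t_1\geq t_0.$$ Suppose that $K$ consecutive Gram blocks with union $[g_n,g_p)$ all satisfy Rosser's rule, that $g_n\geq t_0$, and that $$K>\frac{1}{3\pi}\left(\log\frac{g_p}{2\pi}+\frac{0.048\,\pi^2}{g_p^2}\right)\left(a+b\log\log g_p+c\log g_p\right).$$ Then $$N(g_n)\leq n+1\quad\text{and}\quad N(g_p)\geq p+1.$$
   Context: $\zeta$ denotes the Riemann zeta function. Argument: for $t>0$ not equal to the imaginary part of a zero of $\zeta$, $S(t)=\frac{1}{\pi}\Delta_C\arg\zeta(s)$, where $\Delta_C\arg$ is the continuous change of argument along the path $C$ consisting of the segment from $2$ to $2+it$ followed by the segment from $2+it$ to $\frac12+it$; if $t$ is the imaginary part of a zero, $S(t)$ is defined by the principal value, i.e. $S(t)=\frac12\left(\lim_{u\to t^+}S(u)+\lim_{u\to t^-}S(u)\right)$. Moreover $S_1(t)=\int_0^tS(u)\,du$. Zero counting: $N(t)=\frac12\#\{0<\beta<1,\ 0<\gamma<t:\zeta(\beta+i\gamma)=0\}+\frac12\#\{0<\beta<1,\ 0<\gamma\leq t:\zeta(\beta+i\gamma)=0\}$, zeros counted with multiplicity. Riemann–Siegel functions: $\theta(t)=\operatorname{Im}\log\Gamma\left(\frac14+\frac{it}{2}\right)-\frac{t\log\pi}{2}$ (the branch with $\theta$ continuous and $\theta(0)=0$) and $Z(t)=e^{i\theta(t)}\zeta\left(\frac12+it\right)$,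 which is real for real $t$. Gram points: for integers $n\ge -1$, $g_n$ is the solution of $\theta(g_n)=\pi n$ with $g_n\geq 7$ (on $[7,\infty)$ the function $\theta$ is increasing). The number $\zeta(\frac12+ig_n)=(-1)^nZ(g_n)$ is real. Gram blocks: a Gram block of length $l\ge 1$ is an interval $[g_m,g_{m+l})$ such that $\zeta(\frac12+ig_j)>0$ for $j=m$ and $j=m+l$, and $\zeta(\frac12+ig_j)\leq 0$ for all integers $j$ with $m<j<m+l$. A Gram block of length $l$ satisfies Rosser's rule if $Z(t)$ has at least $l$ zeros in it. Gram blocks are consecutive if each begins at the Gram point where the previous one ends. *)

theory Defs
  imports "HOL-Complex_Analysis.Complex_Analysis"
begin

text \<open>
  The Riemann zeta function as the analytic continuation to \<open>\<complex> - {1}\<close> of its Dirichlet series.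
  The value at the pole is set to \<open>0\<close> only to make the definite description unique
  (see \<open>zeta_unique\<close>); it plays no role below.
\<close>

definition is_zeta :: "(complex \<Rightarrow> complex) \<Rightarrow> bool" where
  "is_zeta f \<longleftrightarrow>
     f holomorphic_on (- {1}) \<and>
     (\<forall>s. Re s > 1 \<longrightarrow> (\<lambda>n. 1 / of_nat (Suc n) powr s) sums f s) \<and>
     f 1 = 0"

definition zeta :: "complex \<Rightarrow> complex" where
  "zeta = (THE f. is_zeta f)"

lemma zeta_unique:
  assumes f: "is_zeta f" and g: "is_zeta g"
  shows "f = g"
proof
  fix z
  have conn: "connected (- {1::complex})"
    by (intro connected_punctured_universe) auto
  show "f z = g z"
  proof (cases "z = 1")
    case True
    then show ?thesis using f g by (simp add: is_zeta_def)
  next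
    case False
    have ne: "{s. Re s > 1} \<noteq> {}"
      by (metis (mono_tags) Re_complex_of_real empty_iff mem_Collect_eq one_less_numeral_iff
            of_real_numeral semiring_norm(76) complex_Re_numeral)
    show ?thesis
    proof (rule analytic_continuation_open[of "{s. Re s > 1}" "- {1}" f g])
      show "f holomorphic_on - {1}" "g holomorphic_on - {1}"
        using f g by (auto simp: is_zeta_def)
      show "f z = g z" if "z \<in> {s. 1 < Re s}" for z
        using f g that sums_unique2 unfolding is_zeta_def by blast
    qed (use conn ne False in \<open>auto simp: open_halfspace_Re_gt\<close>)
  qed
qed

text \<open>
  The continuous change of argument along a path in \<open>\<complex> - {0}\<close>.  The lemmas
  below show that it is well defined.
\<close>

definition arg_lift :: "(real \<Rightarrow> complex) \<Rightarrow> (real \<Rightarrow> real) \<Rightarrow> bool" where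
  "arg_lift p \<phi> \<longleftrightarrow>
     continuous_on {0..1} \<phi> \<and> (\<forall>u\<in>{0..1}. p u = of_real (norm (p u)) * cis (\<phi> u))"

definition arg_change :: "(real \<Rightarrow> complex) \<Rightarrow> real" where
  "arg_change p = (THE d. \<exists>\<phi>. arg_lift p \<phi> \<and> d = \<phi> 1 - \<phi> 0)"

lemma arg_lift_exists:
  assumes "path p" "0 \<notin> path_image p"
  shows "\<exists>\<phi>. arg_lift p \<phi>"
proof -
  obtain q where q: "path q" "\<And>t. t \<in> {0..1} \<Longrightarrow> p t = 0 + exp (q t)"
    using winding_number_as_continuous_log[OF assms] by metis
  have "arg_lift p (\<lambda>u. Im (q u))"
    unfolding arg_lift_def
  proof (intro conjI ballI)
    show "continuous_on {0..1} (\<lambda>u. Im (q u))"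
      using q(1) by (auto simp: path_def intro: continuous_intros)
    show "p u = of_real (norm (p u)) * cis (Im (q u))" if "u \<in> {0..1}" for u
    proof -
      have "p u = exp (q u)" using q(2)[OF that] by simp
      then show ?thesis by (metis exp_eq_polar norm_exp_eq_Re)
    qed
  qed
  then show ?thesis by blast
qed

lemma arg_change_eq:
  assumes "0 \<notin> path_image p" and \<phi>: "arg_lift p \<phi>"
  shows "arg_change p = \<phi> 1 - \<phi> 0"
proof -
  have "\<psi> 1 - \<psi> 0 = \<phi> 1 - \<phi> 0" if \<psi>: "arg_lift p \<psi>" for \<psi>
  proof -
    define h where "h = (\<lambda>u. (\<psi> u - \<phi> u) / (2 * pi))"
    have cont: "continuous_on {0..1} h"
      unfolding h_def using \<phi> \<psi> unfolding arg_lift_def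
      by (intro continuous_on_divide continuous_on_diff continuous_on_const) simp_all
    have int: "h u \<in> \<int>" if u: "u \<in> {0..1}" for u
    proof -
      have "p u \<noteq> 0" using assms(1) u by (auto simp: path_image_def)
      moreover have "p u = of_real (norm (p u)) * cis (\<phi> u)" "p u = of_real (norm (p u)) * cis (\<psi> u)"
        using \<phi> \<psi> u unfolding arg_lift_def by blast+
      ultimately have eq: "cis (\<psi> u) = cis (\<phi> u)"
        by (metis mult_cancel_left norm_eq_zero of_real_eq_0_iff)
      have "cis (\<psi> u - \<phi> u) = 1"
        unfolding cis_divide[symmetric] eq by simp
      then have "cos (\<psi> u - \<phi> u) = 1" by (metis cis.simps(1) one_complex.simps(1))
      then obtain k :: int where k: "\<psi> u - \<phi> u = of_int k * 2 * pi"
        unfolding cos_one_2pi_int by blast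
      have "h u = of_int k" unfolding h_def k by simp
      then show ?thesis by simp
    qed
    have "h constant_on {0..1}"
    proof (rule continuous_discrete_range_constant[OF _ cont])
      show "\<exists>e>0. \<forall>y. y \<in> {0..1} \<and> h y \<noteq> h x \<longrightarrow> e \<le> norm (h y - h x)"
        if x: "x \<in> {0..1}" for x
      proof (intro exI[of _ 1] conjI allI impI)
        fix y assume y: "y \<in> {0..1} \<and> h y \<noteq> h x"
        obtain a b :: int where ab: "h y = of_int a" "h x = of_int b"
          using int[OF x] int[of y] y unfolding Ints_def by blast
        have "a \<noteq> b" using y ab by metis
        then have "1 \<le> \<bar>a - b\<bar>" by linarith
        then have "1 \<le> real_of_int \<bar>a - b\<bar>" by (simp only: of_int_1_le_iff)
        then show "1 \<le> norm (h y - h x)"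
          unfolding ab by (simp only: real_norm_def of_int_diff of_int_abs)
      qed simp
    qed simp
    then have "h 1 = h 0" by (metis atLeastAtMost_iff constant_on_def order_refl zero_le_one)
    then show ?thesis by (simp add: h_def)
  qed
  then show ?thesis
    unfolding arg_change_def using \<phi> by (intro the_equality) blast+
qed

definition zeta_ordinate :: "real \<Rightarrow> bool" where
  "zeta_ordinate t \<longleftrightarrow> (\<exists>s. zeta s = 0 \<and> Im s = t)"

definition S_generic :: "real \<Rightarrow> real" where
  "S_generic t =
     arg_change (zeta \<circ> (linepath 2 (Complex 2 t) +++ linepath (Complex 2 t) (Complex (1/2) t))) / pi"

text \<open>
  Ordinates of zeros are isolated on the positive half-line, so the one-sided limits of \<open>S\<close> at an
  ordinate only involve values of \<open>S_generic\<close>.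
\<close>

definition S :: "real \<Rightarrow> real" where
  "S t = (if zeta_ordinate t
          then (Lim (at_right t) S_generic + Lim (at_left t) S_generic) / 2
          else S_generic t)"

definition S1 :: "real \<Rightarrow> real" where
  "S1 t = integral {0..t} S"

definition N_zeros :: "real \<Rightarrow> real" where
  "N_zeros t =
     1/2 * (\<Sum>s\<in>{s. 0 < Re s \<and> Re s < 1 \<and> 0 < Im s \<and> Im s < t \<and> zeta s = 0}. of_int (zorder zeta s)) +
     1/2 * (\<Sum>s\<in>{s. 0 < Re s \<and> Re s < 1 \<and> 0 < Im s \<and> Im s \<le> t \<and> zeta s = 0}. of_int (zorder zeta s))"

text \<open>
  The library's \<open>ln_Gamma\<close> is holomorphic off the non-positive reals and real on the positive
  reals, so this is the branch of \<open>\<theta>\<close> that is continuous with \<open>\<theta> 0 = 0\<close>.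
\<close>

definition RS_theta :: "real \<Rightarrow> real" where
  "RS_theta t = Im (ln_Gamma (1/4 + \<i> * of_real t / 2)) - t * ln pi / 2"

definition RS_Z :: "real \<Rightarrow> complex" where
  "RS_Z t = exp (\<i> * of_real (RS_theta t)) * zeta (1/2 + \<i> * of_real t)"

definition gram :: "int \<Rightarrow> real" where
  "gram n = (THE t. t \<ge> 7 \<and> RS_theta t = pi * of_int n)"

text \<open>
  At a Gram point \<open>\<zeta>(1/2 + i g)\<close> is real, so its sign is that of its real part.
\<close>

definition gram_block :: "int \<Rightarrow> nat \<Rightarrow> bool" where
  "gram_block m l \<longleftrightarrow>
     m \<ge> -1 \<and> l \<ge> 1 \<and>
     Re (zeta (1/2 + \<i> * of_real (gram m))) > 0 \<and>
     Re (zeta (1/2 + \<i> * of_real (gram (m + int l)))) > 0 \<and>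
     (\<forall>j. m < j \<and> j < m + int l \<longrightarrow> Re (zeta (1/2 + \<i> * of_real (gram j))) \<le> 0)"

text \<open>
  Zeros of \<open>Z\<close> are counted with multiplicity.  As \<open>Z\<close> differs from \<open>\<zeta>(1/2 + i t)\<close> by an analytic
  factor without zeros, the multiplicity of a zero \<open>t\<close> of \<open>Z\<close> is the order of \<open>\<zeta>\<close> at \<open>1/2 + i t\<close>.
\<close>

definition rosser_rule :: "int \<Rightarrow> nat \<Rightarrow> bool" where
  "rosser_rule m l \<longleftrightarrow>
     (\<Sum>t\<in>{t \<in> {gram m..<gram (m + int l)}. RS_Z t = 0}. zorder zeta (1/2 + \<i> * of_real t)) \<ge> int l"

end

theory Submission
  imports Defs "HOL-Real_Asymp.Real_Asymp"
begin

text \<open>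
  Turing's method.  Off the ordinates of zeros, \<open>N(t) = \<theta>(t) / \<pi> + 1 + S(t)\<close>, and at a Gram point
  \<open>g\<^sub>j\<close> with \<open>\<zeta>(1/2 + \<i> g\<^sub>j) > 0\<close> the number of zeros below \<open>g\<^sub>j\<close> is congruent to \<open>j + 1\<close> modulo 2.
  Hence \<open>N(g\<^sub>n) > n + 1\<close> means an excess of at least two zeros just after \<open>g\<^sub>n\<close>.  Rosser's rule carries
  this excess through all the blocks, so that \<open>S \<ge> 2 - (\<theta>(t) / \<pi> - j)\<close> on the first Gram interval
  \<open>[g\<^sub>j, g\<^sub>j\<^sub>+\<^sub>1)\<close> of each block and \<open>S \<ge> 0\<close> on its other Gram intervals.  Each block therefore contributes at least
  \<open>(3/2) \<pi> / max \<theta>'\<close> to the integral of \<open>S\<close>, and the \<open>K\<close> blocks together exceed the assumed bound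
  for \<open>S\<^sub>1\<close>.  If \<open>N(g\<^sub>p) < p + 1\<close>, the same argument runs backwards from \<open>g\<^sub>p\<close>.

  The analytic input is the continuation and functional equation of \<open>\<zeta>\<close> from the modularity of the
  theta function, the absence of zeros with real part 1 (the 3-4-1 inequality), the argument principle
  for \<open>\<xi>\<close>, and Stirling-type bounds for \<open>\<theta>'\<close> obtained by telescoping the digamma function.
\<close>

section \<open>The theta function\<close>

text \<open>The obstacle is that a zero off the critical line may share its ordinate with a Gram
  point, even with one where \<zeta> is positive. Zeros are therefore counted over
  \<open>{0<..t}\<close> and over \<open>{0<..<t}\<close>, N being the mean of the two counts: the
  forward argument carries the count with the endpoint, the backward one the count without it, and
  the parity at a Gram point is obtained for each by approaching the point from the corresponding
  side. The nonvanishing on Re s = 1 identifies the zeros of \<xi>, which the contour integral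
  counts, with the zeros in the open strip, which N counts. The factor 1/(3 pi) in the condition on
  K arises because \<theta>' is at most half of the bracket B next to it, so that the gain (3/2) pi
  / max \<theta>' of a block becomes 3 pi / B. The modular law is the limit of an identity between
  finite sums of binomial coefficients and of powers of cosines, which takes the place of Poisson
  summation. The Mellin transform is then computed for real s > 1, and the identity theorem extends
  the result.\<close>

lemma central_binomial_ratio_Suc:
  assumes "r < m"
  shows "real ((2*m) choose (m + Suc r)) = real ((2*m) choose (m + r)) * ((real m - real r) / (real m + real r + 1))"
proof -
  have "Suc (m + r) * ((2*m) choose Suc (m + r)) = (2*m - (m + r)) * ((2*m) choose (m + r))"
    using binomial_absorb_comp[of "2*m" "m+r"] binomial_absorption[of "m+r" "2*m"] by simp
  then have "real (Suc (m + r)) * real ((2*m) choose Suc (m + r)) = real (2*m - (m + r)) * real ((2*m) choose (m + r))"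
    by (metis of_nat_mult)
  then show ?thesis using assms by (simp add: field_simps of_nat_diff)
qed

text \<open>Consecutive coefficients have the ratio 1 - (2i+1)/(m+i+1) = 1/(1+y) with y =
  (2i+1)/(m-i), and both bounds come from 1 + x \<le> exp x; the exponents add up by 1 + 3 + ... +
  (2r-1) = r^2. The fixed \<open>R\<close> keeps the denominators independent of the induction
  variable.\<close>

lemma central_binomial_ratio_bounds:
  assumes "r \<le> R" "R \<le> m" "0 < m"
  shows "real ((2*m) choose (m + r)) \<le> real ((2*m) choose m) * exp (- ((real r)^2) / (real m + real R))"
    and "real ((2*m) choose (m + r)) \<ge> real ((2*m) choose m) * exp (- ((real r)^2) / (real m + 1 - real R))"
proof -
  show "real ((2*m) choose (m + r)) \<le> real ((2*m) choose m) * exp (- ((real r)^2) / (real m + real R))"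
    using assms
  proof (induction r)
    case (Suc r)
    have rm: "r < m" using Suc by simp
    have "(real m - real r) / (real m + real r + 1) = 1 - (2 * real r + 1) / (real m + real r + 1)"
      by (simp add: field_simps)
    also have "\<dots> \<le> 1 - (2 * real r + 1) / (real m + real R)"
      using Suc.prems by (intro diff_left_mono divide_left_mono) auto
    also have "\<dots> \<le> exp (- ((2 * real r + 1) / (real m + real R)))"
      using exp_ge_add_one_self[of "- ((2 * real r + 1) / (real m + real R))"] by simp
    finally have 1: "(real m - real r) / (real m + real r + 1) \<le> exp (- ((2 * real r + 1) / (real m + real R)))" .
    have "real ((2*m) choose (m + Suc r)) \<le> (real ((2*m) choose m) * exp (- ((real r)^2) / (real m + real R)))
         * exp (- ((2 * real r + 1) / (real m + real R)))"
      unfolding central_binomial_ratio_Suc[OF rm]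
      using Suc rm by (intro mult_mono 1) auto
    also have "\<dots> = real ((2*m) choose m) * exp (- ((real (Suc r))^2) / (real m + real R))"
    proof -
      have "- ((real r)^2) / (real m + real R) - (2 * real r + 1) / (real m + real R) = - ((real (Suc r))^2) / (real m + real R)"
        unfolding diff_divide_distrib[symmetric] by (simp add: power2_eq_square algebra_simps)
      then show ?thesis unfolding mult.assoc exp_add[symmetric] by simp
    qed
    finally show ?case .
  qed auto
  show "real ((2*m) choose (m + r)) \<ge> real ((2*m) choose m) * exp (- ((real r)^2) / (real m + 1 - real R))"
    using assms
  proof (induction r)
    case (Suc r)
    have rm: "r < m" using Suc by simp
    define y where "y = (2 * real r + 1) / (real m - real r)"
    have y0: "y \<ge> 0" using rm by (simp add: y_def)
    have y: "y \<le> (2 * real r + 1) / (real m + 1 - real R)"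
      unfolding y_def using Suc.prems rm by (intro divide_left_mono) auto
    have "(real m - real r) / (real m + real r + 1) = 1 / (1 + y)"
      unfolding y_def using rm by (simp add: field_simps)
    also have "\<dots> \<ge> 1 / exp y"
      using y0 exp_ge_add_one_self[of y] by (intro divide_left_mono) (auto simp del: exp_ge_add_one_self)
    finally have 0: "exp (-y) \<le> (real m - real r) / (real m + real r + 1)" by (simp add: exp_minus field_simps)
    have 1: "exp (- ((2 * real r + 1) / (real m + 1 - real R))) \<le> (real m - real r) / (real m + real r + 1)"
      using y by (intro order_trans[OF _ 0]) auto
    have "real ((2*m) choose m) * exp (- ((real (Suc r))^2) / (real m + 1 - real R))
       = (real ((2*m) choose m) * exp (- ((real r)^2) / (real m + 1 - real R)))
         * exp (- ((2 * real r + 1) / (real m + 1 - real R)))"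
    proof -
      have "- ((real r)^2) / (real m + 1 - real R) - (2 * real r + 1) / (real m + 1 - real R) = - ((real (Suc r))^2) / (real m + 1 - real R)"
        unfolding diff_divide_distrib[symmetric] by (simp add: power2_eq_square algebra_simps)
      then show ?thesis unfolding mult.assoc exp_add[symmetric] by simp
    qed
    also have "\<dots> \<le> real ((2*m) choose (m + Suc r))"
      unfolding central_binomial_ratio_Suc[OF rm]
      using Suc rm by (intro mult_mono 1) auto
    finally show ?case .
  qed auto
qed

text \<open>The local de Moivre-Laplace theorem: r is of order sqrt m, hence r / m tends to 0, and
  the exponents of the two preceding bounds have the common limit c^2.\<close>

lemma central_binomial_ratio_limit:
  fixes r :: "nat \<Rightarrow> nat"
  assumes lim: "(\<lambda>m. real (r m) / sqrt (real m)) \<longlonglongrightarrow> c"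
  shows "(\<lambda>m. real ((2*m) choose (m + r m)) / real ((2*m) choose m)) \<longlonglongrightarrow> exp (- (c^2))"
proof -
  have inv: "(\<lambda>m. 1 / sqrt (real m)) \<longlonglongrightarrow> 0"
    by real_asymp
  have rm: "(\<lambda>m. real (r m) / real m) \<longlonglongrightarrow> 0"
  proof -
    have "(\<lambda>m. (real (r m) / sqrt (real m)) * (1 / sqrt (real m))) \<longlonglongrightarrow> c * 0"
      by (intro tendsto_mult lim inv)
    then show ?thesis by (simp add: mult.commute)
  qed
  have ev: "eventually (\<lambda>m. real (r m) / real m < 1 \<and> m > 0) sequentially"
    using order_tendstoD(2)[OF rm zero_less_one] eventually_gt_at_top[of 0] by eventually_elim auto
  have A: "(\<lambda>m. exp (- ((real (r m) / sqrt (real m))^2 / (1 + real (r m) / real m)))) \<longlonglongrightarrow> exp (- (c^2 / (1 + 0)))"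
    by (intro tendsto_intros lim rm) auto
  have B: "(\<lambda>m. exp (- ((real (r m) / sqrt (real m))^2 / (1 + (1 / sqrt (real m))^2 - real (r m) / real m)))) \<longlonglongrightarrow> exp (- (c^2 / (1 + 0^2 - 0)))"
    by (intro tendsto_intros lim rm inv) auto
  show ?thesis
  proof (rule tendsto_sandwich)
    show "eventually (\<lambda>m. exp (- ((real (r m) / sqrt (real m))^2 / (1 + (1 / sqrt (real m))^2 - real (r m) / real m)))
        \<le> real ((2*m) choose (m + r m)) / real ((2*m) choose m)) sequentially"
      using ev
    proof eventually_elim
      case (elim m)
      have "r m \<le> m" using elim by (auto simp: divide_less_eq)
      have "exp (- ((real (r m))^2) / (real m + 1 - real (r m))) \<le> real ((2*m) choose (m + r m)) / real ((2*m) choose m)"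
        using central_binomial_ratio_bounds(2)[of "r m" "r m" m] \<open>r m \<le> m\<close> elim
        by (simp add: field_simps)
      moreover have "(real (r m))^2 / (real m + 1 - real (r m)) = (real (r m) / sqrt (real m))^2 / (1 + (1 / sqrt (real m))^2 - real (r m) / real m)"
      proof -
        have "1 + (1 / sqrt (real m))^2 - real (r m) / real m = (real m + 1 - real (r m)) / real m"
          using elim by (simp add: power_divide field_simps)
        then show ?thesis using elim by (simp add: power_divide)
      qed
      ultimately show ?case by simp
    qed
    show "eventually (\<lambda>m. real ((2*m) choose (m + r m)) / real ((2*m) choose m)
       \<le> exp (- ((real (r m) / sqrt (real m))^2 / (1 + real (r m) / real m)))) sequentially"
      using ev
    proof eventually_elim
      case (elim m)
      have "r m \<le> m" using elim by (auto simp: divide_less_eq)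
      have "exp (- ((real (r m))^2) / (real m + real (r m))) \<ge> real ((2*m) choose (m + r m)) / real ((2*m) choose m)"
        using central_binomial_ratio_bounds(1)[of "r m" "r m" m] \<open>r m \<le> m\<close> elim
        by (simp add: field_simps)
      moreover have "(real (r m))^2 / (real m + real (r m)) = (real (r m) / sqrt (real m))^2 / (1 + real (r m) / real m)"
        using elim by (simp add: power_divide field_simps)
      ultimately show ?case by simp
    qed
  qed (use A B in simp_all)
qed

section \<open>Roots of unity and the finite theta identity\<close>

text \<open>A geometric sum in an l-th root of unity, which is 1 exactly when l divides q. It
  filters out the indices congruent to m modulo l in the binomial expansion.\<close>

lemma sum_cis_multiples:
  fixes l :: nat and q :: int
  assumes "l > 0"
  shows "(\<Sum>j<l. cis (2 * pi * real j * of_int q / real l)) = (if int l dvd q then of_nat l else 0)"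
proof -
  define w where "w = cis (2 * pi * of_int q / real l)"
  have p: "cis (2 * pi * real j * of_int q / real l) = w ^ j" for j
    unfolding w_def Complex.DeMoivre by (simp add: mult_ac)
  have wl: "w ^ l = 1"
    using assms cis_multiple_2pi[of "of_int q"] unfolding w_def Complex.DeMoivre by (simp add: mult_ac)
  show ?thesis
  proof (cases "int l dvd q")
    case True
    then obtain k where k: "q = int l * k" by auto
    have "w = 1" using assms cis_multiple_2pi[of "of_int k"] unfolding w_def k by (simp add: mult_ac)
    then show ?thesis using True by (simp add: p)
  next
    case False
    have "w \<noteq> 1"
    proof
      assume "w = 1"
      then have "cos (2 * pi * of_int q / real l) = 1" unfolding w_def by (metis cis.simps(1) one_complex.simps(1))
      then obtain k :: int where "2 * pi * of_int q / real l = of_int k * 2 * pi"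
        unfolding cos_one_2pi_int by blast
      then have "real_of_int q = of_int (int l * k)" using assms by (simp add: field_simps)
      then have "q = int l * k" by (simp only: of_int_eq_iff)
      then show False using False by simp
    qed
    then show ?thesis using False wl by (simp add: p sum_gp_strict)
  qed
qed

lemma sum_symmetric_nat:
  fixes f :: "nat \<Rightarrow> 'a::comm_monoid_add"
  shows "(\<Sum>r\<le>2*m. f r) = f m + (\<Sum>d=1..m. f (m + d) + f (m - d))"
proof -
  have eq: "{..2*m} = insert m ({m+1..2*m} \<union> {..<m})" by auto
  have "(\<Sum>r\<le>2*m. f r) = f m + (\<Sum>r\<in>{m+1..2*m} \<union> {..<m}. f r)"
    unfolding eq by (subst sum.insert) auto
  also have "(\<Sum>r\<in>{m+1..2*m} \<union> {..<m}. f r) = (\<Sum>r=m+1..2*m. f r) + (\<Sum>r<m. f r)"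
    by (intro sum.union_disjoint) auto
  also have "(\<Sum>r=m+1..2*m. f r) = (\<Sum>d=1..m. f (m + d))"
    by (rule sum.reindex_bij_witness[of _ "\<lambda>d. m + d" "\<lambda>r. r - m"]) auto
  also have "(\<Sum>r<m. f r) = (\<Sum>d=1..m. f (m - d))"
    by (rule sum.reindex_bij_witness[of _ "\<lambda>d. m - d" "\<lambda>r. m - r"]) auto
  finally show ?thesis by (simp add: sum.distrib)
qed

lemma two_cos_power_expand:
  "complex_of_real ((2 * cos x) ^ (2*m)) = (\<Sum>r\<le>2*m. of_nat ((2*m) choose r) * cis (2 * x * (real r - real m)))"
proof -
  have a: "complex_of_real (2 * cos x) = cis x + cis (-x)"
    by (simp add: complex_eq_iff)
  have "complex_of_real ((2 * cos x) ^ (2*m)) = (cis x + cis (-x)) ^ (2*m)"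
    by (simp only: of_real_power a)
  also have "\<dots> = (\<Sum>r\<le>2*m. of_nat ((2*m) choose r) * cis x ^ r * cis (-x) ^ (2*m - r))"
    by (rule binomial_ring)
  also have "\<dots> = (\<Sum>r\<le>2*m. of_nat ((2*m) choose r) * cis (2 * x * (real r - real m)))"
    by (intro sum.cong refl)
       (simp add: Complex.DeMoivre cis_mult of_nat_diff mult.assoc algebra_simps)
  finally show ?thesis .
qed

text \<open>
  Polya's finite form of the transformation law of the theta function: after division by \<open>4 ^ m\<close>,
  both sides become theta series when \<open>m\<close> tends to infinity and \<open>l\<close> grows like \<open>t * sqrt m\<close>.
\<close>

lemma polya_identity:
  fixes h m :: nat
  defines "l \<equiv> 2 * h + 1"
  shows "4 ^ m * (1 + 2 * (\<Sum>j=1..h. cos (pi * real j / real l) ^ (2*m)))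
       = real l * (real ((2*m) choose m) + 2 * (\<Sum>k=1..m. real ((2*m) choose (m + k * l))))"
proof -
  have l: "l > 0" by (simp add: l_def)
  \<comment> \<open>Evaluated twice: by expanding the powers, where the sum over j retains only r
    congruent to m modulo l, and by pairing j with l - j, which leaves j = 0 alone because l is
    odd.\<close>
  define S where "S = (\<Sum>j<l. (2 * cos (pi * real j / real l)) ^ (2*m))"
  have "complex_of_real S = (\<Sum>j<l. \<Sum>r\<le>2*m. of_nat ((2*m) choose r) * cis (2 * pi * real j * of_int (int r - int m) / real l))"
    unfolding S_def of_real_sum two_cos_power_expand by (simp add: mult_ac)
  also have "\<dots> = (\<Sum>r\<le>2*m. of_nat ((2*m) choose r) * (\<Sum>j<l. cis (2 * pi * real j * of_int (int r - int m) / real l)))"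
    by (subst sum.swap) (simp add: sum_distrib_left)
  also have "\<dots> = (\<Sum>r\<le>2*m. of_nat ((2*m) choose r) * (if int l dvd (int r - int m) then of_nat l else 0))"
    by (simp only: sum_cis_multiples[OF l])
  also have "\<dots> = complex_of_real (\<Sum>r\<le>2*m. real ((2*m) choose r) * (if int l dvd (int r - int m) then real l else 0))"
    by (simp add: if_distrib[of of_real] cong: if_cong)
  finally have "S = (\<Sum>r\<le>2*m. real ((2*m) choose r) * (if int l dvd (int r - int m) then real l else 0))"
    by (simp only: of_real_eq_iff)
  also have "\<dots> = real ((2*m) choose m) * real l + (\<Sum>d=1..m. 2 * (if l dvd d then real ((2*m) choose (m + d)) * real l else 0))"
    unfolding sum_symmetric_nat
  proof (intro arg_cong2[where f="(+)"] sum.cong refl)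
    fix d assume d: "d \<in> {1..m}"
    have "(2*m) choose (m - d) = (2*m) choose (m + d)"
      using d binomial_symmetric[of "m - d" "2*m"] by simp
    moreover have "int l dvd (int (m - d) - int m) \<longleftrightarrow> l dvd d" using d by (simp add: of_nat_diff)
    ultimately show "real ((2*m) choose (m + d)) * (if int l dvd (int (m + d) - int m) then real l else 0) +
        real ((2*m) choose (m - d)) * (if int l dvd (int (m - d) - int m) then real l else 0) =
        2 * (if l dvd d then real ((2*m) choose (m + d)) * real l else 0)" by simp
  qed simp
  also have "(\<Sum>d=1..m. 2 * (if l dvd d then real ((2*m) choose (m + d)) * real l else 0))
     = (\<Sum>d\<in>{d\<in>{1..m}. l dvd d}. 2 * (real ((2*m) choose (m + d)) * real l))"
    by (subst sum.inter_filter) (auto intro!: sum.cong)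
  also have "\<dots> = (\<Sum>k\<in>{k\<in>{1..m}. k * l \<le> m}. 2 * (real ((2*m) choose (m + k * l)) * real l))"
    using l by (intro sum.reindex_bij_witness[of _ "\<lambda>k. k * l" "\<lambda>d. d div l"])
      (auto simp: Suc_le_eq div_greater_zero_iff dvd_imp_le intro: order_trans[OF div_le_dividend])
  \<comment> \<open>The added terms vanish, since k l > m puts m + k l above 2m.\<close>
  also have "\<dots> = (\<Sum>k=1..m. 2 * (real ((2*m) choose (m + k * l)) * real l))"
    by (rule sum.mono_neutral_left) auto
  finally have 1: "S = real l * (real ((2*m) choose m) + 2 * (\<Sum>k=1..m. real ((2*m) choose (m + k * l))))"
    by (simp add: sum_distrib_left algebra_simps)
  have "S = 4 ^ m * (\<Sum>j<l. cos (pi * real j / real l) ^ (2*m))"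
    unfolding S_def by (simp add: power_mult_distrib sum_distrib_left power_mult)
  also have "(\<Sum>j<l. cos (pi * real j / real l) ^ (2*m)) = (\<Sum>j\<in>insert 0 ({1..h} \<union> {h+1..2*h}). cos (pi * real j / real l) ^ (2*m))"
    by (rule sum.cong) (auto simp: l_def)
  also have "\<dots> = 1 + ((\<Sum>j=1..h. cos (pi * real j / real l) ^ (2*m)) + (\<Sum>j=h+1..2*h. cos (pi * real j / real l) ^ (2*m)))"
    by (subst sum.insert; simp?; subst sum.union_disjoint; auto)
  also have "(\<Sum>j=h+1..2*h. cos (pi * real j / real l) ^ (2*m)) = (\<Sum>j=1..h. cos (pi * real j / real l) ^ (2*m))"
  proof (rule sum.reindex_bij_witness[of _ "\<lambda>j. l - j" "\<lambda>j. l - j"])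
    fix j assume j: "j \<in> {h+1..2*h}"
    have "pi * real (l - j) / real l = pi - pi * real j / real l"
      using j l by (simp add: l_def of_nat_diff field_simps)
    then show "cos (pi * real (l - j) / real l) ^ (2*m) = cos (pi * real j / real l) ^ (2*m)"
      by (simp add: power_mult cos_diff)
  qed (auto simp: l_def)
  finally show ?thesis using 1 by simp
qed


section \<open>Passage to the limit in the finite identity\<close>

text \<open>The derivative of cos u exp(u^2/2) has the sign of u cos u - sin u, which is nonpositive
  on the interval. This is the Gaussian majorant for the cosine sum.\<close>

lemma cos_le_exp_half_square:
  fixes u :: real
  assumes "0 \<le> u" "u \<le> pi / 2"
  shows "cos u \<le> exp (- (u^2) / 2)"
proof -
  define f where "f = (\<lambda>u::real. cos u * exp (u^2/2))"
  have "f u \<le> f 0"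
  proof (rule DERIV_nonpos_imp_nonincreasing[OF assms(1)])
    fix x assume x: "0 \<le> x" "x \<le> u"
    have "(f has_real_derivative ((x * cos x - sin x) * exp (x^2/2))) (at x)"
      unfolding f_def by (auto intro!: derivative_eq_intros simp: algebra_simps)
    moreover have "x * cos x \<le> sin x"
    proof -
      have "sin 0 - 0 * cos 0 \<le> sin x - x * cos x"
      proof (rule DERIV_nonneg_imp_nondecreasing[OF x(1)])
        fix y assume y: "0 \<le> y" "y \<le> x"
        have "((\<lambda>x. sin x - x * cos x) has_real_derivative y * sin y) (at y)"
          by (auto intro!: derivative_eq_intros)
        moreover have "y * sin y \<ge> 0" using y x assms by (intro mult_nonneg_nonneg sin_ge_zero) auto
        ultimately show "\<exists>z. ((\<lambda>x. sin x - x * cos x) has_real_derivative z) (at y) \<and> 0 \<le> z" by blast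
      qed
      then show ?thesis by simp
    qed
    ultimately show "\<exists>y. (f has_real_derivative y) (at x) \<and> y \<le> 0"
      by (intro exI[of _ "(x * cos x - sin x) * exp (x^2/2)"] conjI mult_nonpos_nonneg) auto
  qed
  then have "cos u * exp (u^2/2) \<le> 1" by (simp add: f_def)
  then show ?thesis by (simp add: exp_minus field_simps)
qed

text \<open>Squeezed by 1 - c \<le> exp(-c) and 1/(1-c) \<le> exp(c/(1-c)), raised to the m-th
  power; \<open>c m\<close> tends to 0 because \<open>m * c m\<close> converges.\<close>

lemma tendsto_one_minus_power:
  fixes c :: "nat \<Rightarrow> real"
  assumes lim: "(\<lambda>m. real m * c m) \<longlonglongrightarrow> L" and c0: "\<And>m. c m \<ge> 0"
  shows "(\<lambda>m. (1 - c m) ^ m) \<longlonglongrightarrow> exp (- L)"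
proof -
  have "(\<lambda>m. (real m * c m) * (1 / real m)) \<longlonglongrightarrow> L * 0"
    by (intro tendsto_mult lim) real_asymp
  moreover have "eventually (\<lambda>m. (real m * c m) * (1 / real m) = c m) sequentially"
    using eventually_gt_at_top[of 0] by eventually_elim auto
  ultimately have c: "c \<longlonglongrightarrow> 0" by (simp add: tendsto_cong)
  have ev: "eventually (\<lambda>m. c m < 1) sequentially"
    using order_tendstoD(2)[OF c zero_less_one] .
  have A: "(\<lambda>m. exp (- (real m * c m / (1 - c m)))) \<longlonglongrightarrow> exp (- (L / (1 - 0)))"
    by (intro tendsto_intros lim c) auto
  have B: "(\<lambda>m. exp (- (real m * c m))) \<longlonglongrightarrow> exp (- L)"
    by (intro tendsto_intros lim)
  show ?thesis
  proof (rule tendsto_sandwich[OF _ _ _ B])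
    show "eventually (\<lambda>m. exp (- (real m * c m / (1 - c m))) \<le> (1 - c m) ^ m) sequentially"
      using ev
    proof eventually_elim
      case (elim m)
      have "1 / (1 - c m) = 1 + c m / (1 - c m)" using elim by (simp add: field_simps)
      also have "\<dots> \<le> exp (c m / (1 - c m))" by (rule exp_ge_add_one_self)
      finally have "exp (- (c m / (1 - c m))) \<le> 1 - c m"
        using elim by (simp add: exp_minus field_simps)
      then have "exp (- (c m / (1 - c m))) ^ m \<le> (1 - c m) ^ m" by (intro power_mono) auto
      then show ?case by (simp add: exp_of_nat_mult[symmetric])
    qed
    show "eventually (\<lambda>m. (1 - c m) ^ m \<le> exp (- (real m * c m))) sequentially"
      using ev
    proof eventually_elim
      case (elim m)
      have "1 - c m \<le> exp (- c m)" using exp_ge_add_one_self[of "- c m"] by simp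
      then have "(1 - c m) ^ m \<le> exp (- c m) ^ m" using elim by (intro power_mono) auto
      then show ?case by (simp add: exp_of_nat_mult[symmetric])
    qed
  qed (use A in simp)
qed

text \<open>The terms n \<ge> 1 of Jacobi's theta series; the sum over all integers is
  \<open>1 + 2 * theta_tail x\<close>.\<close>

definition theta_tail :: "real \<Rightarrow> real" where
  "theta_tail x = (\<Sum>n. exp (- (pi * (real (Suc n))^2 * x)))"

lemma summable_exp_square:
  fixes c :: real
  assumes "c > 0"
  shows "summable (\<lambda>n. exp (- (c * (real (Suc n))^2)))"
proof (rule summable_comparison_test)
  show "\<exists>N. \<forall>n\<ge>N. norm (exp (- (c * (real (Suc n))^2))) \<le> exp (- c) * exp (- c) ^ n"
  proof (intro exI allI impI)
    fix n :: nat
    have "real (Suc n) \<le> (real (Suc n))^2" by (simp add: power2_eq_square)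
    then have "c * real (Suc n) \<le> c * (real (Suc n))^2" using assms by (intro mult_left_mono) auto
    then show "norm (exp (- (c * (real (Suc n))^2))) \<le> exp (- c) * exp (- c) ^ n"
      by (simp add: exp_of_nat_mult[symmetric] exp_add[symmetric] algebra_simps)
  qed
  show "summable (\<lambda>n. exp (- c) * exp (- c) ^ n)"
    using assms by (intro summable_mult summable_geometric) auto
qed

lemma summable_theta_tail:
  assumes "x > 0"
  shows "summable (\<lambda>n. exp (- (pi * (real (Suc n))^2 * x)))"
  using summable_exp_square[of "pi * x"] assms by (simp add: mult_ac)

text \<open>The odd number lies within 1 of t sqrt m. These are the moduli l = 2h + 1 for which the
  finite identity is taken to the limit.\<close>

lemma sqrt_scaled_odd_limit:
  fixes t :: real
  assumes t: "t > 0"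
  shows "(\<lambda>m. real (2 * nat \<lfloor>t * sqrt (real m) / 2\<rfloor> + 1) / sqrt (real m)) \<longlonglongrightarrow> t"
proof -
  define q where "q = (\<lambda>m. real (2 * nat \<lfloor>t * sqrt (real m) / 2\<rfloor> + 1))"
  have q: "t * sqrt (real m) - 1 \<le> q m" "q m \<le> t * sqrt (real m) + 1" for m
  proof -
    have "0 \<le> \<lfloor>t * sqrt (real m) / 2\<rfloor>" using t by simp
    then have e: "real (nat \<lfloor>t * sqrt (real m) / 2\<rfloor>) = of_int \<lfloor>t * sqrt (real m) / 2\<rfloor>" by simp
    show "t * sqrt (real m) - 1 \<le> q m" "q m \<le> t * sqrt (real m) + 1"
      unfolding q_def of_nat_add of_nat_mult e by simp_all linarith+
  qed
  have "(\<lambda>m. q m / sqrt (real m)) \<longlonglongrightarrow> t"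
  proof (rule tendsto_sandwich)
    show "(\<lambda>m. (t * sqrt (real m) - 1) / sqrt (real m)) \<longlonglongrightarrow> t" by real_asymp
    show "(\<lambda>m. (t * sqrt (real m) + 1) / sqrt (real m)) \<longlonglongrightarrow> t" by real_asymp
  qed (auto intro!: always_eventually divide_right_mono q)
  then show ?thesis by (simp only: q_def)
qed

lemma tannery_sequentially:
  fixes a :: "nat \<Rightarrow> nat \<Rightarrow> 'a :: {real_normed_algebra, banach}"
  assumes lim: "\<And>k. a k \<longlonglongrightarrow> b k"
    and ev: "eventually (\<lambda>n. \<forall>k. norm (a k n) \<le> M k) sequentially" and M: "summable M"
  shows "(\<lambda>n. \<Sum>k. a k n) \<longlonglongrightarrow> (\<Sum>k. b k)"
proof -
  have "eventually (\<lambda>(k, n). norm (a k n) \<le> M k) (at_top \<times>\<^sub>F sequentially)"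
    using eventually_prodI[OF eventually_True ev, of at_top] by (rule eventually_mono) auto
  from tannerys_theorem[OF lim this M] show ?thesis by simp
qed

lemma sum_eq_suminf_if:
  fixes f :: "nat \<Rightarrow> 'a :: {comm_monoid_add, t2_space}"
  shows "(\<Sum>k=1..h. f k) = (\<Sum>k. if Suc k \<le> h then f (Suc k) else 0)"
proof -
  have "(\<Sum>k. if Suc k \<le> h then f (Suc k) else 0) = (\<Sum>k<h. f (Suc k))"
    by (subst suminf_finite[of "{..<h}"]) auto
  also have "\<dots> = (\<Sum>k=1..h. f k)"
    by (rule sum.reindex_bij_witness[of _ "\<lambda>k. k - 1" Suc]) auto
  finally show ?thesis ..
qed

text \<open>The j-th power is (1 - sin^2 x)^m with x = pi j / l, and m sin^2 x tends to (pi j / t)^2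
  because l ~ t sqrt m. \<open>cos_le_exp_half_square\<close> supplies a summable majorant for all
  large m.\<close>

lemma polya_cos_limit:
  fixes t :: real and h :: "nat \<Rightarrow> nat"
  assumes t: "t > 0" and lim: "(\<lambda>m. real (2 * h m + 1) / sqrt (real m)) \<longlonglongrightarrow> t"
  shows "(\<lambda>m. \<Sum>j=1..h m. cos (pi * real j / real (2 * h m + 1)) ^ (2*m)) \<longlonglongrightarrow> theta_tail (pi / t^2)"
proof -
  define l where "l = (\<lambda>m. real (2 * h m + 1))"
  have lpos: "l m > 0" for m by (simp add: l_def)
  have lim': "(\<lambda>m. l m / sqrt (real m)) \<longlonglongrightarrow> t" unfolding l_def by (rule lim)
  define a where "a = (\<lambda>j m. if Suc j \<le> h m then cos (pi * real (Suc j) / l m) ^ (2*m) else 0)"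
  have eq: "(\<Sum>j=1..h m. cos (pi * real j / real (2 * h m + 1)) ^ (2*m)) = (\<Sum>j. a j m)" for m
    unfolding sum_eq_suminf_if a_def l_def ..
  have linf: "filterlim l at_top sequentially"
  proof -
    have "filterlim (\<lambda>m. (l m / sqrt (real m)) * sqrt (real m)) at_top sequentially"
      by (rule filterlim_tendsto_pos_mult_at_top[OF lim' t])
         (rule filterlim_compose[OF sqrt_at_top filterlim_real_sequentially])
    moreover have "eventually (\<lambda>m. (l m / sqrt (real m)) * sqrt (real m) = l m) sequentially"
      using eventually_gt_at_top[of 0] by eventually_elim auto
    ultimately show ?thesis using filterlim_cong by fast
  qed
  have msq: "(\<lambda>m. real m / (l m)^2) \<longlonglongrightarrow> 1 / t^2"
  proof -
    have "(\<lambda>m. 1 / (l m / sqrt (real m))^2) \<longlonglongrightarrow> 1 / t^2"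
      using t by (intro tendsto_intros lim') auto
    then show ?thesis by (simp add: power_divide)
  qed
  have limit: "(a j \<longlongrightarrow> exp (- (pi * (real (Suc j))^2 * (pi / t^2)))) sequentially" for j
  proof -
    define x where "x = (\<lambda>m. pi * real (Suc j) / l m)"
    have x0: "x \<longlonglongrightarrow> 0"
      unfolding x_def by (rule tendsto_divide_0[OF tendsto_const]) (rule filterlim_at_top_imp_at_infinity[OF linf])
    have xpos: "x m > 0" for m unfolding x_def using lpos by (intro divide_pos_pos mult_pos_pos) auto
    have sinx: "(\<lambda>m. sin (x m) / x m) \<longlonglongrightarrow> 1"
    proof -
      have "((\<lambda>x::real. sin x / x) \<longlongrightarrow> 1) (at 0)" by real_asymp
      moreover have "filterlim x (at 0) sequentially"
        using x0 xpos by (intro filterlim_atI always_eventually) (auto simp: less_le)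
      ultimately show ?thesis by (rule filterlim_compose)
    qed
    have "(\<lambda>m. (sin (x m) / x m)^2 * ((pi * real (Suc j))^2 * (real m / (l m)^2))) \<longlonglongrightarrow> 1^2 * ((pi * real (Suc j))^2 * (1 / t^2))"
      by (intro tendsto_mult tendsto_power sinx msq tendsto_const)
    moreover have "(sin (x m) / x m)^2 * ((pi * real (Suc j))^2 * (real m / (l m)^2)) = real m * (sin (x m))^2" for m
    proof -
      have "(pi * real (Suc j))^2 * (real m / (l m)^2) = (x m)^2 * real m" unfolding x_def by (simp add: power_divide)
      then show ?thesis using xpos[of m] by (simp add: power_divide)
    qed
    ultimately have "(\<lambda>m. real m * (sin (x m))^2) \<longlonglongrightarrow> (pi * real (Suc j))^2 * (1 / t^2)" by simp
    from tendsto_one_minus_power[OF this]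
    have "(\<lambda>m. (1 - (sin (x m))^2) ^ m) \<longlonglongrightarrow> exp (- ((pi * real (Suc j))^2 * (1 / t^2)))" by simp
    moreover have "eventually (\<lambda>m. (1 - (sin (x m))^2) ^ m = a j m) sequentially"
    proof -
      have "eventually (\<lambda>m. l m > 2 * real (Suc j) + 1) sequentially"
        using linf by (simp add: filterlim_at_top_dense)
      then show ?thesis
      proof eventually_elim
        case (elim m)
        have "1 - (sin (x m))^2 = (cos (x m))^2" by (simp add: sin_squared_eq)
        then have "(1 - (sin (x m))^2) ^ m = cos (x m) ^ (2 * m)" by (simp add: power_mult)
        then show ?case using elim by (simp add: a_def x_def l_def)
      qed
    qed
    ultimately have "a j \<longlonglongrightarrow> exp (- ((pi * real (Suc j))^2 * (1 / t^2)))" by (simp add: tendsto_cong)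
    also have "(pi * real (Suc j))^2 * (1 / t^2) = pi * (real (Suc j))^2 * (pi / t^2)" by (simp add: power2_eq_square)
    finally show ?thesis .
  qed
  \<comment> \<open>Half the limiting exponent, available as soon as m / l^2 exceeds half its
    limit.\<close>
  define c where "c = pi^2 / (2 * t^2)"
  have c: "c > 0" using t by (simp add: c_def)
  have ev: "eventually (\<lambda>m. real m / (l m)^2 > 1 / (2 * t^2)) sequentially"
    by (rule order_tendstoD(1)[OF msq]) (use t in \<open>simp add: field_simps\<close>)
  have bound: "eventually (\<lambda>n. \<forall>k. norm (a k n) \<le> exp (- (c * (real (Suc k))^2))) sequentially"
    using ev
  proof eventually_elim
    case n: (elim n)
    show ?case
    proof
      fix k
      show "norm (a k n) \<le> exp (- (c * (real (Suc k))^2))"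
      proof (cases "Suc k \<le> h n")
        case True
        define u where "u = pi * real (Suc k) / l n"
        have "real (Suc k) / l n \<le> 1 / 2" using True lpos[of n] by (simp add: l_def divide_simps)
        from mult_left_mono[OF this pi_ge_zero] have u: "0 \<le> u" "u \<le> pi / 2"
          using lpos[of n] by (auto simp: u_def)
        have c0: "cos u \<ge> 0" using u by (intro cos_ge_zero) auto
        have "norm (a k n) = cos u ^ (2 * n)" using True c0 by (simp add: a_def u_def)
        also have "\<dots> \<le> exp (- (u^2) / 2) ^ (2*n)"
          by (intro power_mono cos_le_exp_half_square u c0)
        also have "\<dots> = exp (- (real n * u^2))" by (simp add: exp_of_nat_mult[symmetric])
        also have "\<dots> \<le> exp (- (c * (real (Suc k))^2))"
        proof -
          have "c * (real (Suc k))^2 = (pi * real (Suc k))^2 * (1 / (2 * t^2))" by (simp add: c_def power_mult_distrib)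
          also have "\<dots> \<le> (pi * real (Suc k))^2 * (real n / (l n)^2)" using n by (intro mult_left_mono) auto
          also have "\<dots> = real n * u^2" by (simp add: u_def power_divide)
          finally show ?thesis by simp
        qed
        finally show ?thesis .
      qed (auto simp: a_def)
    qed
  qed
  from tannery_sequentially[OF limit bound summable_exp_square[OF c]] show ?thesis
    unfolding eq theta_tail_def .
qed

text \<open>The k-th term is a coefficient at distance k l ~ k t sqrt m from the centre, so the
  local limit theorem gives exp(-(k t)^2).\<close>

lemma polya_binomial_limit:
  fixes t :: real and l :: "nat \<Rightarrow> nat"
  assumes t: "t > 0" and lim: "(\<lambda>m. real (l m) / sqrt (real m)) \<longlonglongrightarrow> t"
  shows "(\<lambda>m. \<Sum>k=1..m. real ((2*m) choose (m + k * l m)) / real ((2*m) choose m)) \<longlonglongrightarrow> theta_tail (t^2 / pi)"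
proof -
  define a where "a = (\<lambda>k m. if Suc k \<le> m then real ((2*m) choose (m + Suc k * l m)) / real ((2*m) choose m) else 0)"
  have eq: "(\<Sum>k=1..m. real ((2*m) choose (m + k * l m)) / real ((2*m) choose m)) = (\<Sum>k. a k m)" for m
    unfolding sum_eq_suminf_if a_def ..
  have limit: "(a k \<longlongrightarrow> exp (- (pi * (real (Suc k))^2 * (t^2 / pi)))) sequentially" for k
  proof -
    have "(\<lambda>m. real (Suc k) * (real (l m) / sqrt (real m))) \<longlonglongrightarrow> real (Suc k) * t"
      by (intro tendsto_mult lim tendsto_const)
    then have "(\<lambda>m. real (Suc k * l m) / sqrt (real m)) \<longlonglongrightarrow> real (Suc k) * t"
      by (simp only: of_nat_mult times_divide_eq_right)
    from central_binomial_ratio_limit[OF this]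
    have "(\<lambda>m. real ((2*m) choose (m + Suc k * l m)) / real ((2*m) choose m)) \<longlonglongrightarrow> exp (- ((real (Suc k) * t)^2))" .
    moreover have "eventually (\<lambda>m. real ((2*m) choose (m + Suc k * l m)) / real ((2*m) choose m) = a k m) sequentially"
      using eventually_ge_at_top[of "Suc k"] by eventually_elim (simp only: a_def if_True)
    ultimately have "a k \<longlonglongrightarrow> exp (- ((real (Suc k) * t)^2))" by (rule Lim_transform_eventually)
    then show ?thesis by (simp add: power_mult_distrib)
  qed
  \<comment> \<open>The limiting exponent t^2 is halved twice: once by the denominator
    \<open>m + R\<close> with R = m, once because l^2 / m is only known to exceed half its
    limit.\<close>
  define c where "c = t^2 / 4"
  have c: "c > 0" using t by (simp add: c_def)
  have "(\<lambda>m. (real (l m) / sqrt (real m))^2) \<longlonglongrightarrow> t^2" by (intro tendsto_power lim)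
  then have "eventually (\<lambda>m. (real (l m) / sqrt (real m))^2 > t^2 / 2) sequentially"
    by (rule order_tendstoD(1)) (use t in simp)
  then have ev: "eventually (\<lambda>m. (real (l m))^2 / real m > t^2 / 2) sequentially"
    by (simp add: power_divide)
  have bound: "eventually (\<lambda>n. \<forall>k. norm (a k n) \<le> exp (- (c * (real (Suc k))^2))) sequentially"
    using ev
  proof eventually_elim
    case n: (elim n)
    show ?case
    proof
      fix k
      show "norm (a k n) \<le> exp (- (c * (real (Suc k))^2))"
      proof (cases "Suc k \<le> n \<and> Suc k * l n \<le> n")
        case True
        then have n0: "n > 0" by simp
        let ?r = "Suc k * l n"
        have pos: "real ((2*n) choose n) > 0" by simp
        have "norm (a k n) = real ((2*n) choose (n + ?r)) / real ((2*n) choose n)" using True by (simp add: a_def)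
        also have "\<dots> \<le> exp (- ((real ?r)^2) / (real n + real n))"
          using central_binomial_ratio_bounds(1)[of ?r n n] True n0 pos by (simp only: pos_divide_le_eq) (simp add: mult.commute)
        also have "\<dots> \<le> exp (- (c * (real (Suc k))^2))"
        proof -
          have "c * (real (Suc k))^2 = (real (Suc k))^2 / 2 * (t^2 / 2)" by (simp add: c_def)
          also have "\<dots> \<le> (real (Suc k))^2 / 2 * ((real (l n))^2 / real n)" using n by (intro mult_left_mono) auto
          also have "\<dots> = (real ?r)^2 / (real n + real n)" by (simp only: of_nat_mult power_mult_distrib) simp
          finally show ?thesis by simp
        qed
        finally show ?thesis .
      next
        case False
        then have "a k n = 0" by (auto simp: a_def)
        then show ?thesis by simp
      qed
    qed
  qed
  from tannery_sequentially[OF limit bound summable_exp_square[OF c]] show ?thesis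
    unfolding eq theta_tail_def .
qed

lemma theta_tail_nonneg: "x > 0 \<Longrightarrow> theta_tail x \<ge> 0"
  unfolding theta_tail_def by (intro suminf_nonneg summable_theta_tail) auto

text \<open>The normalised central binomial coefficient \<kappa> does not depend on t, while by the
  finite identity \<open>t * \<kappa> m\<close> converges to a quotient of two theta values.
  Comparing t = sqrt (pi x) with t = sqrt pi eliminates \<kappa>.\<close>

theorem theta_modular:
  assumes x: "x > 0"
  shows "1 + 2 * theta_tail (1 / x) = sqrt x * (1 + 2 * theta_tail x)"
proof -
  define \<kappa> where "\<kappa> = (\<lambda>m. sqrt (real m) * real ((2*m) choose m) / 4 ^ m)"
  have main: "((\<lambda>m. t * \<kappa> m) \<longlongrightarrow> (1 + 2 * theta_tail (pi / t^2)) / (1 + 2 * theta_tail (t^2 / pi))) sequentially"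
    if t: "t > 0" for t
  proof -
    define h where "h = (\<lambda>m. nat \<lfloor>t * sqrt (real m) / 2\<rfloor>)"
    define l where "l = (\<lambda>m. 2 * h m + 1)"
    have lim: "(\<lambda>m. real (l m) / sqrt (real m)) \<longlonglongrightarrow> t"
      unfolding l_def h_def by (rule sqrt_scaled_odd_limit[OF t])
    define A where "A = (\<lambda>m. \<Sum>j=1..h m. cos (pi * real j / real (l m)) ^ (2*m))"
    define B where "B = (\<lambda>m. \<Sum>k=1..m. real ((2*m) choose (m + k * l m)) / real ((2*m) choose m))"
    have limA: "A \<longlonglongrightarrow> theta_tail (pi / t^2)"
      using polya_cos_limit[OF t, of h] lim unfolding A_def l_def by simp
    have limB: "B \<longlonglongrightarrow> theta_tail (t^2 / pi)"
      using polya_binomial_limit[OF t lim] unfolding B_def .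
    have B0: "1 + 2 * theta_tail (t^2 / pi) \<noteq> 0"
      using theta_tail_nonneg[of "t^2 / pi"] t by (smt (verit) divide_pos_pos pi_gt_zero zero_less_power)
    have B0': "B m \<ge> 0" for m unfolding B_def by (intro sum_nonneg) auto
    have id: "1 + 2 * A m = real (l m) * (real ((2*m) choose m) / 4 ^ m) * (1 + 2 * B m)" for m
    proof -
      have "4 ^ m * (1 + 2 * A m) = real (l m) * (real ((2*m) choose m) + 2 * (\<Sum>k=1..m. real ((2*m) choose (m + k * l m))))"
        using polya_identity[of m "h m"] unfolding A_def l_def by simp
      also have "(\<Sum>k=1..m. real ((2*m) choose (m + k * l m))) = real ((2*m) choose m) * B m"
        unfolding B_def sum_distrib_left by simp
      finally show ?thesis by (simp add: field_simps)
    qed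
    have "(\<lambda>m. (1 / (real (l m) / sqrt (real m))) * ((1 + 2 * A m) / (1 + 2 * B m))) \<longlonglongrightarrow>
        (1 / t) * ((1 + 2 * theta_tail (pi / t^2)) / (1 + 2 * theta_tail (t^2 / pi)))"
      using t B0 by (intro tendsto_intros lim limA limB) auto
    moreover have "(1 / (real (l m) / sqrt (real m))) * ((1 + 2 * A m) / (1 + 2 * B m)) = \<kappa> m" for m
    proof -
      have D: "1 + 2 * B m > 0" using B0'[of m] by linarith
      have L: "real (l m) > 0" by (simp add: l_def)
      have "(1 + 2 * A m) / (1 + 2 * B m) = real (l m) * (real ((2*m) choose m) / 4 ^ m)"
        unfolding id using D by (simp only: nonzero_mult_div_cancel_right)
      then show ?thesis unfolding \<kappa>_def using L by simp
    qed
    ultimately have "\<kappa> \<longlonglongrightarrow> (1 / t) * ((1 + 2 * theta_tail (pi / t^2)) / (1 + 2 * theta_tail (t^2 / pi)))" by simp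
    then have "(\<lambda>m. t * \<kappa> m) \<longlonglongrightarrow> t * ((1 / t) * ((1 + 2 * theta_tail (pi / t^2)) / (1 + 2 * theta_tail (t^2 / pi))))"
      by (intro tendsto_intros)
    then show ?thesis using t by simp
  qed
  have nz: "1 + 2 * theta_tail y > 0" if "y > 0" for y using theta_tail_nonneg[OF that] by linarith
  \<comment> \<open>The self-dual case \<open>x = 1\<close> evaluates the limit of \<open>\<kappa>\<close>, so no asymptotics of the central binomial coefficient is needed.\<close>
  have "(\<lambda>m. sqrt pi * \<kappa> m) \<longlonglongrightarrow> 1" using main[of "sqrt pi"] nz[of 1] by simp
  then have k: "(\<lambda>m. sqrt x * (sqrt pi * \<kappa> m)) \<longlonglongrightarrow> sqrt x * 1" by (intro tendsto_intros)
  have "(\<lambda>m. sqrt (pi * x) * \<kappa> m) \<longlonglongrightarrow> (1 + 2 * theta_tail (1/x)) / (1 + 2 * theta_tail x)"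
    using main[of "sqrt (pi * x)"] x by simp
  moreover have "sqrt (pi * x) * \<kappa> m = sqrt x * (sqrt pi * \<kappa> m)" for m by (simp add: real_sqrt_mult)
  ultimately have "(1 + 2 * theta_tail (1/x)) / (1 + 2 * theta_tail x) = sqrt x"
    using k LIMSEQ_unique by fastforce
  then show ?thesis using nz[OF x] by (simp add: field_simps)
qed

section \<open>The entire part of the completed zeta function\<close>

text \<open>Since n^2 \<ge> n, the series lies below a geometric one with ratio q = exp(-pi x) \<le>
  1/2, whence the factor 2.\<close>

lemma theta_tail_le:
  assumes "x \<ge> 1"
  shows "theta_tail x \<le> 2 * exp (- (pi * x))"
proof -
  define q where "q = exp (- (pi * x))"
  have "pi * x \<ge> 1 * 1" using assms pi_gt3 by (intro mult_mono) auto
  then have "exp (pi * x) \<ge> 2" using exp_ge_add_one_self[of "pi * x"] by linarith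
  then have q: "q \<le> 1 / 2" "q > 0" by (auto simp: q_def exp_minus field_simps)
  have "theta_tail x \<le> (\<Sum>n. q * q ^ n)"
    unfolding theta_tail_def
  proof (rule suminf_le)
    fix n :: nat
    have "real (Suc n) \<le> (real (Suc n))^2" by (simp add: power2_eq_square)
    then have "pi * x * real (Suc n) \<le> pi * x * (real (Suc n))^2" using assms by (intro mult_left_mono) auto
    then show "exp (- (pi * (real (Suc n))^2 * x)) \<le> q * q ^ n"
      by (simp add: q_def exp_of_nat_mult[symmetric] exp_add[symmetric] algebra_simps)
  next
    show "summable (\<lambda>n. exp (- (pi * (real (Suc n))^2 * x)))" using assms by (intro summable_theta_tail) auto
    show "summable (\<lambda>n. q * q ^ n)" using q by (intro summable_mult summable_geometric) auto
  qed
  also have "\<dots> = q / (1 - q)" using q by (subst suminf_mult) (auto simp: suminf_geometric intro!: summable_geometric)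
  also have "\<dots> \<le> q / (1 / 2)" using q by (intro divide_left_mono) auto
  finally show ?thesis by (simp add: q_def)
qed

lemma continuous_on_theta_tail: "continuous_on {0<..} theta_tail"
proof -
  have 1: "continuous_on {x0..} theta_tail" if "x0 > 0" for x0
    unfolding theta_tail_def
  proof (rule uniform_limit_theorem)
    show "uniform_limit {x0..} (\<lambda>N x. \<Sum>n<N. exp (- (pi * (real (Suc n))^2 * x)))
       (\<lambda>x. \<Sum>n. exp (- (pi * (real (Suc n))^2 * x))) sequentially"
    proof (rule Weierstrass_m_test)
      show "summable (\<lambda>n. exp (- (pi * (real (Suc n))^2 * x0)))" by (rule summable_theta_tail[OF that])
    qed (auto intro!: mult_left_mono)
  qed (auto intro!: always_eventually continuous_intros)
  show ?thesis
  proof (rule continuous_at_imp_continuous_on, safe)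
    fix x :: real assume "0 < x"
    then show "isCont theta_tail x"
      using continuous_on_interior[OF 1[of "x/2"], of x] by (simp add: interior_real_atLeast)
  qed
qed

text \<open>
  The substitution \<open>x = exp (2 u)\<close> turns Riemann's integral representation of \<open>\<xi>\<close> into an
  integral over the real line in which \<open>s \<mapsto> 1 - s\<close> corresponds to \<open>u \<mapsto> - u\<close>.
\<close>

definition theta_kernel :: "real \<Rightarrow> real" where
  "theta_kernel u = 2 * theta_tail (exp (2 * u))"

lemma continuous_on_theta_kernel [continuous_intros]: "continuous_on A theta_kernel"
  unfolding theta_kernel_def
  by (intro continuous_intros continuous_on_compose2[OF continuous_on_theta_tail]) auto

lemma theta_kernel_nonneg: "theta_kernel u \<ge> 0"
  unfolding theta_kernel_def by (simp add: theta_tail_nonneg)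

lemma theta_kernel_le:
  assumes "u \<ge> 0"
  shows "theta_kernel u \<le> 4 * exp (- (pi * exp (2 * u)))"
  using theta_tail_le[of "exp (2 * u)"] assms by (simp add: theta_kernel_def)

text \<open>The modular law at x = exp(2u), where sqrt x = exp u. The terms exp u - 1 are the source
  of the poles of the completed zeta function.\<close>

lemma theta_kernel_minus:
  "theta_kernel (- u) = exp u * theta_kernel u + exp u - 1"
proof -
  have "sqrt (exp (2 * u)) = exp u"
    by (metis exp_double exp_ge_zero real_sqrt_abs abs_of_nonneg)
  moreover have "1 / exp (2 * u) = exp (2 * (- u))" by (simp add: exp_minus field_simps)
  ultimately have "1 + theta_kernel (- u) = exp u * (1 + theta_kernel u)"
    using theta_modular[of "exp (2 * u)"] unfolding theta_kernel_def by simp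
  then show ?thesis by (simp add: algebra_simps)
qed

section \<open>The folded Mellin integral as an entire function\<close>

text \<open>The half-line u < 0 is already folded onto u > 0, so that the invariance under s
  \<mapsto> 1 - s is visible in the integrand.\<close>

definition xi_integrand :: "complex \<Rightarrow> real \<Rightarrow> complex" where
  "xi_integrand s u = of_real (theta_kernel u) * (exp (s * of_real u) + exp ((1 - s) * of_real u))"

text \<open>Cutting the improper integral at the integers makes it a series: each piece is entire as
  a parameter integral over a compact interval, and the convergence is locally uniform in s.\<close>

definition xi_piece :: "nat \<Rightarrow> complex \<Rightarrow> complex" where
  "xi_piece N s = integral {real N..real (Suc N)} (xi_integrand s)"

definition xi_entire :: "complex \<Rightarrow> complex" where
  "xi_entire s = (\<Sum>N. xi_piece N s)"

lemma continuous_on_xi_integrand [continuous_intros]: "continuous_on A (xi_integrand s)"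
  unfolding xi_integrand_def[abs_def] by (intro continuous_intros)

lemma xi_integrand_integrable: "xi_integrand s integrable_on {a..b}"
  by (intro integrable_continuous_real continuous_intros)

lemma xi_piece_holomorphic: "xi_piece N holomorphic_on UNIV"
proof -
  have "(\<lambda>s. integral (cbox (real N) (real (Suc N))) (xi_integrand s)) holomorphic_on UNIV"
  proof (rule leibniz_rule_holomorphic)
    fix s :: complex and u :: real
    show "((\<lambda>s. xi_integrand s u) has_field_derivative
        of_real (theta_kernel u) * (of_real u * exp (s * of_real u) - of_real u * exp ((1 - s) * of_real u))) (at s within UNIV)"
      unfolding xi_integrand_def by (auto intro!: derivative_eq_intros simp: algebra_simps)
  next
    fix s :: complex
    show "xi_integrand s integrable_on cbox (real N) (real (Suc N))"
      using xi_integrand_integrable by simp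
  next
    have "continuous_on (UNIV \<times> cbox (real N) (real (Suc N))) (\<lambda>p::complex \<times> real. theta_kernel (snd p))"
      by (intro continuous_on_compose2[OF continuous_on_theta_kernel] continuous_intros) auto
    then show "continuous_on (UNIV \<times> cbox (real N) (real (Suc N)))
        (\<lambda>(s, u). of_real (theta_kernel u) * (of_real u * exp (s * of_real u) - of_real u * exp ((1 - s) * of_real u)) :: complex)"
      unfolding case_prod_beta by (intro continuous_intros)
  qed simp
  then show ?thesis by (simp add: xi_piece_def[abs_def])
qed

text \<open>The doubly exponential decay of the kernel beats exp(R u): completing the square gives
  (R+1) u \<le> (R+1)^2/4 + u^2, and u^2 \<le> exp(2u).\<close>

lemma norm_xi_integrand_le:
  assumes "u \<ge> 0" "\<bar>Re s\<bar> + 1 \<le> R"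
  shows "norm (xi_integrand s u) \<le> 8 * exp ((R + 1)^2 / 4) * exp (- u)"
proof -
  have a: "norm (exp (s * of_real u)) \<le> exp (R * u)" "norm (exp ((1 - s) * of_real u)) \<le> exp (R * u)"
    using assms by (auto simp: norm_exp_eq_Re intro!: mult_right_mono)
  have "norm (exp (s * of_real u) + exp ((1 - s) * of_real u)) \<le> 2 * exp (R * u)"
    using norm_triangle_ineq[of "exp (s * of_real u)" "exp ((1 - s) * of_real u)"] a by linarith
  then have "norm (xi_integrand s u) \<le> theta_kernel u * (2 * exp (R * u))"
    unfolding xi_integrand_def norm_mult using theta_kernel_nonneg[of u] by (intro mult_mono) auto
  also have "\<dots> \<le> (4 * exp (- (pi * exp (2 * u)))) * (2 * exp (R * u))"
    by (intro mult_right_mono theta_kernel_le assms) auto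
  also have "\<dots> = 8 * exp (R * u - pi * exp (2 * u))" by (simp add: exp_diff exp_minus field_simps)
  also have "\<dots> \<le> 8 * exp ((R + 1)^2 / 4 - u)"
  proof -
    have "u \<le> exp u" using exp_ge_add_one_self[of u] by linarith
    then have "u^2 \<le> (exp u)^2" using assms by (intro power_mono) auto
    also have "\<dots> = exp (2 * u)" by (simp add: exp_double)
    also have "1 * exp (2 * u) \<le> pi * exp (2 * u)" using pi_gt3 by (intro mult_right_mono) auto
    finally have "u^2 \<le> pi * exp (2 * u)" by simp
    moreover have "(R + 1) * u \<le> (R + 1)^2 / 4 + u^2"
      using zero_le_power2[of "u - (R + 1) / 2"] by (simp add: power2_eq_square algebra_simps)
    ultimately show ?thesis by (simp add: algebra_simps)
  qed
  also have "\<dots> = 8 * exp ((R + 1)^2 / 4) * exp (- u)" unfolding mult.assoc exp_add[symmetric] by simp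
  finally show ?thesis .
qed

lemma norm_xi_piece_le:
  assumes "\<And>u. u \<in> {real N..real (Suc N)} \<Longrightarrow> norm (xi_integrand s u) \<le> C * exp (- u)" and "C \<ge> 0"
  shows "norm (xi_piece N s) \<le> C * exp (- 1) ^ N"
proof -
  have "norm (xi_piece N s) \<le> integral {real N..real (Suc N)} (\<lambda>u. C * exp (- real N))"
    unfolding xi_piece_def
  proof (rule integral_norm_bound_integral[OF xi_integrand_integrable])
    fix u assume u: "u \<in> {real N..real (Suc N)}"
    have "C * exp (- u) \<le> C * exp (- real N)" using u assms(2) by (intro mult_left_mono) auto
    then show "norm (xi_integrand s u) \<le> C * exp (- real N)" using assms(1)[OF u] by linarith
  qed auto
  also have "\<dots> = C * exp (- 1) ^ N" by (simp add: exp_of_nat_mult[symmetric])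
  finally show ?thesis .
qed

lemma summable_exp_geometric: "summable (\<lambda>N. C * exp (- 1) ^ N :: real)"
  by (intro summable_mult summable_geometric) auto

lemma norm_xi_piece_ball:
  assumes "norm s \<le> r"
  shows "norm (xi_piece N s) \<le> 8 * exp ((r + 2)^2 / 4) * exp (- 1) ^ N"
proof (rule norm_xi_piece_le)
  fix u assume "u \<in> {real N..real (Suc N)}"
  then show "norm (xi_integrand s u) \<le> 8 * exp ((r + 2)^2 / 4) * exp (- u)"
    using norm_xi_integrand_le[of u s "r + 1"] abs_Re_le_cmod[of s] assms by (simp add: add.commute)
qed simp

lemma summable_xi_piece: "summable (\<lambda>N. xi_piece N s)"
  by (rule summable_comparison_test[OF _ summable_exp_geometric[of "8 * exp ((norm s + 2)^2 / 4)"]])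
     (use norm_xi_piece_ball[of s "norm s"] in auto)

lemma xi_entire_holomorphic: "xi_entire holomorphic_on UNIV"
proof (rule holomorphic_uniform_sequence)
  show "(\<lambda>s. \<Sum>N<n. xi_piece N s) holomorphic_on UNIV" for n
    by (intro holomorphic_intros xi_piece_holomorphic)
  fix z :: complex
  have "uniform_limit (cball z 1) (\<lambda>n s. \<Sum>N<n. xi_piece N s) (\<lambda>s. \<Sum>N. xi_piece N s) sequentially"
  proof (rule Weierstrass_m_test[OF _ summable_exp_geometric])
    fix n s assume "s \<in> cball z 1"
    then have "norm (s - z) \<le> 1" by (simp add: dist_norm norm_minus_commute)
    then have "norm s \<le> norm z + 1" using norm_triangle_sub[of s z] by linarith
    then show "norm (xi_piece n s) \<le> 8 * exp ((norm z + 1 + 2)^2 / 4) * exp (- 1) ^ n"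
      by (rule norm_xi_piece_ball)
  qed
  then show "\<exists>d>0. cball z d \<subseteq> UNIV \<and> uniform_limit (cball z d) (\<lambda>n s. \<Sum>N<n. xi_piece N s) xi_entire sequentially"
    unfolding xi_entire_def[abs_def] by (intro exI[of _ 1]) auto
qed simp

lemma xi_entire_reflect: "xi_entire (1 - s) = xi_entire s"
proof -
  have "xi_integrand (1 - s) = xi_integrand s" by (simp add: xi_integrand_def fun_eq_iff add.commute)
  then show ?thesis by (simp add: xi_entire_def xi_piece_def)
qed

lemma xi_entire_cnj: "xi_entire (cnj s) = cnj (xi_entire s)"
proof -
  have i: "xi_integrand (cnj s) u = cnj (xi_integrand s u)" for u
    by (simp add: xi_integrand_def exp_cnj)
  have "xi_piece N (cnj s) = cnj (xi_piece N s)" for N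
    unfolding xi_piece_def i by (rule integral_cnj[symmetric])
  then have "(\<lambda>N. xi_piece N (cnj s)) sums cnj (xi_entire s)"
    using summable_sums[OF summable_xi_piece[of s]] by (simp add: xi_entire_def sums_cnj)
  then show ?thesis unfolding xi_entire_def[of "cnj s"] by (simp add: sums_iff)
qed

text \<open>A bound small enough to exclude zeros of \<xi> on the real segment [0, 1], where s (s -
  1) has modulus at most 1/4. It rests on exp pi \<ge> 8 and on a geometric series of ratio exp(-1)
  \<le> 1/2.\<close>

lemma norm_xi_entire_strip:
  assumes "0 \<le> Re s" "Re s \<le> 1"
  shows "norm (xi_entire s) \<le> 2"
proof -
  have e1: "exp (-1::real) \<le> 1 / 2" using exp_ge_add_one_self[of "1::real"] by (simp add: exp_minus field_simps)
  have "exp pi \<ge> exp (1::real) ^ 3" using pi_gt3 by (simp add: exp_of_nat_mult[symmetric])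
  moreover have "exp (1::real) ^ 3 \<ge> 2 ^ 3" using exp_ge_add_one_self[of "1::real"] by (intro power_mono) auto
  ultimately have "exp pi \<ge> 8" by simp
  then have epi: "8 * exp (- pi) \<le> 1" by (simp add: exp_minus field_simps)
  have b: "norm (xi_piece N s) \<le> 1 * exp (- 1) ^ N" for N
  proof (rule norm_xi_piece_le)
    fix u assume "u \<in> {real N..real (Suc N)}"
    then have u: "u \<ge> 0" by simp
    have a: "norm (exp (s * of_real u)) \<le> exp u" "norm (exp ((1 - s) * of_real u)) \<le> exp u"
      using assms u by (auto simp: norm_exp_eq_Re intro!: mult_left_le_one_le)
    have "norm (exp (s * of_real u) + exp ((1 - s) * of_real u)) \<le> 2 * exp u"
      using norm_triangle_ineq[of "exp (s * of_real u)" "exp ((1 - s) * of_real u)"] a by linarith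
    then have "norm (xi_integrand s u) \<le> theta_kernel u * (2 * exp u)"
      unfolding xi_integrand_def norm_mult using theta_kernel_nonneg[of u] by (intro mult_mono) auto
    also have "\<dots> \<le> (4 * exp (- (pi * exp (2 * u)))) * (2 * exp u)"
      by (intro mult_right_mono theta_kernel_le u) auto
    also have "\<dots> = 8 * exp (u - pi * exp (2 * u))" by (simp add: exp_diff exp_minus field_simps)
    also have "\<dots> \<le> 8 * exp (- pi - u)"
    proof -
      have "pi * (1 + 2 * u) \<le> pi * exp (2 * u)" by (intro mult_left_mono exp_ge_add_one_self) auto
      moreover have "2 * u \<le> pi * (2 * u)" using u pi_gt3 by (intro mult_right_mono[of 1 pi, simplified]) auto
      ultimately show ?thesis by (simp add: algebra_simps)
    qed
    also have "\<dots> = (8 * exp (- pi)) * exp (- u)" by (simp add: exp_diff exp_minus field_simps)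
    also have "\<dots> \<le> 1 * exp (- u)" using epi by (intro mult_right_mono) auto
    finally show "norm (xi_integrand s u) \<le> 1 * exp (- u)" .
  qed simp
  have "norm (xi_entire s) \<le> (\<Sum>N. 1 * exp (- 1) ^ N)"
    unfolding xi_entire_def by (rule norm_suminf_le[OF b summable_exp_geometric])
  also have "\<dots> = 1 / (1 - exp (-1))" by (simp add: suminf_geometric)
  also have "\<dots> \<le> 1 / (1 / 2)" using e1 by (intro divide_left_mono) auto
  finally show ?thesis by simp
qed

lemma xi_entire_of_real_limit:
  fixes s :: real
  defines "w \<equiv> \<lambda>N. integral {0..real N} (\<lambda>u. theta_kernel u * (exp (s * u) + exp ((1 - s) * u)))"
  shows "(\<lambda>N. complex_of_real (w N)) \<longlonglongrightarrow> xi_entire (of_real s)"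
proof -
  have f: "xi_integrand (of_real s) = (\<lambda>u. complex_of_real (theta_kernel u * (exp (s * u) + exp ((1 - s) * u))))"
    by (simp add: xi_integrand_def fun_eq_iff exp_of_real[symmetric])
  have "(\<Sum>k<N. xi_piece k (of_real s)) = of_real (w N)" for N
  proof (induction N)
    case (Suc N)
    have "integral {0..real (Suc N)} (xi_integrand (of_real s)) = integral {0..real N} (xi_integrand (of_real s)) + xi_piece N (of_real s)"
      unfolding xi_piece_def by (rule Henstock_Kurzweil_Integration.integral_combine[symmetric]) (auto intro: xi_integrand_integrable)
    moreover have "of_real (w M) = integral {0..real M} (xi_integrand (of_real s))" for M
      unfolding f w_def
      by (rule integral_unique[symmetric], rule has_integral_of_real, rule integrable_integral)
         (intro integrable_continuous_real continuous_intros)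
    ultimately show ?case using Suc by simp
  qed (simp add: w_def)
  then show ?thesis
    using summable_LIMSEQ[OF summable_xi_piece[of "of_real s"]] by (simp add: xi_entire_def)
qed

section \<open>The Mellin transform of the theta kernel, computed in two ways\<close>

lemma integral_exp_neg_interval:
  fixes c b :: real
  assumes "c \<noteq> 0" "b \<ge> 0"
  shows "integral {0..b} (\<lambda>u. exp (- (c * u))) = (1 - exp (- (c * b))) / c"
proof -
  have "((\<lambda>u. exp (- (c * u))) has_integral (- exp (- (c * b)) / c - - exp (- (c * 0)) / c)) {0..b}"
  proof (rule fundamental_theorem_of_calculus)
    fix x
    have "((\<lambda>u. - exp (- (c * u)) / c) has_real_derivative exp (- (c * x))) (at x within {0..b})"
      using assms by (auto intro!: derivative_eq_intros)
    then show "((\<lambda>u. - exp (- (c * u)) / c) has_vector_derivative exp (- (c * x))) (at x within {0..b})"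
      by (simp add: has_real_derivative_iff_has_vector_derivative)
  qed (use assms in simp)
  then show ?thesis by (simp add: integral_unique diff_divide_distrib)
qed

text \<open>Reflecting the part u < 0 and applying \<open>theta_kernel_minus\<close> produces the
  second exponential of \<open>xi_integrand\<close> and two elementary integrals, whose difference
  tends to 1/(s-1) - 1/s.\<close>

lemma theta_mellin_fold:
  fixes s :: real
  assumes s: "s > 1"
  shows "(\<lambda>N. complex_of_real (integral {- real N..real N} (\<lambda>u. theta_kernel u * exp (s * u))))
     \<longlonglongrightarrow> xi_entire (of_real s) + 1 / (of_real s * (of_real s - 1))"
proof -
  define w where "w = (\<lambda>N. integral {0..real N} (\<lambda>u. theta_kernel u * (exp (s * u) + exp ((1 - s) * u))))"
  have eq: "integral {- real N..real N} (\<lambda>u. theta_kernel u * exp (s * u))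
      = w N + ((1 - exp (- ((s - 1) * real N))) / (s - 1) - (1 - exp (- (s * real N))) / s)" for N
  proof -
    have "integral {- real N..real N} (\<lambda>u. theta_kernel u * exp (s * u))
       = integral {- real N..0} (\<lambda>u. theta_kernel u * exp (s * u)) + integral {0..real N} (\<lambda>u. theta_kernel u * exp (s * u))"
      by (rule Henstock_Kurzweil_Integration.integral_combine[symmetric]) (auto intro!: integrable_continuous_real continuous_intros)
    also have "integral {- real N..0} (\<lambda>u. theta_kernel u * exp (s * u)) = integral {0..real N} (\<lambda>u. theta_kernel (- u) * exp (s * (- u)))"
      using Henstock_Kurzweil_Integration.integral_reflect_real[of "real N" 0 "\<lambda>u. theta_kernel (- u) * exp (s * (- u))"] by simp
    also have "(\<lambda>u. theta_kernel (- u) * exp (s * (- u))) = (\<lambda>u. theta_kernel u * exp ((1 - s) * u) + (exp (- ((s - 1) * u)) - exp (- (s * u))))"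
    proof
      fix u
      have "exp u * exp (s * (- u)) = exp ((1 - s) * u)" by (simp add: exp_add[symmetric] algebra_simps)
      moreover have "exp (- ((s - 1) * u)) = exp ((1 - s) * u)" by (simp add: algebra_simps)
      ultimately show "theta_kernel (- u) * exp (s * (- u)) = theta_kernel u * exp ((1 - s) * u) + (exp (- ((s - 1) * u)) - exp (- (s * u)))"
        unfolding theta_kernel_minus by (simp add: algebra_simps)
    qed
    also have "integral {0..real N} \<dots> = integral {0..real N} (\<lambda>u. theta_kernel u * exp ((1 - s) * u)) +
        (integral {0..real N} (\<lambda>u. exp (- ((s - 1) * u))) - integral {0..real N} (\<lambda>u. exp (- (s * u))))"
      by (subst Henstock_Kurzweil_Integration.integral_add, (intro integrable_continuous_real continuous_intros)+,
          subst Henstock_Kurzweil_Integration.integral_diff, (intro integrable_continuous_real continuous_intros)+, rule refl)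
    also have "integral {0..real N} (\<lambda>u. exp (- ((s - 1) * u))) = (1 - exp (- ((s - 1) * real N))) / (s - 1)"
      using integral_exp_neg_interval[of "s - 1" "real N"] s by simp
    also have "integral {0..real N} (\<lambda>u. exp (- (s * u))) = (1 - exp (- (s * real N))) / s"
      using integral_exp_neg_interval[of s "real N"] s by simp
    finally show ?thesis
      unfolding w_def distrib_left
      by (subst Henstock_Kurzweil_Integration.integral_add) (auto intro!: integrable_continuous_real continuous_intros)
  qed
  have e1: "(\<lambda>N. exp (- (c * real N))) \<longlonglongrightarrow> 0" if "c > 0" for c using that by real_asymp
  have "(\<lambda>N. (1 - exp (- ((s - 1) * real N))) / (s - 1) - (1 - exp (- (s * real N))) / s) \<longlonglongrightarrow> (1 - 0) / (s - 1) - (1 - 0) / s"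
    using s by (intro tendsto_intros e1) auto
  then have e: "(\<lambda>N. (1 - exp (- ((s - 1) * real N))) / (s - 1) - (1 - exp (- (s * real N))) / s) \<longlonglongrightarrow> 1 / (s - 1) - 1 / s"
    by simp
  have "(\<lambda>N. complex_of_real (w N) + of_real ((1 - exp (- ((s - 1) * real N))) / (s - 1) - (1 - exp (- (s * real N))) / s))
     \<longlonglongrightarrow> xi_entire (of_real s) + of_real (1 / (s - 1) - 1 / s)"
    by (intro tendsto_add tendsto_of_real e) (use xi_entire_of_real_limit[of s] in \<open>simp add: w_def\<close>)
  moreover have "complex_of_real (1 / (s - 1) - 1 / s) = 1 / (of_real s * (of_real s - 1))"
  proof -
    have "1 / (s - 1) - 1 / s = 1 / (s * (s - 1))" using s by (simp add: field_simps)
    then show ?thesis by simp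
  qed
  ultimately show ?thesis unfolding eq by simp
qed

text \<open>The substitution t = c exp(2u) in Euler's integral for \<Gamma>(s/2), truncated to a
  compact interval.\<close>

lemma gamma_piece:
  fixes s c :: real and N :: nat
  assumes s: "s > 0" and c: "c > 0"
  defines "f \<equiv> \<lambda>t::real. t powr (s / 2 - 1) / exp t"
  shows "integral {- real N..real N} (\<lambda>u. 2 * exp (- (c * exp (2 * u))) * exp (s * u))
     = c powr (- s / 2) * integral {c * exp (- 2 * real N)..c * exp (2 * real N)} f"
proof -
  define g where "g = (\<lambda>u. c * exp (2 * u))"
  have "((\<lambda>u. (2 * g u) *\<^sub>R f (g u)) has_integral integral {g (- real N)..g (real N)} f) {- real N..real N}"
  proof (rule has_integral_substitution[where c = "g (- real N)" and d = "g (real N)"])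
    show "continuous_on {g (- real N)..g (real N)} f"
    proof -
      have "g (- real N) > 0" using c by (simp add: g_def)
      then show ?thesis unfolding f_def by (intro continuous_intros) auto
    qed
    show "(g has_field_derivative 2 * g x) (at x within {- real N..real N})" for x
      unfolding g_def by (auto intro!: derivative_eq_intros)
  qed (use c in \<open>auto simp: g_def\<close>)
  moreover have "(2 * g u) *\<^sub>R f (g u) = c powr (s / 2) * (2 * exp (- (c * exp (2 * u))) * exp (s * u))" for u
  proof -
    have gp: "g u > 0" using c by (simp add: g_def)
    have "g u * g u powr (s / 2 - 1) = g u powr (s / 2)" using gp powr_mult_base[of "g u" "s / 2 - 1"] by simp
    moreover have "g u powr (s / 2) = c powr (s / 2) * exp (s * u)"
      using c by (simp add: g_def powr_mult exp_powr_real)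
    ultimately have "g u * g u powr (s / 2 - 1) / exp (g u) = c powr (s / 2) * exp (s * u) / exp (g u)" by simp
    moreover have "exp (- (c * exp (2 * u))) = 1 / exp (g u)" by (simp add: exp_minus g_def inverse_eq_divide)
    moreover have "(2 * g u) *\<^sub>R f (g u) = 2 * (g u * g u powr (s / 2 - 1) / exp (g u))" by (simp add: f_def)
    ultimately show ?thesis by (simp only: times_divide_eq_right times_divide_eq_left mult_1_right mult_1_left mult.assoc mult.left_commute mult.commute)
  qed
  ultimately have "((\<lambda>u. c powr (s / 2) * (2 * exp (- (c * exp (2 * u))) * exp (s * u))) has_integral integral {g (- real N)..g (real N)} f) {- real N..real N}"
    by (simp only:)
  from has_integral_mult_right[OF this, of "c powr (- s / 2)"]
  have "((\<lambda>u. 2 * exp (- (c * exp (2 * u))) * exp (s * u)) has_integral c powr (- s / 2) * integral {g (- real N)..g (real N)} f) {- real N..real N}"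
    using c by (simp add: powr_minus mult.assoc[symmetric] powr_add[symmetric])
  then show ?thesis by (simp add: g_def integral_unique)
qed

text \<open>The truncated integrals exhaust Euler's integral of a nonnegative function. The bound by
  the limit, uniform in N, is the majorant under which N is later sent to infinity inside a
  sum.\<close>

lemma gamma_piece_limit:
  fixes s c :: real
  assumes s: "s > 0" and c: "c > 0"
  defines "I \<equiv> \<lambda>N. integral {- real N..real N} (\<lambda>u. 2 * exp (- (c * exp (2 * u))) * exp (s * u))"
  shows "I \<longlonglongrightarrow> c powr (- s / 2) * Gamma (s / 2)"
    and "I N \<le> c powr (- s / 2) * Gamma (s / 2)"
proof -
  define f where "f = (\<lambda>t::real. t powr (s / 2 - 1) / exp t)"
  have f: "(f has_integral Gamma (s / 2)) {0..}"
    unfolding f_def using Gamma_integral_real[of "s / 2"] s by simp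
  have f0: "f t \<ge> 0" for t by (simp add: f_def)
  define S where "S = (\<lambda>N. {c * exp (- 2 * real N)..c * exp (2 * real N)})"
  have sub: "S N \<subseteq> {0..}" for N using c by (auto simp: S_def intro: order_trans[rotated])
  have fS: "f integrable_on S N" for N
    unfolding S_def by (rule integrable_on_subinterval[OF has_integral_integrable[OF f]])
      (use sub[of N] in \<open>auto simp: S_def\<close>)
  have I: "I N = c powr (- s / 2) * integral (S N) f" for N
    unfolding I_def S_def f_def by (rule gamma_piece[OF s c])
  have "integral (S N) f \<le> integral {0..} f"
    using sub fS f f0 by (intro integral_subset_le) auto
  then show "I N \<le> c powr (- s / 2) * Gamma (s / 2)"
    unfolding I integral_unique[OF f] by (intro mult_left_mono) auto
  have "(\<lambda>N. integral {0..} (\<lambda>t. if t \<in> S N then f t else 0)) \<longlonglongrightarrow> integral {0..} f"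
  proof (rule dominated_convergence(2))
    show "(\<lambda>t. if t \<in> S N then f t else 0) integrable_on {0..}" for N
      using fS[of N] integrable_restrict_Int[of "S N" f "{0..}"] Int_absorb2[OF sub[of N]] by simp
    show "f integrable_on {0..}" using f by blast
    show "(\<lambda>N. if t \<in> S N then f t else 0) \<longlonglongrightarrow> f t" if "t \<in> {0..}" for t
    proof (cases "t = 0")
      case True
      then have "f t = 0" by (simp add: f_def)
      then show ?thesis by (simp cong: if_cong)
    next
      case False
      then have t: "t > 0" using that by simp
      have "(\<lambda>N. c * exp (- 2 * real N)) \<longlonglongrightarrow> 0" by real_asymp
      from order_tendstoD(2)[OF this t] have 1: "eventually (\<lambda>N. c * exp (- 2 * real N) < t) sequentially" .
      have "filterlim (\<lambda>N. c * exp (2 * real N)) at_top sequentially" using c by real_asymp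
      then have 2: "eventually (\<lambda>N. c * exp (2 * real N) > t) sequentially" by (simp add: filterlim_at_top_dense)
      have "eventually (\<lambda>N. (if t \<in> S N then f t else 0) = f t) sequentially"
        using 1 2 by eventually_elim (auto simp: S_def)
      then show ?thesis by (rule tendsto_eventually)
    qed
  qed (auto simp: f0)
  moreover have "integral {0..} (\<lambda>t. if t \<in> S N then f t else 0) = integral (S N) f" for N
    using integral_restrict_Int[of "{0..}" "S N" f] Int_absorb2[OF sub[of N]] by simp
  ultimately have "(\<lambda>N. integral (S N) f) \<longlonglongrightarrow> Gamma (s / 2)" by (simp add: integral_unique[OF f])
  then show "I \<longlonglongrightarrow> c powr (- s / 2) * Gamma (s / 2)" unfolding I by (intro tendsto_intros)
qed

text \<open>With c = pi n^2 the factor c^(-s/2) turns the Gamma integral into the n-th Dirichlet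
  term. Sum and integral are interchanged on [-N, N] by uniform convergence, the sum and the limit
  in N by dominated convergence.\<close>

lemma theta_mellin_dirichlet:
  fixes s :: real
  assumes s: "s > 1"
  shows "(\<lambda>N. integral {- real N..real N} (\<lambda>u. theta_kernel u * exp (s * u)))
     \<longlonglongrightarrow> pi powr (- s / 2) * Gamma (s / 2) * (\<Sum>n. real (Suc n) powr (- s))"
proof -
  define c where "c = (\<lambda>n. pi * (real (Suc n))^2)"
  have c: "c n > 0" for n by (simp add: c_def)
  define f where "f = (\<lambda>n u. 2 * exp (- (c n * exp (2 * u))) * exp (s * u))"
  have cf: "continuous_on A (f n)" for A n unfolding f_def by (intro continuous_intros)
  define I where "I = (\<lambda>n N. integral {- real N..real N} (f n))"
  define M where "M = (\<lambda>n. c n powr (- s / 2) * Gamma (s / 2))"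
  have I0: "I n N \<ge> 0" for n N
    unfolding I_def by (intro integral_nonneg integrable_continuous_real cf) (simp add: f_def)
  have lim: "(\<lambda>N. I n N) \<longlonglongrightarrow> M n" and bd: "I n N \<le> M n" for n N
    using gamma_piece_limit[of s "c n"] s c unfolding I_def M_def f_def by auto
  have M: "M n = pi powr (- s / 2) * Gamma (s / 2) * real (Suc n) powr (- s)" for n
  proof -
    have "c n powr (- s / 2) = pi powr (- s / 2) * ((real (Suc n))^2) powr (- s / 2)"
      unfolding c_def by (simp only: powr_mult pi_ge_zero zero_le_power2)
    also have "((real (Suc n))^2) powr (- s / 2) = real (Suc n) powr (- s)"
      by (simp add: powr_powr flip: powr_numeral)
    finally show ?thesis by (simp add: M_def)
  qed
  have sM: "summable M"
  proof -
    have "summable (\<lambda>n. real n powr (- s))" using s by (subst summable_real_powr_iff) auto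
    then have "summable (\<lambda>n. real (Suc n) powr (- s))" by (subst summable_Suc_iff)
    then show ?thesis unfolding M by (intro summable_mult)
  qed
  have J: "integral {- real N..real N} (\<lambda>u. theta_kernel u * exp (s * u)) = (\<Sum>n. I n N)" for N
  proof -
    have ul: "uniform_limit {- real N..real N} (\<lambda>k u. \<Sum>n<k. f n u)
          (\<lambda>u. \<Sum>n. f n u) sequentially"
    proof (rule Weierstrass_m_test)
      show "summable (\<lambda>n. exp (- (pi * (real (Suc n))^2 * exp (- 2 * real N))) * (2 * exp (s * real N)))"
        by (intro summable_mult2 summable_theta_tail) auto
      fix n u assume u: "u \<in> {- real N..real N}"
      have "exp (- (c n * exp (2 * u))) \<le> exp (- (c n * exp (- 2 * real N)))"
        using u c[of n] by (auto intro!: mult_left_mono)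
      moreover have "exp (s * u) \<le> exp (s * real N)" using u s by (auto intro!: mult_left_mono)
      ultimately have "exp (- (c n * exp (2 * u))) * exp (s * u) \<le> exp (- (c n * exp (- 2 * real N))) * exp (s * real N)"
        by (intro mult_mono) auto
      then show "norm (f n u)
          \<le> exp (- (pi * (real (Suc n))^2 * exp (- 2 * real N))) * (2 * exp (s * real N))"
        by (simp add: c_def f_def)
    qed
    obtain Ik J where *: "\<And>k. ((\<lambda>u. \<Sum>n<k. f n u) has_integral Ik k) {- real N..real N}"
        "((\<lambda>u. \<Sum>n. f n u) has_integral J) {- real N..real N}" "Ik \<longlonglongrightarrow> J"
      by (rule uniform_limit_integral[OF ul]) (auto intro!: continuous_intros cf)
    have "Ik k = (\<Sum>n<k. I n N)" for k
      unfolding I_def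
      by (rule has_integral_unique[OF *(1)], rule has_integral_sum)
         (auto intro!: integrable_integral integrable_continuous_real cf)
    then have "Ik = (\<lambda>k. \<Sum>n<k. I n N)" by (rule ext)
    then have "(\<lambda>n. I n N) sums J" using *(3) unfolding sums_def by (simp only:)
    then have "(\<Sum>n. I n N) = J" by (rule sums_unique[symmetric])
    moreover have "(\<Sum>n. f n u) = theta_kernel u * exp (s * u)" for u
    proof -
      have "summable (\<lambda>n. exp (- (c n * exp (2 * u))))" unfolding c_def by (rule summable_theta_tail) simp
      then have "(\<lambda>n. exp (- (c n * exp (2 * u)))) sums theta_tail (exp (2 * u))"
        unfolding theta_tail_def c_def by (rule summable_sums)
      from sums_mult2[OF sums_mult[OF this, of 2], of "exp (s * u)"] show ?thesis
        unfolding theta_kernel_def f_def by (rule sums_unique[symmetric])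
    qed
    ultimately show ?thesis using *(2) by (simp add: integral_unique)
  qed
  have "(\<lambda>N. \<Sum>n. I n N) \<longlonglongrightarrow> (\<Sum>n. M n)"
    using I0 bd by (intro tannery_sequentially[OF lim _ sM] always_eventually) auto
  moreover have "(\<Sum>n. M n) = pi powr (- s / 2) * Gamma (s / 2) * (\<Sum>n. real (Suc n) powr (- s))"
  proof -
    have "summable (\<lambda>n. real n powr (- s))" using s by (subst summable_real_powr_iff) auto
    then have "summable (\<lambda>n. real (Suc n) powr (- s))" by (subst summable_Suc_iff)
    then show ?thesis unfolding M by (rule suminf_mult)
  qed
  ultimately show ?thesis by (simp add: J)
qed

theorem xi_entire_mellin:
  fixes s :: real
  assumes s: "s > 1"
  shows "xi_entire (of_real s) + 1 / (of_real s * (of_real s - 1)) =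
    of_real (pi powr (- s / 2) * Gamma (s / 2) * (\<Sum>n. real (Suc n) powr (- s)))"
  using LIMSEQ_unique[OF theta_mellin_fold[OF s] tendsto_of_real[OF theta_mellin_dirichlet[OF s]]] .

section \<open>The zeta function and its zero-free regions\<close>

text \<open>Twice Riemann's \<open>\<xi>\<close>, that is, \<open>s (s - 1) \<pi>\<^sup>-\<^sup>s\<^sup>/\<^sup>2 \<Gamma>(s/2) \<zeta>(s)\<close>.\<close>

definition xi :: "complex \<Rightarrow> complex" where
  "xi s = 1 + s * (s - 1) * xi_entire s"

lemma xi_holomorphic [holomorphic_intros]: "f holomorphic_on A \<Longrightarrow> (\<lambda>z. xi (f z)) holomorphic_on A"
proof -
  have "xi holomorphic_on UNIV"
    unfolding xi_def[abs_def] by (intro holomorphic_intros xi_entire_holomorphic)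
  then show "f holomorphic_on A \<Longrightarrow> (\<lambda>z. xi (f z)) holomorphic_on A"
    using holomorphic_on_compose_gen[of f A xi UNIV] by (simp add: o_def)
qed

lemma xi_reflect: "xi (1 - s) = xi s"
  unfolding xi_def xi_entire_reflect by (simp add: algebra_simps)

lemma xi_cnj: "xi (cnj s) = cnj (xi s)"
  unfolding xi_def xi_entire_cnj by simp

lemma xi_0 [simp]: "xi 0 = 1" and xi_1 [simp]: "xi 1 = 1"
  by (simp_all add: xi_def)

text \<open>The factors |s (s - 1)| \<le> 1/4 and |\<open>xi_entire\<close> s| \<le> 2 have a
  product below 1, which cannot cancel the constant term of \<xi>. Together with the location in the
  strip this makes every zero of \<xi> nonreal.\<close>

lemma xi_nonzero_unit_interval:
  assumes "Im s = 0" "0 \<le> Re s" "Re s \<le> 1"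
  shows "xi s \<noteq> 0"
proof
  assume "xi s = 0"
  then have "s * (s - 1) * xi_entire s = -1" by (simp add: xi_def add_eq_0_iff)
  then have "norm (s * (s - 1)) * norm (xi_entire s) = 1" by (metis norm_minus_cancel norm_mult norm_one)
  moreover have "norm (s * (s - 1)) \<le> 1 / 4"
  proof -
    have "s = of_real (Re s)" using assms by (simp add: complex_eq_iff)
    then have "s * (s - 1) = of_real (Re s * (Re s - 1))" by (metis of_real_1 of_real_diff of_real_mult)
    then have "norm (s * (s - 1)) = \<bar>Re s * (Re s - 1)\<bar>" by (simp only: norm_of_real)
    also have "\<dots> = Re s * (1 - Re s)" using assms by (simp add: abs_mult)
    also have "\<dots> \<le> 1 / 4" using zero_le_power2[of "Re s - 1 / 2"] by (simp add: power2_eq_square algebra_simps)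
    finally show ?thesis .
  qed
  moreover have "norm (s * (s - 1)) * norm (xi_entire s) \<le> (1 / 4) * 2"
    using norm_xi_entire_strip[of s] assms calculation(2) by (intro mult_mono) auto
  ultimately show False by simp
qed

section \<open>Analytic continuation of the Dirichlet series\<close>

lemma norm_nat_powr: "n > 0 \<Longrightarrow> norm (of_nat n powr s :: complex) = real n powr Re s"
  by (simp add: norm_powr_real_powr)

lemma norm_dirichlet_term: "norm (1 / of_nat (Suc n) powr s :: complex) = real (Suc n) powr (- Re s)"
  by (simp add: norm_divide norm_nat_powr powr_minus_divide del: of_nat_Suc)

lemma summable_Suc_powr: "\<sigma> > 1 \<Longrightarrow> summable (\<lambda>n. real (Suc n) powr (- \<sigma>))"
proof -
  assume "\<sigma> > 1"
  then have "summable (\<lambda>n. real n powr (- \<sigma>))" by (subst summable_real_powr_iff) auto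
  then show "summable (\<lambda>n. real (Suc n) powr (- \<sigma>))" by (subst summable_Suc_iff)
qed

lemma summable_dirichlet: "Re s > 1 \<Longrightarrow> summable (\<lambda>n. 1 / of_nat (Suc n) powr s :: complex)"
  by (rule summable_norm_cancel) (unfold norm_dirichlet_term, rule summable_Suc_powr)

lemma holomorphic_dirichlet:
  "(\<lambda>s. \<Sum>n. 1 / of_nat (Suc n) powr s :: complex) holomorphic_on {s. Re s > 1}"
proof (rule holomorphic_uniform_sequence)
  show "(\<lambda>s. \<Sum>n<N. 1 / of_nat (Suc n) powr s :: complex) holomorphic_on {s. Re s > 1}" for N
    by (intro holomorphic_intros) (auto simp del: of_nat_Suc)
  fix z :: complex assume "z \<in> {s. Re s > 1}"
  define d where "d = (Re z - 1) / 2"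
  have d: "d > 0" "Re z - d > 1" using \<open>z \<in> _\<close> by (auto simp: d_def field_simps)
  have r: "Re z - d \<le> Re s" if "s \<in> cball z d" for s
    using that abs_Re_le_cmod[of "z - s"] by (auto simp: dist_norm)
  have "uniform_limit (cball z d) (\<lambda>N s. \<Sum>n<N. 1 / of_nat (Suc n) powr s :: complex) (\<lambda>s. \<Sum>n. 1 / of_nat (Suc n) powr s) sequentially"
  proof (rule Weierstrass_m_test[OF _ summable_Suc_powr[OF d(2)]])
    fix n s assume "s \<in> cball z d"
    from r[OF this] show "norm (1 / of_nat (Suc n) powr s :: complex) \<le> real (Suc n) powr (- (Re z - d))"
      unfolding norm_dirichlet_term by (intro powr_mono) auto
  qed
  moreover have "cball z d \<subseteq> {s. Re s > 1}" using r d by force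
  ultimately show "\<exists>d>0. cball z d \<subseteq> {s. Re s > 1} \<and>
       uniform_limit (cball z d) (\<lambda>N s. \<Sum>n<N. 1 / of_nat (Suc n) powr s :: complex) (\<lambda>s. \<Sum>n. 1 / of_nat (Suc n) powr s) sequentially"
    using d by blast
qed (simp add: open_halfspace_Re_gt)

text \<open>The relation \<xi>(s) = s (s - 1) pi^(-s/2) \<Gamma>(s/2) \<zeta>(s) solved for \<zeta>,
  with the factor s absorbed by s/2 \<Gamma>(s/2) = \<Gamma>(s/2 + 1). The reciprocal Gamma function
  is entire, so s = 1 is the only singularity.\<close>

definition zeta_model :: "complex \<Rightarrow> complex" where
  "zeta_model s = (if s = 1 then 0 else xi s * of_real pi powr (s / 2) * rGamma (s / 2 + 1) / (2 * (s - 1)))"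

lemma zeta_model_real:
  assumes s: "s > 1"
  shows "zeta_model (of_real s) = (\<Sum>n. 1 / of_nat (Suc n) powr (of_real s))"
proof -
  define D where "D = (\<Sum>n. real (Suc n) powr (- s))"
  have D: "(\<Sum>n. 1 / of_nat (Suc n) powr (of_real s)) = complex_of_real D"
  proof -
    have "1 / of_nat (Suc n) powr (of_real s) = complex_of_real (real (Suc n) powr (- s))" for n
      using powr_of_real[of "real (Suc n)" s] by (simp add: powr_minus_divide del: of_nat_Suc)
    then show ?thesis unfolding D_def by (simp add: suminf_of_real summable_Suc_powr[OF s] del: of_nat_Suc)
  qed
  have nz: "complex_of_real s \<noteq> 0" "complex_of_real s \<noteq> 1" using s by auto
  define P where "P = complex_of_real pi powr (of_real s / 2)"
  have P: "complex_of_real (pi powr (- s / 2)) = 1 / P"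
  proof -
    have "complex_of_real (pi powr (- s / 2)) = 1 / complex_of_real (pi powr (s / 2))" by (simp add: powr_minus_divide)
    also have "complex_of_real (pi powr (s / 2)) = P" unfolding P_def by (subst powr_of_real[symmetric]) auto
    finally show ?thesis .
  qed
  have P0: "P \<noteq> 0" by (simp add: P_def)
  have G: "complex_of_real (Gamma (s / 2)) * rGamma (of_real s / 2 + 1) = 2 / of_real s"
  proof -
    have "complex_of_real (Gamma (s / 2)) = Gamma (of_real s / 2)" by (simp add: Gamma_complex_of_real[symmetric])
    moreover have "of_real s / 2 * rGamma (of_real s / 2 + 1) = rGamma (of_real s / 2 :: complex)" by (rule rGamma_plus1)
    moreover have "Gamma (of_real s / 2 :: complex) * rGamma (of_real s / 2) = 1"
    proof -
      have "of_real s / 2 \<notin> (\<int>\<^sub>\<le>\<^sub>0 :: complex set)" using s by (auto elim!: nonpos_Ints_cases simp: complex_eq_iff)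
      then show ?thesis by (simp add: rGamma_inverse_Gamma Gamma_eq_zero_iff)
    qed
    ultimately have "of_real s / 2 * (complex_of_real (Gamma (s / 2)) * rGamma (of_real s / 2 + 1)) = 1"
      by (metis mult.left_commute)
    then show ?thesis using nz by (simp add: field_simps)
  qed
  have "xi_entire (of_real s) + 1 / (of_real s * (of_real s - 1)) = (1 / P) * of_real (Gamma (s / 2)) * of_real D"
    using xi_entire_mellin[OF s] unfolding of_real_mult P D_def .
  then have "of_real s * (of_real s - 1) * (xi_entire (of_real s) + 1 / (of_real s * (of_real s - 1))) = of_real s * (of_real s - 1) * ((1 / P) * of_real (Gamma (s / 2)) * of_real D)"
    by simp
  then have x: "xi (of_real s) = of_real s * (of_real s - 1) * ((1 / P) * of_real (Gamma (s / 2)) * of_real D)"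
    using nz by (simp add: xi_def distrib_left add.commute)
  have "zeta_model (of_real s) = of_real s * (of_real s - 1) * ((1 / P) * of_real D) * P * (of_real (Gamma (s / 2)) * rGamma (of_real s / 2 + 1)) / (2 * (of_real s - 1))"
    using nz unfolding zeta_model_def x P_def[symmetric] by simp
  also have "\<dots> = of_real D" unfolding G using nz P0 by (simp add: field_simps)
  finally show ?thesis unfolding D .
qed

text \<open>Agreement with the Dirichlet series is known for real s > 1; since this half-line
  accumulates at 2, the identity theorem extends it to Re s > 1.\<close>

lemma zeta_model_is_zeta: "is_zeta zeta_model"
  unfolding is_zeta_def
proof (intro conjI allI impI)
  show hol: "zeta_model holomorphic_on - {1}"
  proof (rule holomorphic_transform)
    show "(\<lambda>s. xi s * of_real pi powr (s / 2) * rGamma (s / 2 + 1) / (2 * (s - 1))) holomorphic_on - {1}"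
      by (intro holomorphic_intros) auto
  qed (auto simp: zeta_model_def)
  show "zeta_model 1 = 0" by (simp add: zeta_model_def)
  fix s :: complex assume s: "Re s > 1"
  have "zeta_model s - (\<Sum>n. 1 / of_nat (Suc n) powr s) = 0"
  proof (rule analytic_continuation[where f = "\<lambda>s. zeta_model s - (\<Sum>n. 1 / of_nat (Suc n) powr s)" and w = s and S = "{s. Re s > 1}" and U = "of_real ` {1<..}" and \<xi> = 2])
    show "(\<lambda>s. zeta_model s - (\<Sum>n. 1 / of_nat (Suc n) powr s)) holomorphic_on {s. Re s > 1}"
      by (intro holomorphic_on_diff holomorphic_dirichlet holomorphic_on_subset[OF hol]) auto
    show "connected {s::complex. Re s > 1}" by (intro convex_connected convex_halfspace_Re_gt)
    show "(2::complex) islimpt of_real ` {1::real<..}"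
      unfolding islimpt_approachable
    proof (intro allI impI)
      fix e :: real assume e: "e > 0"
      have "complex_of_real (2 + e / 2) \<in> of_real ` {1<..}" using e by (intro imageI) auto
      moreover have "dist (complex_of_real (2 + e / 2)) 2 < e" using e by (simp add: dist_norm)
      ultimately show "\<exists>x'\<in>of_real ` {1<..}. x' \<noteq> (2::complex) \<and> dist x' 2 < e"
        using e by (intro bexI[of _ "of_real (2 + e / 2)"]) (auto simp: complex_eq_iff)
    qed
  qed (use s in \<open>auto simp: open_halfspace_Re_gt zeta_model_real\<close>)
  then show "(\<lambda>n. 1 / of_nat (Suc n) powr s) sums zeta_model s"
    using summable_sums[OF summable_dirichlet[OF s]] by simp
qed

lemma zeta_eq_model: "zeta = zeta_model"
  unfolding zeta_def by (rule the_equality) (use zeta_model_is_zeta zeta_unique in auto)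

lemma zeta_holomorphic: "zeta holomorphic_on - {1}"
  and zeta_sums: "Re s > 1 \<Longrightarrow> (\<lambda>n. 1 / of_nat (Suc n) powr s) sums zeta s"
  using zeta_model_is_zeta unfolding is_zeta_def zeta_eq_model by auto

lemma zeta_isCont: "s \<noteq> 1 \<Longrightarrow> isCont zeta s"
proof -
  have "open (- {1::complex})" by auto
  then show "s \<noteq> 1 \<Longrightarrow> isCont zeta s"
    using holomorphic_on_imp_continuous_on[OF zeta_holomorphic] by (auto simp: continuous_on_eq_continuous_at)
qed

lemma zeta_eq_xi:
  "s \<noteq> 1 \<Longrightarrow> zeta s = xi s * of_real pi powr (s / 2) * rGamma (s / 2 + 1) / (2 * (s - 1))"
  by (simp add: zeta_eq_model zeta_model_def)

section \<open>The Euler product\<close>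

text \<open>The Euler product is used as a sieve: the Dirichlet series restricted to integers
  without prime factors up to k equals \<zeta> times the product of 1 - p^(-s) over these primes,
  which keeps all products finite.\<close>

definition sieved :: "nat \<Rightarrow> nat set" where
  "sieved k = {n. n > 0 \<and> (\<forall>p. prime p \<longrightarrow> p \<le> k \<longrightarrow> \<not> p dvd n)}"

lemma sieved_0: "sieved 0 = {0<..}"
  using prime_gt_0_nat by (auto simp: sieved_def)

lemma sieved_Suc_not_prime: "\<not> prime (Suc k) \<Longrightarrow> sieved (Suc k) = sieved k"
  by (auto simp: sieved_def le_Suc_eq)

text \<open>Multiplication by the prime q = k + 1 introduces no prime factor up to k, so the
  multiples of q in \<open>sieved k\<close> form a scaled copy of it. This yields the factor 1 -
  q^(-s).\<close>

lemma sieved_Suc_prime: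
  assumes q: "prime (Suc k)"
  shows "sieved k = sieved (Suc k) \<union> (*) (Suc k) ` sieved k" and "sieved (Suc k) \<inter> (*) (Suc k) ` sieved k = {}"
proof -
  have "Suc k * m \<notin> sieved (Suc k)" for m using q dvd_triv_left[of "Suc k" m] by (auto simp: sieved_def simp del: mult_Suc)
  then show "sieved (Suc k) \<inter> (*) (Suc k) ` sieved k = {}" by blast
  have 1: "Suc k * m \<in> sieved k" if "m \<in> sieved k" for m
  proof -
    have "\<not> p dvd Suc k * m" if p: "prime p" "p \<le> k" for p
    proof
      assume "p dvd Suc k * m"
      then have "p dvd Suc k \<or> p dvd m" using p prime_dvd_mult_iff by blast
      moreover have "\<not> p dvd m" using \<open>m \<in> sieved k\<close> p by (auto simp: sieved_def)
      moreover have "p dvd Suc k \<Longrightarrow> p = Suc k" using q p primes_dvd_imp_eq by blast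
      ultimately show False using p by auto
    qed
    then show ?thesis using that by (auto simp: sieved_def)
  qed
  have 2: "n \<in> (*) (Suc k) ` sieved k" if ns: "n \<in> sieved k" "n \<notin> sieved (Suc k)" for n
  proof -
    have "n > 0" using ns(1) by (simp add: sieved_def)
    then obtain p where p: "prime p" "p \<le> Suc k" "p dvd n" using ns(2) unfolding sieved_def by blast
    then have "p = Suc k" using ns by (auto simp: sieved_def le_Suc_eq)
    then obtain m where m: "n = Suc k * m" using p(3) unfolding dvd_def by blast
    have "m \<in> sieved k" using ns(1) unfolding m sieved_def by (auto intro: dvd_mult)
    then show ?thesis using m by blast
  qed
  show "sieved k = sieved (Suc k) \<union> (*) (Suc k) ` sieved k"
    using 1 2 by (auto simp: sieved_def le_Suc_eq)
qed

lemma summable_on_nat_powr: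
  assumes "Re s > 1"
  shows "(\<lambda>n. of_nat n powr (- s) :: complex) summable_on A"
    and "summable (\<lambda>n. norm (of_nat n powr (- s) :: complex))"
proof -
  show *: "summable (\<lambda>n. norm (of_nat n powr (- s) :: complex))"
    by (subst summable_Suc_iff[symmetric]) (use summable_Suc_powr[OF assms] in \<open>simp add: norm_nat_powr del: of_nat_Suc\<close>)
  show "(\<lambda>n. of_nat n powr (- s) :: complex) summable_on A"
    by (rule summable_on_subset_banach[OF norm_summable_imp_summable_on[OF *]]) auto
qed

definition euler_partial :: "nat \<Rightarrow> complex \<Rightarrow> complex" where
  "euler_partial k s = (\<Prod>p\<in>{p. prime p \<and> p \<le> k}. 1 - of_nat p powr (- s))"

lemma infsum_sieved:
  assumes s: "Re s > 1"
  shows "(\<Sum>\<^sub>\<infinity>n\<in>sieved k. of_nat n powr (- s)) = zeta s * euler_partial k s"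
proof (induction k)
  case 0
  have "(\<lambda>n. of_nat (Suc n) powr (- s)) sums zeta s"
    using zeta_sums[OF s] by (simp add: powr_minus_divide del: of_nat_Suc)
  then have "(\<lambda>n. of_nat n powr (- s)) sums (zeta s + of_nat 0 powr (- s))" by (rule sums_Suc)
  then have "(\<lambda>n. of_nat n powr (- s)) sums zeta s" by simp
  from norm_summable_imp_has_sum[OF summable_on_nat_powr(2)[OF s] this]
  have "((\<lambda>n. of_nat n powr (- s)) has_sum zeta s) {0<..}"
    by (subst (asm) has_sum_cong_neutral[where T = "{0<..}" and g = "\<lambda>n. of_nat n powr (- s)"]) auto
  moreover have "{p::nat. prime p \<and> p \<le> 0} = {}" by auto
  ultimately show ?case unfolding euler_partial_def sieved_0 by (simp add: infsumI)
next
  case (Suc k)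
  let ?a = "\<lambda>n::nat. of_nat n powr (- s) :: complex"
  show ?case
  proof (cases "prime (Suc k)")
    case False
    then have "{p. prime p \<and> p \<le> Suc k} = {p. prime p \<and> p \<le> k}" by (auto simp: le_Suc_eq)
    then show ?thesis using Suc by (simp add: sieved_Suc_not_prime[OF False] euler_partial_def)
  next
    case True
    have "infsum ?a (sieved k) = infsum ?a (sieved (Suc k)) + infsum ?a ((*) (Suc k) ` sieved k)"
      using sieved_Suc_prime[OF True] infsum_Un_disjoint[OF summable_on_nat_powr(1)[OF s] summable_on_nat_powr(1)[OF s]] by metis
    also have "infsum ?a ((*) (Suc k) ` sieved k) = infsum (?a \<circ> (*) (Suc k)) (sieved k)"
      by (rule infsum_reindex) (auto simp: inj_on_def simp del: mult_Suc)
    also have "\<dots> = infsum (\<lambda>n. ?a (Suc k) * ?a n) (sieved k)"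
      by (rule infsum_cong) (simp add: powr_times_real del: of_nat_Suc mult_Suc)
    also have "\<dots> = ?a (Suc k) * infsum ?a (sieved k)"
      by (rule infsum_cmult_right[OF summable_on_nat_powr(1)[OF s]])
    finally have "infsum ?a (sieved (Suc k)) = (1 - ?a (Suc k)) * infsum ?a (sieved k)" by (simp add: algebra_simps)
    also have "\<dots> = zeta s * ((1 - ?a (Suc k)) * euler_partial k s)" unfolding Suc.IH by (simp add: mult_ac)
    also have "(1 - ?a (Suc k)) * euler_partial k s = euler_partial (Suc k) s"
    proof -
      have "{p. prime p \<and> p \<le> Suc k} = insert (Suc k) {p. prime p \<and> p \<le> k}" using True by (auto simp: le_Suc_eq)
      then show ?thesis unfolding euler_partial_def by simp
    qed
    finally show ?thesis .
  qed
qed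

text \<open>An integer n > 1 has a prime factor and is sieved out once k \<ge> n, so only n = 1
  survives in the limit, the absolutely convergent Dirichlet series being the majorant. In
  particular \<zeta>(s) cannot vanish.\<close>

lemma zeta_euler_limit:
  assumes s: "Re s > 1"
  shows "(\<lambda>k. zeta s * euler_partial k s) \<longlonglongrightarrow> 1"
proof -
  let ?a = "\<lambda>n::nat. of_nat n powr (- s) :: complex"
  define F where "F = (\<lambda>n k. if n \<in> sieved k then ?a n else 0)"
  have nF: "norm (F n k) \<le> norm (?a n)" for n k by (simp add: F_def)
  have eq: "zeta s * euler_partial k s = (\<Sum>n. F n k)" for k
  proof -
    have sn: "summable (\<lambda>n. norm (F n k))"
      by (rule summable_comparison_test'[OF summable_on_nat_powr(2)[OF s]]) (use nF in auto)
    then have "((\<lambda>n. F n k) has_sum (\<Sum>n. F n k)) UNIV"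
      by (intro norm_summable_imp_has_sum summable_sums summable_norm_cancel[OF sn])
    then have "(?a has_sum (\<Sum>n. F n k)) (sieved k)"
      by (subst (asm) has_sum_cong_neutral[where T = "sieved k" and g = ?a]) (auto simp: F_def)
    then show ?thesis using infsum_sieved[OF s, of k] by (simp add: infsumI)
  qed
  have lim: "(F n \<longlongrightarrow> (if n = 1 then 1 else 0)) sequentially" for n
  proof (cases "n = 1")
    case True
    have "1 \<in> sieved k" for k by (auto simp: sieved_def)
    then show ?thesis using True by (simp add: F_def)
  next
    case False
    have "eventually (\<lambda>k. F n k = 0) sequentially"
    proof (cases "n = 0")
      case True
      then show ?thesis by (simp add: F_def)
    next
      case n0: False
      obtain p where p: "prime p" "p dvd n" using prime_factor_nat[OF False] by blast
      show ?thesis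
        using eventually_ge_at_top[of n]
      proof eventually_elim
        case (elim k)
        have "p \<le> k" using dvd_imp_le[OF p(2)] n0 elim by linarith
        then show ?case using p by (auto simp: F_def sieved_def)
      qed
    qed
    then show ?thesis using False by (simp add: tendsto_eventually)
  qed
  have "(\<lambda>k. \<Sum>n. F n k) \<longlonglongrightarrow> (\<Sum>n. if n = 1 then 1 else 0)"
    using nF by (intro tannery_sequentially[OF lim _ summable_on_nat_powr(2)[OF s]] always_eventually) auto
  moreover have "(\<Sum>n. if n = 1 then 1 else 0 :: complex) = 1"
    using sums_single[of 1 "\<lambda>_. 1::complex"] by (simp add: sums_iff)
  ultimately show ?thesis unfolding eq by simp
qed

lemma zeta_nonzero_Re_gt_1: "Re s > 1 \<Longrightarrow> zeta s \<noteq> 0"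
  using zeta_euler_limit[of s] LIMSEQ_unique[OF tendsto_const, of "0::complex" 1] by auto

section \<open>Nonvanishing on the line Re s = 1\<close>

text \<open>The 3-4-1 inequality for a single Euler factor. In the power series of the logarithm
  every coefficient contains 3 + 4 cos x + cos 2x = 2 (1 + cos x)^2 \<ge> 0.\<close>

lemma three_four_one:
  fixes w :: complex and r :: real
  assumes w: "norm w = 1" and r: "0 \<le> r" "r < 1"
  shows "norm (1 - complex_of_real r) ^ 3 * norm (1 - of_real r * w) ^ 4 * norm (1 - of_real r * w^2) \<le> 1"
proof -
  have L: "(\<lambda>n. - (z ^ n) / of_nat n) sums ln (1 - z)" if "norm z < 1" for z :: complex
    using Ln_series'[of "- z"] that by simp
  have n: "norm (complex_of_real r) < 1" "norm (complex_of_real r * w) < 1" "norm (complex_of_real r * w^2) < 1"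
    using w r by (auto simp: norm_mult norm_power)
  have nz: "1 - complex_of_real r \<noteq> 0" "1 - of_real r * w \<noteq> 0" "1 - of_real r * w^2 \<noteq> 0"
    using n by (metis (no_types) eq_iff_diff_eq_0 less_irrefl norm_one)+
  have S: "(\<lambda>n. Re (3 * (- (of_real r ^ n) / of_nat n) + 4 * (- ((of_real r * w) ^ n) / of_nat n) + (- ((of_real r * w^2) ^ n) / of_nat n)))
     sums Re (3 * ln (1 - of_real r) + 4 * ln (1 - of_real r * w) + ln (1 - of_real r * w^2))"
    by (intro sums_Re sums_add sums_mult L n)
  have "Re (3 * ln (1 - of_real r) + 4 * ln (1 - of_real r * w) + ln (1 - of_real r * w^2)) \<le> 0"
  proof (rule sums_le[OF _ S sums_zero])
    fix m :: nat
    define v where "v = w ^ m"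
    have v: "norm v = 1" using w by (simp add: v_def norm_power)
    then have "(Re v)^2 + (Im v)^2 = 1" by (metis cmod_power2 one_power2)
    then have "Re (v^2) = 2 * (Re v)^2 - 1" by (simp add: Re_power2)
    then have "3 + 4 * Re v + Re (v^2) = 2 * (1 + Re v)^2" by (simp add: power2_eq_square algebra_simps)
    then have p: "3 + 4 * Re v + Re (v^2) \<ge> 0" by simp
    have "3 * (- (of_real r ^ m) / of_nat m) + 4 * (- ((of_real r * w) ^ m) / of_nat m) + (- ((of_real r * w^2) ^ m) / of_nat m)
      = of_real (- (r ^ m / real m)) * (3 + 4 * v + v^2)"
      by (simp add: v_def power_mult_distrib power_commutes flip: power_mult) (simp add: algebra_simps add_divide_distrib)
    then have "Re (3 * (- (of_real r ^ m) / of_nat m) + 4 * (- ((of_real r * w) ^ m) / of_nat m) + (- ((of_real r * w^2) ^ m) / of_nat m))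
      = - (r ^ m / real m) * (3 + 4 * Re v + Re (v^2))" by simp
    also have "\<dots> \<le> 0" using p r by (intro mult_nonpos_nonneg) auto
    finally show "Re (3 * (- (of_real r ^ m) / of_nat m) + 4 * (- ((of_real r * w) ^ m) / of_nat m) + (- ((of_real r * w^2) ^ m) / of_nat m)) \<le> 0" .
  qed
  then have "exp (3 * ln (norm (1 - complex_of_real r)) + 4 * ln (norm (1 - of_real r * w)) + ln (norm (1 - of_real r * w^2))) \<le> 1"
    using nz by simp
  then show ?thesis using nz by (simp add: exp_add exp_of_nat_mult[of 3, simplified] exp_of_nat_mult[of 4, simplified])
qed

text \<open>Multiplying \<open>three_four_one\<close> over primes bounds the finite products, and
  \<zeta> times these products tends to 1. Logarithms are thus only taken of single factors.\<close>

lemma zeta_three_four_one: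
  assumes \<sigma>: "\<sigma> > 1"
  shows "norm (zeta (of_real \<sigma>)) ^ 3 * norm (zeta (Complex \<sigma> t)) ^ 4 * norm (zeta (Complex \<sigma> (2 * t))) \<ge> 1"
proof -
  let ?Z = "norm (zeta (of_real \<sigma>)) ^ 3 * norm (zeta (Complex \<sigma> t)) ^ 4 * norm (zeta (Complex \<sigma> (2 * t)))"
  let ?P = "\<lambda>k. norm (euler_partial k (of_real \<sigma>)) ^ 3 * norm (euler_partial k (Complex \<sigma> t)) ^ 4 * norm (euler_partial k (Complex \<sigma> (2 * t)))"
  have "(\<lambda>k. norm (zeta (of_real \<sigma>) * euler_partial k (of_real \<sigma>)) ^ 3 * norm (zeta (Complex \<sigma> t) * euler_partial k (Complex \<sigma> t)) ^ 4
      * norm (zeta (Complex \<sigma> (2 * t)) * euler_partial k (Complex \<sigma> (2 * t)))) \<longlonglongrightarrow> norm (1::complex) ^ 3 * norm (1::complex) ^ 4 * norm (1::complex)"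
    using \<sigma> by (intro tendsto_mult tendsto_power tendsto_norm zeta_euler_limit) auto
  then have lim: "(\<lambda>k. ?Z * ?P k) \<longlonglongrightarrow> 1"
    by (simp add: norm_mult power_mult_distrib mult_ac)
  have P: "?P k \<le> 1" for k
  proof -
    have "?P k = (\<Prod>p\<in>{p. prime p \<and> p \<le> k}. norm (1 - of_nat p powr (- of_real \<sigma>) :: complex) ^ 3 *
        norm (1 - of_nat p powr (- Complex \<sigma> t) :: complex) ^ 4 * norm (1 - of_nat p powr (- Complex \<sigma> (2 * t)) :: complex))"
      unfolding euler_partial_def prod_norm[symmetric] prod_power_distrib prod.distrib ..
    also have "\<dots> \<le> 1"
    proof (rule prod_le_1, intro conjI)
      fix p assume "p \<in> {p. prime p \<and> p \<le> k}"
      then have p: "p > 1" using prime_gt_1_nat by blast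
      define r where "r = real p powr (- \<sigma>)"
      define w where "w = (of_nat p :: complex) powr (- (\<i> * of_real t))"
      have r: "0 \<le> r" "r < 1" using p \<sigma> by (auto simp: r_def powr_less_one)
      have w: "norm w = 1" unfolding w_def using p by (simp add: norm_nat_powr)
      have 0: "of_nat p powr (- of_real \<sigma>) = complex_of_real r"
        using powr_of_real[of "real p" "- \<sigma>"] by (simp add: r_def)
      have 1: "of_nat p powr (- Complex \<sigma> t) = of_real r * w"
      proof -
        have "- Complex \<sigma> t = - of_real \<sigma> + - (\<i> * of_real t)" by (simp add: complex_eq_iff)
        then show ?thesis unfolding w_def 0[symmetric] by (simp only: powr_add)
      qed
      have 2: "of_nat p powr (- Complex \<sigma> (2 * t)) = of_real r * w^2"
      proof -
        have "- Complex \<sigma> (2 * t) = - of_real \<sigma> + (- (\<i> * of_real t) + - (\<i> * of_real t))" by (simp add: complex_eq_iff)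
        then show ?thesis unfolding w_def 0[symmetric] power2_eq_square by (simp only: powr_add)
      qed
      show "norm (1 - of_nat p powr (- of_real \<sigma>) :: complex) ^ 3 *
        norm (1 - of_nat p powr (- Complex \<sigma> t) :: complex) ^ 4 * norm (1 - of_nat p powr (- Complex \<sigma> (2 * t)) :: complex) \<le> 1"
        unfolding 0 1 2 by (rule three_four_one[OF w r])
    qed simp
    finally show ?thesis .
  qed
  have "?Z * ?P k \<le> ?Z" for k using P[of k] by (intro mult_left_le) auto
  then show ?thesis by (intro LIMSEQ_le_const2[OF lim]) auto
qed

text \<open>A zero at 1 + i t, taken to the fourth power, would outweigh the pole at 1, taken to the
  third: a factor \<sigma> - 1 is left over and tends to 0, against the lower bound 1.\<close>

lemma zeta_nonzero_Re_eq_1: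
  assumes t: "t \<noteq> 0"
  shows "zeta (Complex 1 t) \<noteq> 0"
proof
  assume z0: "zeta (Complex 1 t) = 0"
  have opn: "open (- {1::complex})" by auto
  have ev: "eventually (\<lambda>\<sigma>::real. \<sigma> > 1) (at_right 1)" by (simp add: eventually_at_filter)
  have line: "((\<lambda>\<sigma>. Complex \<sigma> u) \<longlongrightarrow> Complex 1 u) (at_right 1)" for u
    by (intro tendsto_Complex tendsto_const tendsto_ident_at)
  have A: "((\<lambda>\<sigma>. zeta (Complex \<sigma> (2 * t))) \<longlongrightarrow> zeta (Complex 1 (2 * t))) (at_right 1)"
    by (rule isCont_tendsto_compose[OF zeta_isCont line]) (use t in \<open>auto simp: complex_eq_iff\<close>)
  obtain D where D: "(zeta has_field_derivative D) (at (Complex 1 t))"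
    using zeta_holomorphic t unfolding holomorphic_on_open[OF opn] by (metis Compl_iff complex.sel(2) one_complex.sel(2) singletonD)
  have "((\<lambda>s. (zeta s - zeta (Complex 1 t)) / (s - Complex 1 t)) \<longlongrightarrow> D) (at (Complex 1 t))"
    using D by (simp add: has_field_derivative_iff)
  moreover have "filterlim (\<lambda>\<sigma>. Complex \<sigma> t) (at (Complex 1 t)) (at_right 1)"
    using line by (rule filterlim_atI) (simp add: eventually_at_filter)
  ultimately have "((\<lambda>\<sigma>. (zeta (Complex \<sigma> t) - zeta (Complex 1 t)) / (Complex \<sigma> t - Complex 1 t)) \<longlongrightarrow> D) (at_right 1)"
    by (rule filterlim_compose)
  moreover have "Complex \<sigma> t - Complex 1 t = of_real (\<sigma> - 1)" for \<sigma> by (simp add: complex_eq_iff)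
  ultimately have B: "((\<lambda>\<sigma>. zeta (Complex \<sigma> t) / of_real (\<sigma> - 1)) \<longlongrightarrow> D) (at_right 1)"
    by (simp only: z0 diff_zero)
  \<comment> \<open>This is (s - 1) \<zeta>(s), continued through the pole.\<close>
  define h where "h = (\<lambda>s. xi s * of_real pi powr (s / 2) * rGamma (s / 2 + 1) / 2)"
  have "h holomorphic_on UNIV" unfolding h_def by (intro holomorphic_intros) auto
  then have "isCont h 1" using holomorphic_on_imp_continuous_on continuous_on_eq_continuous_at open_UNIV by blast
  moreover have "((\<lambda>\<sigma>. complex_of_real \<sigma>) \<longlongrightarrow> of_real 1) (at_right 1)" by (intro tendsto_of_real tendsto_ident_at)
  ultimately have H: "((\<lambda>\<sigma>. h (of_real \<sigma>)) \<longlongrightarrow> h 1) (at_right 1)" using isCont_tendsto_compose by fastforce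
  have "((\<lambda>\<sigma>. \<sigma> - 1) \<longlongrightarrow> (1 - 1::real)) (at_right 1)" by (intro tendsto_diff tendsto_const tendsto_ident_at)
  then have E: "((\<lambda>\<sigma>. \<sigma> - 1) \<longlongrightarrow> (0::real)) (at_right 1)" by simp
  have lim: "((\<lambda>\<sigma>. norm (h (of_real \<sigma>)) ^ 3 * norm (zeta (Complex \<sigma> t) / of_real (\<sigma> - 1)) ^ 4 * norm (zeta (Complex \<sigma> (2 * t))) * (\<sigma> - 1)) \<longlongrightarrow>
      norm (h 1) ^ 3 * norm D ^ 4 * norm (zeta (Complex 1 (2 * t))) * 0) (at_right 1)"
    by (intro tendsto_mult tendsto_power tendsto_norm H B A E)
  have "eventually (\<lambda>\<sigma>. norm (h (of_real \<sigma>)) ^ 3 * norm (zeta (Complex \<sigma> t) / of_real (\<sigma> - 1)) ^ 4 * norm (zeta (Complex \<sigma> (2 * t))) * (\<sigma> - 1) \<ge> 1) (at_right 1)"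
    using ev
  proof eventually_elim
    case (elim \<sigma>)
    have hz: "h (of_real \<sigma>) = zeta (of_real \<sigma>) * of_real (\<sigma> - 1)"
      using elim by (simp add: zeta_eq_xi h_def divide_simps) (simp add: algebra_simps)?
    have pos: "\<sigma> - 1 > 0" using elim by simp
    have n: "norm (complex_of_real (\<sigma> - 1)) = \<sigma> - 1" using elim by (simp only: norm_of_real)
    have alg: "(a * x) ^ 3 * (b / x) ^ 4 * c * x = a ^ 3 * b ^ 4 * c" if "x > 0" for a b c x :: real
      using that by (simp add: field_simps power_mult_distrib eval_nat_numeral)
    show ?case
      unfolding hz norm_mult norm_divide n alg[OF pos] by (rule zeta_three_four_one[OF elim])
  qed
  from tendsto_lowerbound[OF lim this] show False by simp
qed

lemma zeta_nonzero_Re_ge_1: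
  assumes "Re s \<ge> 1" "s \<noteq> 1"
  shows "zeta s \<noteq> 0"
proof (cases "Re s = 1")
  case True
  then have "s = Complex 1 (Im s)" "Im s \<noteq> 0" using assms by (auto simp: complex_eq_iff)
  then show ?thesis using zeta_nonzero_Re_eq_1 by metis
qed (use assms zeta_nonzero_Re_gt_1 in auto)

lemma xi_zero_iff_zeta_zero:
  assumes "Im s \<noteq> 0 \<or> Re s > 1"
  shows "xi s = 0 \<longleftrightarrow> zeta s = 0"
proof -
  have "s \<noteq> 1" using assms by auto
  moreover have "s / 2 + 1 \<notin> \<int>\<^sub>\<le>\<^sub>0" using assms by (auto elim!: nonpos_Ints_cases simp: complex_eq_iff)
  then have "rGamma (s / 2 + 1) \<noteq> 0" by (simp add: rGamma_eq_zero_iff)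
  ultimately show ?thesis by (simp add: zeta_eq_xi)
qed

text \<open>Zeros with Re s \<ge> 1 are excluded by the nonvanishing of \<zeta>, those with Re s
  \<le> 0 by s \<mapsto> 1 - s.\<close>

theorem xi_zero_in_strip:
  assumes "xi s = 0"
  shows "0 < Re s" "Re s < 1" "Im s \<noteq> 0"
proof -
  have 1: "Re s < 1" if "xi s = 0" for s
  proof (rule ccontr)
    assume "\<not> Re s < 1"
    then have r: "Re s \<ge> 1" by simp
    have "s \<noteq> 1" using that by auto
    then have "Im s \<noteq> 0 \<or> Re s > 1" using r by (auto simp: complex_eq_iff)
    then show False using xi_zero_iff_zeta_zero that zeta_nonzero_Re_ge_1[OF r \<open>s \<noteq> 1\<close>] by blast
  qed
  show "Re s < 1" "0 < Re s" using 1[of s] 1[of "1 - s"] assms xi_reflect[of s] by auto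
  then show "Im s \<noteq> 0" using xi_nonzero_unit_interval[of s] assms by auto
qed

section \<open>Counting zeros\<close>

lemma finite_xi_zeros:
  assumes "compact A"
  shows "finite {s \<in> A. xi s = 0}"
proof (rule ccontr)
  assume "infinite {s \<in> A. xi s = 0}"
  then obtain x where "x \<in> A" "x islimpt {s \<in> A. xi s = 0}"
    using assms unfolding compact_eq_Bolzano_Weierstrass by (metis (no_types, lifting) mem_Collect_eq subsetI)
  then have "xi 0 = 0"
    by (intro analytic_continuation[of xi UNIV "{s \<in> A. xi s = 0}" x 0]) (auto intro!: holomorphic_intros)
  then show False by simp
qed

lemma finite_xi_zeros_below: "finite {s. xi s = 0 \<and> \<bar>Im s\<bar> \<le> t}"
proof (rule finite_subset)
  show "finite {s \<in> cbox (Complex 0 (- t)) (Complex 1 t). xi s = 0}"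
    by (rule finite_xi_zeros) (rule compact_cbox)
  show "{s. xi s = 0 \<and> \<bar>Im s\<bar> \<le> t} \<subseteq> {s \<in> cbox (Complex 0 (- t)) (Complex 1 t). xi s = 0}"
    using xi_zero_in_strip by (force simp: in_cbox_complex_iff)
qed

lemma xi_eventually_nonzero: "eventually (\<lambda>s. xi s \<noteq> 0) (at z)"
proof (rule ccontr)
  assume "\<not> eventually (\<lambda>s. xi s \<noteq> 0) (at z)"
  then have "frequently (\<lambda>s. xi s = 0) (at z)" by (simp add: frequently_def)
  then have "z islimpt {s. xi s = 0}" by (simp add: islimpt_conv_frequently_at)
  then have "xi 0 = 0"
    by (intro analytic_continuation[of xi UNIV "{s. xi s = 0}" z 0]) (auto intro!: holomorphic_intros)
  then show False by simp
qed

lemma xi_analytic: "xi analytic_on A"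
  by (rule analytic_on_subset[of _ UNIV]) (auto simp: analytic_on_open intro!: holomorphic_intros)

lemma zorder_xi_reflect: "zorder xi (1 - s) = zorder xi s"
proof -
  have "zorder xi (1 - s) = zorder (\<lambda>u. xi (u + (1 - s))) 0" by (rule zorder_shift)
  also have "(\<lambda>u. xi (u + (1 - s))) = (\<lambda>u. xi ((-1) * u + s))"
    using xi_reflect by (simp add: fun_eq_iff) (metis diff_diff_eq2 diff_add_eq add.commute)
  also have "zorder (\<lambda>u. xi ((-1) * u + s)) 0 = zorder (\<lambda>u. xi (u + s)) 0"
  proof -
    have "(\<lambda>u. xi (u + s)) analytic_on {(-1) * 0}"
      by (rule analytic_on_subset[of _ UNIV]) (auto simp: analytic_on_open intro!: holomorphic_intros)
    then show ?thesis
      using zorder_scale[OF analytic_on_imp_meromorphic_on, of "\<lambda>u. xi (u + s)" "-1" 0] by simp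
  qed
  also have "\<dots> = zorder xi s" using zorder_shift[of xi s] by simp
  finally show ?thesis .
qed

lemma zorder_zeta_eq_xi:
  assumes "Im s \<noteq> 0"
  shows "zorder zeta s = zorder xi s"
proof -
  define h where "h = (\<lambda>s. of_real pi powr (s / 2) * rGamma (s / 2 + 1) / (2 * (s - 1)) :: complex)"
  have s1: "s \<noteq> 1" using assms by auto
  have "s / 2 + 1 \<notin> \<int>\<^sub>\<le>\<^sub>0" using assms by (auto elim!: nonpos_Ints_cases simp: complex_eq_iff)
  then have h0: "h s \<noteq> 0" using s1 by (simp add: h_def rGamma_eq_zero_iff)
  have hol: "h holomorphic_on - {1}" unfolding h_def by (intro holomorphic_intros) auto
  then have ha: "h analytic_on {s}" using s1 by (intro analytic_at[THEN iffD2]) (auto intro!: exI[of _ "- {1}"])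
  have "eventually (\<lambda>w. w \<in> - {1}) (nhds s)" using s1 by (intro eventually_nhds_in_open) auto
  then have "eventually (\<lambda>w. zeta w = xi w * h w) (nhds s)"
    by eventually_elim (simp add: zeta_eq_xi h_def)
  then have "zorder zeta s = zorder (\<lambda>w. xi w * h w) s" by (intro zorder_cong) (auto simp: eventually_nhds_conv_at)
  also have "\<dots> = zorder xi s + zorder h s"
  proof (rule zorder_times_analytic[OF xi_analytic ha])
    have "isCont h s" using analytic_at_imp_isCont ha by blast
    then have "eventually (\<lambda>w. h w \<noteq> 0) (at s)" using h0 by (metis isCont_def tendsto_imp_eventually_ne)
    then show "eventually (\<lambda>w. xi w * h w \<noteq> 0) (at s)"
      using xi_eventually_nonzero[of s] by eventually_elim auto
  qed
  also have "zorder h s = 0" by (rule zorder_eq_0I[OF ha h0])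
  finally show ?thesis by simp
qed

lemma zorder_zeta_pos:
  assumes "xi s = 0"
  shows "zorder zeta s \<ge> 1"
proof -
  have "zorder xi s > 0"
    using zorder_pos_iff'[OF xi_analytic eventually_frequently[OF at_neq_bot xi_eventually_nonzero], of s] assms by simp
  then show ?thesis using zorder_zeta_eq_xi[OF xi_zero_in_strip(3)[OF assms]] by simp
qed

text \<open>Indexed by a set of ordinates, so that the counts up to t with and without the endpoint
  and the zeros between two Gram points are values of one additive function.\<close>

definition zero_count :: "real set \<Rightarrow> int" where
  "zero_count A = (\<Sum>s\<in>{s. xi s = 0 \<and> Im s \<in> A}. zorder zeta s)"

section \<open>The argument principle on a symmetric rectangle\<close>

lemma contour_integral_linepath_reflect:
  assumes "\<And>s. f (1 - s) = - f s"
  shows "contour_integral (linepath (1 - a) (1 - b)) f = contour_integral (linepath a b) f"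
proof -
  have l: "linepath (1 - a) (1 - b) x = 1 - linepath a b x" for x
    by (simp add: linepath_def scaleR_conv_of_real algebra_simps)
  have "f (linepath (1 - a) (1 - b) x) * ((1 - b) - (1 - a)) = f (linepath a b x) * (b - a)" for x
    unfolding l assms by (simp add: algebra_simps)
  then show ?thesis
    unfolding contour_integral_integral vector_derivative_linepath_at by (simp only:)
qed

lemma contour_integral_linepath_cnj:
  assumes "\<And>s. f (cnj s) = cnj (f s)"
  shows "contour_integral (linepath (cnj a) (cnj b)) f = cnj (contour_integral (linepath a b) f)"
proof -
  have l: "linepath (cnj a) (cnj b) x = cnj (linepath a b x)" for x
    by (simp add: linepath_def)
  show ?thesis
    unfolding contour_integral_integral vector_derivative_linepath_at integral_cnj l assms by simp
qed

definition xi_logderiv :: "complex \<Rightarrow> complex" where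
  "xi_logderiv s = deriv xi s / xi s"

lemma xi_has_deriv: "(xi has_field_derivative deriv xi s) (at s)"
  by (rule holomorphic_derivI[of _ UNIV]) (auto intro!: holomorphic_intros)

lemma xi_logderiv_reflect: "xi_logderiv (1 - s) = - xi_logderiv s"
proof -
  have "((\<lambda>s. xi (1 - s)) has_field_derivative deriv xi (1 - s) * (-1)) (at s)"
    by (rule DERIV_chain2[OF xi_has_deriv]) (auto intro!: derivative_eq_intros)
  then have "deriv xi s = - deriv xi (1 - s)"
    unfolding xi_reflect using DERIV_imp_deriv by fastforce
  then show ?thesis by (simp add: xi_logderiv_def xi_reflect)
qed

lemma xi_logderiv_cnj: "xi_logderiv (cnj s) = cnj (xi_logderiv s)"
proof -
  have "cnj \<circ> xi \<circ> cnj = xi" by (simp add: fun_eq_iff xi_cnj)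
  then have "deriv xi (cnj s) = cnj (deriv xi s)"
    using has_field_derivative_cnj_cnj[of xi "deriv xi s" "cnj s"] xi_has_deriv[of s]
    by (intro DERIV_imp_deriv) (simp only: complex_cnj_cnj)
  then show ?thesis by (simp add: xi_logderiv_def xi_cnj)
qed

lemma continuous_on_xi_logderiv:
  assumes "\<And>s. s \<in> A \<Longrightarrow> xi s \<noteq> 0"
  shows "continuous_on A xi_logderiv"
  unfolding xi_logderiv_def
  by (intro continuous_on_divide holomorphic_on_imp_continuous_on holomorphic_on_subset[OF holomorphic_deriv[of xi UNIV]])
     (use assms in \<open>auto intro!: holomorphic_intros\<close>)

text \<open>
  The boundary of the rectangle with corners \<open>- 1 - \<i> T\<close> and \<open>2 + \<i> T\<close> consists of four images of
  the path from \<open>2\<close> over \<open>2 + \<i> T\<close> to \<open>1/2 + \<i> T\<close> under \<open>s \<mapsto> 1 - s\<close> and complex conjugation.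
\<close>

lemma zero_count_contour:
  assumes T: "T > 0" and nz: "\<And>s. xi s = 0 \<Longrightarrow> Im s \<noteq> T"
  shows "Im (contour_integral (linepath 2 (Complex 2 T)) xi_logderiv
       + contour_integral (linepath (Complex 2 T) (Complex (1/2) T)) xi_logderiv) = pi * of_int (zero_count {0<..<T})"
proof -
  let ?I = "\<lambda>a b. contour_integral (linepath a b) xi_logderiv"
  define V where "V = ?I 2 (Complex 2 T)"
  define H where "H = ?I (Complex 2 T) (Complex (1/2) T)"
  define a1 where "a1 = Complex (-1) (- T)"
  define a2 where "a2 = Complex 2 (- T)"
  define a3 where "a3 = Complex 2 T"
  define a4 where "a4 = Complex (-1) T"
  note a_def = a1_def a2_def a3_def a4_def
  have nz': "Im s \<noteq> - T" if "xi s = 0" for s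
    using nz[of "1 - s"] that by (auto simp: xi_reflect)
  have rev: "?I b a = - ?I a b" for a b
    using contour_integral_reversepath[of "linepath a b" xi_logderiv] by simp
  have refl: "?I (1 - a) (1 - b) = ?I a b" for a b
    by (rule contour_integral_linepath_reflect) (rule xi_logderiv_reflect)
  have conj: "?I (cnj a) (cnj b) = cnj (?I a b)" for a b
    by (rule contour_integral_linepath_cnj) (rule xi_logderiv_cnj)
  have seg: "xi s \<noteq> 0" if "s \<in> closed_segment a2 a3 \<union> closed_segment a3 a4 \<union> closed_segment a1 a2 \<union> closed_segment a4 a1" for s
  proof
    assume z: "xi s = 0"
    note z' = xi_zero_in_strip[OF z] nz[OF z] nz'[OF z]
    show False using that z' by (auto simp: closed_segment_same_Im closed_segment_same_Re a_def)
  qed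
  have right: "?I a2 a3 = V - cnj V"
  proof -
    have "?I a2 a3 = ?I a2 2 + ?I 2 a3"
      by (rule contour_integral_split_linepath, rule continuous_on_xi_logderiv)
         (use seg T in \<open>auto simp: closed_segment_same_Re a_def closed_segment_eq_real_ivl\<close>)
    also have "?I a2 2 = - ?I (cnj 2) (cnj a3)" by (subst rev) (simp add: a_def complex_cnj)
    also have "\<dots> = - cnj V" unfolding conj V_def a3_def ..
    finally show ?thesis by (simp add: V_def a3_def)
  qed
  have top: "?I a3 a4 = H - cnj H"
  proof -
    have "?I a3 a4 = ?I a3 (Complex (1/2) T) + ?I (Complex (1/2) T) a4"
      by (rule contour_integral_split_linepath, rule continuous_on_xi_logderiv)
         (use seg T in \<open>auto simp: closed_segment_same_Im a_def closed_segment_eq_real_ivl\<close>)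
    also have "?I (Complex (1/2) T) a4 = ?I (1 - cnj (Complex (1/2) T)) (1 - cnj a3)"
      by (rule arg_cong2[where f = ?I]) (simp_all add: a_def complex_eq_iff)
    also have "\<dots> = - cnj H" unfolding refl conj by (subst rev) (simp add: H_def a3_def)
    finally show ?thesis by (simp add: H_def a3_def)
  qed
  have left: "?I a4 a1 = V - cnj V"
  proof -
    have "?I a4 a1 = ?I (1 - a2) (1 - a3)"
      by (rule arg_cong2[where f = ?I]) (simp_all add: a_def complex_eq_iff)
    then show ?thesis unfolding refl right .
  qed
  have bottom: "?I a1 a2 = H - cnj H"
  proof -
    have "?I a1 a2 = ?I (1 - a3) (1 - a4)"
      by (rule arg_cong2[where f = ?I]) (simp_all add: a_def complex_eq_iff)
    then show ?thesis unfolding refl top .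
  qed
  have rect: "rectpath a1 a3 = linepath a1 a2 +++ linepath a2 a3 +++ linepath a3 a4 +++ linepath a4 a1"
    by (simp add: rectpath_def Let_def a_def)
  have ci: "xi_logderiv contour_integrable_on linepath a b" if "{a, b} = {a1, a2} \<or> {a, b} = {a2, a3} \<or> {a, b} = {a3, a4} \<or> {a, b} = {a4, a1}" for a b
    by (rule contour_integrable_continuous_linepath, rule continuous_on_xi_logderiv, rule seg)
       (use that in \<open>auto simp: doubleton_eq_iff closed_segment_commute\<close>)
  \<comment> \<open>By the two symmetries each side contributes 2 i times the imaginary part of V or
    of H.\<close>
  have total: "contour_integral (rectpath a1 a3) xi_logderiv = 4 * \<i> * of_real (Im (V + H))"
  proof -
    have "contour_integral (rectpath a1 a3) xi_logderiv = ?I a1 a2 + (?I a2 a3 + (?I a3 a4 + ?I a4 a1))"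
      unfolding rect by (simp add: ci)
    also have "\<dots> = 4 * \<i> * of_real (Im (V + H))"
      unfolding right top left bottom by (simp add: complex_eq_iff)
    finally show ?thesis .
  qed
  \<comment> \<open>An open convex box around the rectangle, as domain for the argument principle;
    its zeros beyond the contour have winding number 0.\<close>
  define S where "S = box (Complex (-2) (- T - 1)) (Complex 3 (T + 1))"
  have path_S: "path_image (rectpath a1 a3) \<subseteq> S"
  proof -
    have "path_image (rectpath a1 a3) \<subseteq> cbox a1 a3"
      using T by (intro path_image_rectpath_subset_cbox) (auto simp: a_def)
    also have "\<dots> \<subseteq> S" using T by (auto simp: S_def a_def in_box_complex_iff in_cbox_complex_iff)
    finally show ?thesis .
  qed
  have path_nz: "xi s \<noteq> 0" if "s \<in> path_image (rectpath a1 a3)" for s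
    using that seg[of s] unfolding rect by (auto simp: path_image_join)
  have finS: "finite {w \<in> S. xi w = 0}"
  proof (rule finite_subset[OF _ finite_xi_zeros])
    show "{w \<in> S. xi w = 0} \<subseteq> {w \<in> cbox (Complex (-2) (- T - 1)) (Complex 3 (T + 1)). xi w = 0}"
      using box_subset_cbox by (auto simp: S_def)
  qed (rule compact_cbox)
  let ?ZT = "{w. xi w = 0 \<and> \<bar>Im w\<bar> < T}"
  have "contour_integral (rectpath a1 a3) (\<lambda>x. deriv xi x * 1 / xi x) =
      2 * pi * \<i> * (\<Sum>p\<in>{w \<in> S. xi w = 0 \<or> w \<in> {}}. winding_number (rectpath a1 a3) p * 1 * zorder xi p)"
  proof (rule argument_principle)
    show "open S" unfolding S_def by (rule open_box)
    show "connected S" unfolding S_def by (intro convex_connected convex_box)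
    show "path_image (rectpath a1 a3) \<subseteq> S - {w \<in> S. xi w = 0 \<or> w \<in> {}}" using path_S path_nz by auto
    show "\<forall>z. z \<notin> S \<longrightarrow> winding_number (rectpath a1 a3) z = 0"
      using path_S by (intro allI impI winding_number_zero_outside[of _ S]) (auto simp: S_def convex_box)
  qed (use finS in \<open>auto intro!: holomorphic_intros\<close>)
  then have "contour_integral (rectpath a1 a3) xi_logderiv =
      2 * pi * \<i> * (\<Sum>p\<in>{w \<in> S. xi w = 0}. winding_number (rectpath a1 a3) p * zorder xi p)"
    by (simp add: xi_logderiv_def[abs_def])
  also have "(\<Sum>p\<in>{w \<in> S. xi w = 0}. winding_number (rectpath a1 a3) p * zorder xi p) =
      (\<Sum>p\<in>?ZT. of_int (zorder xi p))"
  proof (rule sum.mono_neutral_cong_right[OF finS])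
    show "?ZT \<subseteq> {w \<in> S. xi w = 0}"
      using xi_zero_in_strip by (force simp: S_def in_box_complex_iff)
    show "\<forall>i\<in>{w \<in> S. xi w = 0} - ?ZT. winding_number (rectpath a1 a3) i * of_int (zorder xi i) = 0"
    proof
      fix w assume w: "w \<in> {w \<in> S. xi w = 0} - ?ZT"
      then have "w \<notin> cbox a1 a3" using nz[of w] nz'[of w] by (auto simp: a_def in_cbox_complex_iff)
      then have "winding_number (rectpath a1 a3) w = 0" 
        using T by (intro winding_number_rectpath_outside) (auto simp: a_def)
      then show "winding_number (rectpath a1 a3) w * of_int (zorder xi w) = 0" by simp
    qed
    show "winding_number (rectpath a1 a3) w * of_int (zorder xi w) = of_int (zorder xi w)"
      if "w \<in> ?ZT" for w
    proof -
      have "w \<in> box a1 a3" using that xi_zero_in_strip[of w] by (auto simp: a_def in_box_complex_iff)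
      then show ?thesis by (simp add: winding_number_rectpath)
    qed
  qed
  also have "\<dots> = of_int (\<Sum>p\<in>?ZT. zorder xi p)" by simp
  \<comment> \<open>The map s \<mapsto> 1 - s matches the zeros above the real axis with those
    below, and none is real. Hence 2 pi i times twice the count equals 4 i Im (V + H).\<close>
  also have "(\<Sum>p\<in>?ZT. zorder xi p) = 2 * zero_count {0<..<T}"
  proof -
    let ?Z = "{w. xi w = 0 \<and> Im w \<in> {0<..<T}}"
    have fin: "finite ?Z" by (rule finite_subset[OF _ finite_xi_zeros_below[of T]]) auto
    have split: "?ZT = ?Z \<union> (\<lambda>w. 1 - w) ` ?Z"
    proof (intro equalityI subsetI)
      fix w assume w: "w \<in> ?ZT"
      then have "Im w \<noteq> 0" using xi_zero_in_strip(3) by blast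
      moreover have "w = 1 - (1 - w)" by simp
      ultimately show "w \<in> ?Z \<union> (\<lambda>w. 1 - w) ` ?Z"
        using w by (cases "Im w > 0") (auto simp: xi_reflect intro!: rev_image_eqI[of "1 - w"])
    qed (auto simp: xi_reflect)
    have "(\<Sum>p\<in>?ZT. zorder xi p) = (\<Sum>p\<in>?Z. zorder xi p) + (\<Sum>p\<in>(\<lambda>w. 1 - w) ` ?Z. zorder xi p)"
      unfolding split using fin by (intro sum.union_disjoint) auto
    also have "(\<Sum>p\<in>(\<lambda>w. 1 - w) ` ?Z. zorder xi p) = (\<Sum>p\<in>?Z. zorder xi (1 - p))"
      by (subst sum.reindex) (auto simp: inj_on_def)
    also have "\<dots> = (\<Sum>p\<in>?Z. zorder xi p)" by (simp add: zorder_xi_reflect)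
    also have "(\<Sum>p\<in>?Z. zorder xi p) = zero_count {0<..<T}"
      unfolding zero_count_def by (intro sum.cong refl) (auto simp: zorder_zeta_eq_xi)
    finally show ?thesis by simp
  qed
  finally have "4 * \<i> * of_real (Im (V + H)) = 4 * \<i> * of_real (pi * of_int (zero_count {0<..<T}))"
    unfolding total by simp
  then have "of_real (Im (V + H)) = complex_of_real (pi * of_int (zero_count {0<..<T}))" by simp
  then show ?thesis unfolding V_def H_def by (simp only: of_real_eq_iff)
qed

section \<open>The Riemann-von Mangoldt formula\<close>

text \<open>The union of balls of a fixed radius around the segment is a Minkowski sum of two convex
  sets, hence convex, and a nonvanishing holomorphic function on it has a logarithm.\<close>

lemma holomorphic_log_near_segment:
  fixes f :: "complex \<Rightarrow> complex"
  assumes f: "f holomorphic_on U" "open U" and seg: "closed_segment a b \<subseteq> U"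
    and nz: "\<And>z. z \<in> closed_segment a b \<Longrightarrow> f z \<noteq> 0"
  obtains W g where "open W" "closed_segment a b \<subseteq> W" "W \<subseteq> U" "g holomorphic_on W" "\<And>z. z \<in> W \<Longrightarrow> exp (g z) = f z"
proof -
  have op: "open (U \<inter> f -` (- {0}))"
    by (rule continuous_open_preimage[OF holomorphic_on_imp_continuous_on[OF f(1)] f(2)]) auto
  obtain e where e: "e > 0" "(\<Union>x\<in>closed_segment a b. ball x e) \<subseteq> U \<inter> f -` (- {0})"
    by (rule compact_subset_open_imp_ball_epsilon_subset[OF compact_segment op]) (use seg nz in auto)
  define W where "W = (\<Union>x\<in>closed_segment a b. \<Union>y\<in>ball 0 e. {x + y})"
  have W: "W \<subseteq> (\<Union>x\<in>closed_segment a b. ball x e)"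
    by (auto simp: W_def dist_norm)
  have oW: "open W" unfolding W_def by (intro open_sums) auto
  have cW: "convex W" unfolding W_def by (intro convex_sums) auto
  have sW: "closed_segment a b \<subseteq> W" using e(1) by (force simp: W_def)
  have WU: "W \<subseteq> U" using W e(2) by blast
  have "f z \<noteq> 0" if "z \<in> W" for z using that W e(2) by blast
  moreover have "a \<in> W" using sW by auto
  ultimately obtain g where g: "g holomorphic_on W" "\<And>z. z \<in> W \<Longrightarrow> exp (g z) = f z"
    using holomorphic_logarithm_exists[OF cW oW holomorphic_on_subset[OF f(1) WU]] by blast
  show ?thesis by (rule that[OF oW sW WU g])
qed

lemma contour_integral_logderiv:
  assumes W: "open W" "closed_segment a b \<subseteq> W" and G: "G holomorphic_on W" "\<And>z. z \<in> W \<Longrightarrow> exp (G z) = F z"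
  shows "contour_integral (linepath a b) (\<lambda>z. deriv F z / F z) = G b - G a"
proof -
  have "((\<lambda>z. deriv F z / F z) has_contour_integral G (pathfinish (linepath a b)) - G (pathstart (linepath a b))) (linepath a b)"
  proof (rule contour_integral_primitive[of W])
    fix z assume z: "z \<in> W"
    have Gd: "(G has_field_derivative deriv G z) (at z)" by (rule holomorphic_derivI[OF G(1) W(1) z])
    have "((\<lambda>z. exp (G z)) has_field_derivative exp (G z) * deriv G z) (at z)"
      by (rule DERIV_chain2[OF DERIV_exp Gd])
    then have "((\<lambda>z. exp (G z)) has_field_derivative F z * deriv G z) (at z)" by (simp only: G(2)[OF z])
    then have "(F has_field_derivative F z * deriv G z) (at z)"
      by (rule has_field_derivative_transform_within_open[OF _ W(1) z]) (use G(2) in auto)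
    then have "deriv F z = F z * deriv G z" by (rule DERIV_imp_deriv)
    moreover have "F z \<noteq> 0" using G(2)[OF z] by (metis exp_not_eq_zero)
    ultimately show "(G has_field_derivative deriv F z / F z) (at z within W)"
      using Gd by (simp add: has_field_derivative_at_within)
  qed (use W in auto)
  then show ?thesis by (simp add: contour_integral_unique)
qed

lemma zeta_2_real: "zeta 2 = of_real (Re (zeta 2))" and zeta_2_pos: "Re (zeta 2) > 0"
proof -
  have z: "(\<lambda>n. complex_of_real (1 / (real (Suc n))^2)) sums zeta 2"
    using zeta_sums[of 2] by (simp del: of_nat_Suc)
  then have r: "(\<lambda>n. 1 / (real (Suc n))^2) sums Re (zeta 2)" using sums_Re by fastforce
  from sums_of_real[OF this] z show "zeta 2 = of_real (Re (zeta 2))" using sums_unique2 by blast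
  show "Re (zeta 2) > 0"
    using suminf_pos[of "\<lambda>n. 1 / (real (Suc n))^2"] r by (auto simp: sums_iff simp del: of_nat_Suc)
qed

text \<open>Along the path, log \<xi> splits into an explicit function and a logarithm of \<zeta>.
  The former contributes pi + \<theta>(T) to the change of argument, the latter pi S(T). The second
  claim records the argument of \<zeta> at the endpoint modulo 2 pi, from which parities of zero
  counts are read off.\<close>

lemma riemann_von_mangoldt:
  assumes T: "T > 0" and nz: "\<And>s. xi s = 0 \<Longrightarrow> Im s \<noteq> T"
  shows "of_int (zero_count {0<..<T}) = 1 + RS_theta T / pi + S_generic T"
    and "zeta (Complex (1/2) T) = of_real (norm (zeta (Complex (1/2) T))) * cis (pi * S_generic T)"
proof -
  define c where "c = Complex 2 T"
  define e where "e = Complex (1/2) T"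
  have xi_nz1: "xi s \<noteq> 0" if "s \<in> closed_segment 2 c" for s
    using that xi_zero_in_strip[of s] T by (auto simp: closed_segment_same_Re c_def closed_segment_eq_real_ivl)
  have xi_nz2: "xi s \<noteq> 0" if "s \<in> closed_segment c e" for s
    using that nz[of s] by (auto simp: closed_segment_same_Im c_def e_def)
  \<comment> \<open>Contains both segments of the path, avoids 1, and keeps s and s - 1 off the
    branch cut of \<open>Ln\<close>.\<close>
  define D where "D = {s::complex. Re s > 0 \<and> (Im s > 0 \<or> Re s > 1)}"
  have oD: "open D"
  proof -
    have "D = {s. Re s > 0} \<inter> ({s. Im s > 0} \<union> {s. Re s > 1})" by (auto simp: D_def)
    then show ?thesis by (simp add: open_Int open_Un open_halfspace_Re_gt open_halfspace_Im_gt)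
  qed
  have seg1D: "closed_segment 2 c \<subseteq> D" using T by (auto simp: closed_segment_same_Re c_def closed_segment_eq_real_ivl D_def)
  have seg2D: "closed_segment c e \<subseteq> D" using T by (auto simp: closed_segment_same_Im c_def e_def closed_segment_eq_real_ivl D_def)
  have D1: "1 \<notin> D" by (simp add: D_def)
  have nzD: "zeta s \<noteq> 0" if "s \<in> D" "xi s \<noteq> 0" for s
    using that xi_zero_iff_zeta_zero[of s] by (auto simp: D_def)
  have zD: "zeta holomorphic_on D" by (rule holomorphic_on_subset[OF zeta_holomorphic]) (use D1 in auto)
  obtain W1 g1 where 1: "open W1" "closed_segment 2 c \<subseteq> W1" "W1 \<subseteq> D" "g1 holomorphic_on W1" "\<And>z. z \<in> W1 \<Longrightarrow> exp (g1 z) = zeta z"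
    by (rule holomorphic_log_near_segment[OF zD oD seg1D]) (use xi_nz1 nzD seg1D in blast)+
  obtain W2 g2 where 2: "open W2" "closed_segment c e \<subseteq> W2" "W2 \<subseteq> D" "g2 holomorphic_on W2" "\<And>z. z \<in> W2 \<Longrightarrow> exp (g2 z) = zeta z"
    by (rule holomorphic_log_near_segment[OF zD oD seg2D]) (use xi_nz2 nzD seg2D in blast)+
  \<comment> \<open>A logarithm of \<xi> / \<zeta>.\<close>
  define h where "h = (\<lambda>s. Ln s + Ln (s - 1) - s / 2 * of_real (ln pi) + ln_Gamma (s / 2))"
  have hD: "h holomorphic_on D"
    unfolding h_def
    by (intro holomorphic_intros holomorphic_on_compose_gen[of "\<lambda>s. s / 2" D ln_Gamma "- \<real>\<^sub>\<le>\<^sub>0", unfolded o_def])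
       (auto simp: D_def complex_nonpos_Reals_iff)
  have exph: "exp (h s) * zeta s = xi s" if s: "s \<in> D" for s
  proof -
    have s0: "s \<noteq> 0" "s \<noteq> 1" "Re s > 0" using s by (auto simp: D_def)
    have ni: "s / 2 \<notin> \<int>\<^sub>\<le>\<^sub>0" using s0 by (auto elim!: nonpos_Ints_cases simp: complex_eq_iff)
    have P: "of_real pi powr (s / 2) = exp (s / 2 * of_real (ln pi))"
      by (simp add: powr_def Ln_of_real)
    have G: "exp (ln_Gamma (s / 2)) * rGamma (s / 2) = 1"
      using ni Gamma_complex_altdef[of "s / 2"] by (simp add: rGamma_inverse_Gamma)
    have "exp (h s) = s * (s - 1) * exp (ln_Gamma (s / 2)) / of_real pi powr (s / 2)"
      unfolding h_def P using s0 by (simp add: exp_add exp_diff)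
    moreover have "zeta s = xi s * of_real pi powr (s / 2) * rGamma (s / 2 + 1) / (2 * (s - 1))" by (rule zeta_eq_xi[OF s0(2)])
    moreover have alg: "s * x * E / P * (X * P * R / (2 * x)) = X * (E * (s / 2 * R))" if "P \<noteq> 0" "x \<noteq> 0" for x E P X R :: complex
      using that by (simp add: field_simps)
    ultimately have "exp (h s) * zeta s = xi s * (exp (ln_Gamma (s / 2)) * (s / 2 * rGamma (s / 2 + 1)))"
      using alg[of "of_real pi powr (s / 2)" "s - 1"] s0 by (simp only:) simp
    then show ?thesis by (simp add: rGamma_plus1 G)
  qed
  define p1 where "p1 = linepath 2 c"
  define p2 where "p2 = linepath c e"
  have pe: "p1 0 = 2" "p1 1 = c" "p2 0 = c" "p2 1 = e" by (simp_all add: p1_def p2_def linepath_def)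
  \<comment> \<open>The jump between the two branches at the corner, a multiple of 2 pi; adding it
    on the second segment makes the lift continuous.\<close>
  define d where "d = Im (g1 c) - Im (g2 c)"
  have cW: "c \<in> W1" "c \<in> W2" "2 \<in> W1" "e \<in> W2" using 1(2) 2(2) by auto
  have cisd: "cis d = 1"
  proof -
    have "exp (g1 c) = exp (g2 c)" using 1(5) 2(5) cW by simp
    then obtain n :: int where "g1 c = g2 c + (of_int (2 * n) * pi) * \<i>" unfolding exp_eq by blast
    then have "d = 2 * pi * of_int n" by (simp add: d_def)
    then show ?thesis by simp
  qed
  define \<phi> where "\<phi> = (\<lambda>x. Im (g1 (p1 x))) +++ (\<lambda>x. Im (g2 (p2 x)) + d)"
  define p where "p = zeta \<circ> (p1 +++ p2)"
  have in1: "p1 x \<in> W1" if "x \<in> {0..1}" for x using 1(2) that by (auto simp: p1_def linepath_in_path)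
  have in2: "p2 x \<in> W2" if "x \<in> {0..1}" for x using 2(2) that by (auto simp: p2_def linepath_in_path)
  have polar: "zeta z = of_real (norm (zeta z)) * cis (Im w)" if "exp w = zeta z" for w z
    by (metis exp_eq_polar norm_exp_eq_Re that)
  have "path \<phi>" unfolding \<phi>_def
  proof (rule path_join_imp)
    show "path (\<lambda>x. Im (g1 (p1 x)))"
      unfolding path_def using in1
      by (intro continuous_intros continuous_on_compose2[OF holomorphic_on_imp_continuous_on[OF 1(4)]]) (auto simp: p1_def)
    show "path (\<lambda>x. Im (g2 (p2 x)) + d)"
      unfolding path_def using in2
      by (intro continuous_intros continuous_on_compose2[OF holomorphic_on_imp_continuous_on[OF 2(4)]]) (auto simp: p2_def)
  qed (simp add: pathfinish_def pathstart_def pe d_def)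
  then have contphi: "continuous_on {0..1} \<phi>" by (simp add: path_def)
  have lift: "p u = of_real (norm (p u)) * cis (\<phi> u)" if u: "u \<in> {0..1}" for u
  proof (cases "u \<le> 1 / 2")
    case True
    then have "2 * u \<in> {0..1}" using u by auto
    then show ?thesis using True polar[of "g1 (p1 (2 * u))" "p1 (2 * u)"] 1(5)[OF in1]
      by (simp add: p_def \<phi>_def joinpaths_def)
  next
    case False
    then have "2 * u - 1 \<in> {0..1}" using u by auto
    then have "zeta (p2 (2 * u - 1)) = of_real (norm (zeta (p2 (2 * u - 1)))) * (cis (Im (g2 (p2 (2 * u - 1)))) * cis d)"
      using polar[of "g2 (p2 (2 * u - 1))" "p2 (2 * u - 1)"] 2(5)[OF in2] cisd by simp
    then show ?thesis using False by (simp add: p_def \<phi>_def joinpaths_def cis_mult)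
  qed
  have arg: "arg_lift p \<phi>" unfolding arg_lift_def using contphi lift by blast
  have p0: "0 \<notin> path_image p"
  proof
    assume "0 \<in> path_image p"
    then obtain x where "x \<in> path_image (p1 +++ p2)" "zeta x = 0" by (auto simp: p_def path_image_compose)
    moreover have "path_image (p1 +++ p2) \<subseteq> closed_segment 2 c \<union> closed_segment c e"
      using path_image_join_subset[of p1 p2] by (simp add: p1_def p2_def)
    ultimately show False using xi_nz1 xi_nz2 nzD seg1D seg2D by blast
  qed
  have ph: "\<phi> 0 = Im (g1 2)" "\<phi> 1 = Im (g2 e) + d" by (simp_all add: \<phi>_def joinpaths_def pe)
  have S: "pi * S_generic T = Im (g2 e) + d - Im (g1 2)"
    using arg_change_eq[OF p0 arg] unfolding S_generic_def ph p_def p1_def p2_def c_def e_def by simp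
  show "zeta (Complex (1/2) T) = of_real (norm (zeta (Complex (1/2) T))) * cis (pi * S_generic T)"
  proof -
    have "zeta 2 = of_real (norm (zeta 2)) * cis (Im (g1 2))" by (rule polar) (rule 1(5)[OF cW(3)])
    moreover have "norm (zeta 2) = Re (zeta 2)"
      by (subst zeta_2_real) (use zeta_2_pos in simp)
    ultimately have "zeta 2 * 1 = zeta 2 * cis (Im (g1 2))" using zeta_2_real by simp
    moreover have "zeta 2 \<noteq> 0" using zeta_2_pos by auto
    ultimately have c1: "cis (Im (g1 2)) = 1" by (metis mult_cancel_left)
    have "cis (pi * S_generic T) = cis (Im (g2 e)) * cis d / cis (Im (g1 2))"
      unfolding S by (simp add: cis_mult cis_divide)
    then have "cis (pi * S_generic T) = cis (Im (g2 e))" by (simp add: c1 cisd)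
    then show ?thesis using polar[of "g2 e" e] 2(5)[OF cW(4)] by (simp add: e_def)
  qed
  have I1: "contour_integral (linepath 2 c) xi_logderiv = (h c + g1 c) - (h 2 + g1 2)"
    unfolding xi_logderiv_def[abs_def]
    by (rule contour_integral_logderiv[OF 1(1,2)])
       (use 1(3,5) exph in \<open>auto simp: exp_add intro!: holomorphic_intros 1(4) holomorphic_on_subset[OF hD]\<close>)
  have I2: "contour_integral (linepath c e) xi_logderiv = (h e + g2 e) - (h c + g2 c)"
    unfolding xi_logderiv_def[abs_def]
    by (rule contour_integral_logderiv[OF 2(1,2)])
       (use 2(3,5) exph in \<open>auto simp: exp_add intro!: holomorphic_intros 2(4) holomorphic_on_subset[OF hD]\<close>)
  have "pi * of_int (zero_count {0<..<T}) = Im (h e) - Im (h 2) + pi * S_generic T"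
    using zero_count_contour[OF T nz] unfolding c_def[symmetric] e_def[symmetric] I1 I2 S by (simp add: d_def)
  moreover have "Im (h 2) = 0"
  proof -
    have "ln_Gamma (1::complex) = of_real (ln_Gamma 1)" using ln_Gamma_complex_of_real[of 1] by simp
    moreover have "Ln (2::complex) = of_real (ln 2)" using Ln_of_real[of 2] by simp
    ultimately show ?thesis by (simp add: h_def)
  qed
  \<comment> \<open>As e - 1 = - cnj e, the arguments of e and e - 1 add up to pi; this is the
    summand 1 in the formula.\<close>
  moreover have "Im (h e) = pi + RS_theta T"
  proof -
    have "e - 1 = - cnj e" by (simp add: e_def complex_eq_iff)
    moreover have "cnj (Ln e) = Ln (cnj e)" using T by (intro cnj_Ln) (simp add: e_def complex_nonpos_Reals_iff)
    moreover have "Ln (- cnj e) = Ln (cnj e) + \<i> * pi" using T by (subst Ln_minus) (auto simp: e_def complex_eq_iff)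
    ultimately have "Ln (e - 1) = cnj (Ln e) + \<i> * pi" by simp
    then have 1: "Im (Ln e) + Im (Ln (e - 1)) = pi" by simp
    have 2: "e / 2 = 1/4 + \<i> * of_real T / 2" by (simp add: e_def complex_eq_iff)
    have 3: "Im (e / 2 * of_real (ln pi)) = T * ln pi / 2" by (simp add: e_def)
    have "Im (h e) = Im (Ln e) + Im (Ln (e - 1)) - Im (e / 2 * of_real (ln pi)) + Im (ln_Gamma (e / 2))"
      by (simp only: h_def plus_complex.sel minus_complex.sel)
    then show ?thesis unfolding 1 3 unfolding 2 RS_theta_def by simp
  qed
  ultimately have "pi * of_int (zero_count {0<..<T}) = pi * (1 + RS_theta T / pi + S_generic T)"
    by (simp add: field_simps)
  then show "of_int (zero_count {0<..<T}) = 1 + RS_theta T / pi + S_generic T" by simp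
qed

section \<open>The Riemann-Siegel theta function and Gram points\<close>

lemma Ln_diff_bound:
  assumes "0 < r" "r \<le> Re a" "r \<le> Re b"
  shows "norm (Ln a - Ln b) \<le> norm (a - b) / r"
proof -
  have "norm (Ln a - Ln b) \<le> (1 / r) * norm (a - b)"
  proof (rule field_differentiable_bound[of "{z. Re z \<ge> r}"])
    fix z assume z: "z \<in> {z. Re z \<ge> r}"
    then have "z \<notin> \<real>\<^sub>\<le>\<^sub>0" using assms by (auto simp: complex_nonpos_Reals_iff)
    then show "(Ln has_field_derivative 1 / z) (at z within {z. Re z \<ge> r})"
      by (auto intro!: derivative_eq_intros simp: inverse_eq_divide)
    have "r \<le> norm z" using z complex_Re_le_cmod[of z] by simp
    then show "norm (1 / z) \<le> 1 / r" using assms by (simp add: norm_divide frac_le)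
  qed (use assms in \<open>auto simp: convex_halfspace_Re_ge\<close>)
  then show ?thesis by simp
qed

text \<open>The asymptotic expansion of the digamma function, truncated so that the error of the
  telescoping step, \<open>digamma_defect\<close>, has the simple derivative
  \<open>- 1 / (6 w\<^sup>3 (w + 1)\<^sup>3)\<close>.\<close>

definition digamma_approx :: "complex \<Rightarrow> complex" where
  "digamma_approx z = Ln z - 1 / (2 * z) - 1 / (12 * z^2)"

definition digamma_defect :: "complex \<Rightarrow> complex" where
  "digamma_defect w = digamma_approx (w + 1) - digamma_approx w - 1 / w"

lemma digamma_approx_deriv:
  assumes "Re z > 0"
  shows "(digamma_approx has_field_derivative 1 / z + 1 / (2 * z^2) + 1 / (6 * z^3)) (at z)"
proof -
  have nz: "z \<noteq> 0" "z \<notin> \<real>\<^sub>\<le>\<^sub>0" using assms by (auto simp: complex_eq_iff complex_nonpos_Reals_iff)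
  have "((\<lambda>z. Ln z - (1/2) * inverse z - (1/12) * (inverse z)^2) has_field_derivative
      (inverse z + (1/2) * (inverse z)^2 + (1/6) * (inverse z)^3)) (at z)"
    using nz by (auto intro!: derivative_eq_intros simp: power2_eq_square power3_eq_cube algebra_simps)
  moreover have "(\<lambda>z. Ln z - (1/2) * inverse z - (1/12) * (inverse z)^2) = digamma_approx"
    by (simp add: digamma_approx_def fun_eq_iff inverse_eq_divide power_one_over)
  moreover have "inverse z + (1/2) * (inverse z)^2 + (1/6) * (inverse z)^3 = 1 / z + 1 / (2 * z^2) + 1 / (6 * z^3)"
    by (simp add: inverse_eq_divide power_one_over)
  ultimately show ?thesis by simp
qed

lemma digamma_defect_deriv:
  assumes "Re w > 0"
  shows "(digamma_defect has_field_derivative - 1 / (6 * w^3 * (w + 1)^3)) (at w)"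
proof -
  have nz: "w \<noteq> 0" "w + 1 \<noteq> 0" using assms by (auto simp: complex_eq_iff)
  have "(digamma_defect has_field_derivative
      (1 / (w + 1) + 1 / (2 * (w + 1)^2) + 1 / (6 * (w + 1)^3)) - (1 / w + 1 / (2 * w^2) + 1 / (6 * w^3)) - - (1 / w^2)) (at w)"
    unfolding digamma_defect_def
  proof (intro DERIV_diff)
    show "((\<lambda>w. digamma_approx (w + 1)) has_field_derivative 1 / (w + 1) + 1 / (2 * (w + 1)^2) + 1 / (6 * (w + 1)^3)) (at w)"
      using digamma_approx_deriv[of "w + 1"] assms by (simp add: DERIV_shift)
    show "((\<lambda>w. 1 / w) has_field_derivative - (1 / w^2)) (at w)"
      using nz by (auto intro!: derivative_eq_intros simp: power2_eq_square)
  qed (rule digamma_approx_deriv[OF assms])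
  then have "(digamma_defect has_field_derivative
      (1 / (w + 1) + 1 / (2 * (w + 1)^2) + 1 / (6 * (w + 1)^3)) - (1 / w + 1 / (2 * w^2) + 1 / (6 * w^3)) + 1 / w^2) (at w)"
    by simp
  moreover have "(1 / (w + 1) + 1 / (2 * (w + 1)^2) + 1 / (6 * (w + 1)^3)) - (1 / w + 1 / (2 * w^2) + 1 / (6 * w^3)) + 1 / w^2
     = - 1 / (6 * w^3 * (w + 1)^3)"
  proof -
    define v where "v = w + 1"
    have v: "v \<noteq> 0" "v = w + 1" using nz by (simp_all add: v_def)
    have "(1 / v + 1 / (2 * v^2) + 1 / (6 * v^3)) - (1 / w + 1 / (2 * w^2) + 1 / (6 * w^3)) + 1 / w^2
      = (6 * v^2 * w^3 + 3 * v * w^3 + w^3 - 6 * w^2 * v^3 - 3 * w * v^3 - v^3 + 6 * w * v^3) / (6 * w^3 * v^3)"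
      using v(1) nz(1) by (simp add: divide_simps) (simp add: eval_nat_numeral algebra_simps)
    also have "6 * v^2 * w^3 + 3 * v * w^3 + w^3 - 6 * w^2 * v^3 - 3 * w * v^3 - v^3 + 6 * w * v^3 = -1"
      unfolding v(2) by (simp add: eval_nat_numeral algebra_simps)
    finally show ?thesis unfolding v_def by simp
  qed
  ultimately show ?thesis by simp
qed

text \<open>Links the term ln m in the limit formula for the digamma function with the far end of
  the telescoping sum.\<close>

lemma digamma_approx_tendsto_ln:
  assumes "Re z > 0"
  shows "(\<lambda>m. of_real (ln (real m)) - digamma_approx (z + of_nat m)) \<longlonglongrightarrow> 0"
proof (rule tendsto_0_le[where K = 1])
  show "(\<lambda>m. (norm z + 1) / real m) \<longlonglongrightarrow> 0" by real_asymp
  show "eventually (\<lambda>m. norm (of_real (ln (real m)) - digamma_approx (z + of_nat m)) \<le> norm ((norm z + 1) / real m) * 1) sequentially"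
    using eventually_gt_at_top[of 0]
  proof eventually_elim
    case (elim m)
    have m1: "real m \<ge> 1" using elim by simp
    have nz: "real m \<le> norm (z + of_nat m)" using assms complex_Re_le_cmod[of "z + of_nat m"] by simp
    have "real m \<le> norm (z + of_nat m) * norm (z + of_nat m)" using nz m1 mult_mono[of "real m" "norm (z + of_nat m)" 1 "norm (z + of_nat m)"] by simp
    then have inv2: "norm (1 / (z + of_nat m)^2) \<le> 1 / real m"
      using m1 by (simp add: norm_divide norm_mult power2_eq_square frac_le)
    have inv: "norm (1 / (z + of_nat m)) \<le> 1 / real m" using nz m1 by (simp add: norm_divide frac_le)
    have "norm (Ln (of_nat m) - Ln (z + of_nat m)) \<le> norm (of_nat m - (z + of_nat m)) / real m"
      by (rule Ln_diff_bound) (use assms m1 in auto)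
    then have l: "norm (Ln (of_nat m) - Ln (z + of_nat m)) \<le> norm z / real m" by simp
    have "of_real (ln (real m)) = Ln (of_nat m :: complex)" using Ln_of_real[of "real m"] elim by simp
    then have "of_real (ln (real m)) - digamma_approx (z + of_nat m) = (Ln (of_nat m) - Ln (z + of_nat m)) + (1/2 * (1 / (z + of_nat m)) + 1/12 * (1 / (z + of_nat m)^2))"
      by (simp add: digamma_approx_def)
    also have "norm \<dots> \<le> norm z / real m + (1/2 * (1 / real m) + 1/12 * (1 / real m))"
      by (intro norm_triangle_mono l; simp only: norm_mult; intro mult_mono inv inv2; simp)
    also have "\<dots> \<le> (norm z + 1) / real m" using m1 by (simp add: field_simps)
    finally show ?case by simp
  qed
qed

lemma digamma_defect_tendsto_0:
  assumes "Re w > 0"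
  shows "(\<lambda>n. digamma_defect (w + of_nat n)) \<longlonglongrightarrow> 0"
proof -
  define e where "e = (\<lambda>z m. of_real (ln (real m)) - digamma_approx (z + of_nat m))"
  have e: "e z \<longlonglongrightarrow> 0" if "Re z > 0" for z
    unfolding e_def by (rule digamma_approx_tendsto_ln[OF that])
  have "filterlim (\<lambda>n. w + of_nat n) at_infinity sequentially"
    by (rule tendsto_add_filterlim_at_infinity[OF tendsto_const tendsto_of_nat])
  then have "(\<lambda>n. e w n - e (w + 1) n - inverse (w + of_nat n)) \<longlonglongrightarrow> 0 - 0 - 0"
    using assms by (intro tendsto_diff e filterlim_compose[OF tendsto_inverse_0]) auto
  moreover have "e w n - e (w + 1) n - inverse (w + of_nat n) = digamma_defect (w + of_nat n)" for n
    by (simp add: e_def digamma_defect_def inverse_eq_divide add_ac)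
  ultimately show ?thesis by simp
qed

text \<open>Integration along the horizontal ray from w, at whose far end the defect tends to 0.
  There |w + s| is at least y and |w + s|^2 at least (u + s + y)^2 / 2, which bounds the derivative
  by 2 / (3 y^2 (u + s + y)^4).\<close>

lemma digamma_defect_bound:
  assumes u: "u > 0" and y: "y > 0"
  shows "norm (digamma_defect (Complex u y)) \<le> 2 / (9 * y^2 * (u + y)^3)"
proof -
  define w where "w = Complex u y"
  define T' where "T' = (\<lambda>s. - 1 / (6 * (w + of_real s)^3 * (w + of_real s + 1)^3))"
  define \<phi> where "\<phi> = (\<lambda>s. - 2 / (9 * y^2 * (u + s + y)^3))"
  have step: "norm (digamma_defect (w + of_nat N) - digamma_defect w) \<le> 2 / (9 * y^2 * (u + y)^3)" if "N > 0" for N :: nat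
  proof -
    have "norm (digamma_defect (w + of_real (real N)) - digamma_defect (w + of_real 0)) \<le> \<phi> (real N) - \<phi> 0"
    proof (rule differentiable_bound_general[where f' = T' and \<phi>' = "\<lambda>s. 2 / (3 * y^2 * (u + s + y)^4)"])
      show "0 < real N" using that by simp
      have vd: "((\<lambda>s. digamma_defect (w + of_real s)) has_vector_derivative T' s) (at s)"
        if "s \<ge> 0" for s
      proof -
        have "(digamma_defect has_field_derivative T' s) (at (w + of_real s))"
          unfolding T'_def by (rule digamma_defect_deriv) (use u that in \<open>simp add: w_def\<close>)
        moreover have "((\<lambda>s. w + of_real s) has_vector_derivative 1) (at s)"
          by (auto intro!: derivative_eq_intros simp: has_vector_derivative_def scaleR_conv_of_real fun_eq_iff)
        ultimately show ?thesis using field_vector_diff_chain_at by (fastforce simp: o_def)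
      qed
      then show "continuous_on {0..real N} (\<lambda>s. digamma_defect (w + of_real s))"
        by (intro continuous_at_imp_continuous_on) (auto intro!: has_vector_derivative_continuous[OF vd])
      show "((\<lambda>s. digamma_defect (w + of_real s)) has_vector_derivative T' s) (at s)"
        if "0 < s" "s < real N" for s using vd that by simp
      have fd: "(\<phi> has_real_derivative 2 / (3 * y^2 * (u + s + y)^4)) (at s)" if "s \<ge> 0" for s
        unfolding \<phi>_def using u y that
        by (auto intro!: derivative_eq_intros simp: divide_simps) (simp add: eval_nat_numeral algebra_simps)?
      then show "continuous_on {0..real N} \<phi>"
        by (intro continuous_at_imp_continuous_on) (auto intro!: DERIV_isCont[OF fd])
      show "(\<phi> has_vector_derivative 2 / (3 * y^2 * (u + s + y)^4)) (at s)" if "0 < s" "s < real N" for s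
        using fd[of s] that by (simp add: has_real_derivative_iff_has_vector_derivative)
      show "norm (T' s) \<le> 2 / (3 * y^2 * (u + s + y)^4)"
        if s: "0 < s" "s < real N" for s
      proof -
        define v where "v = u + s"
        have v: "v > 0" using u s by (simp add: v_def)
        have n1: "norm (w + of_real s) = sqrt (v^2 + y^2)" by (simp add: w_def v_def cmod_def)
        have n2: "norm (w + of_real s) \<le> norm (w + of_real s + 1)"
          using v by (simp add: w_def v_def cmod_def power_mono add_ac)
        have n3: "y \<le> norm (w + of_real s)" unfolding n1 using y by (intro real_le_rsqrt) auto
        have n0: "norm (w + of_real s) > 0" using n3 y by linarith
        have "(v + y)^2 \<le> 2 * (v^2 + y^2)" using zero_le_power2[of "v - y"] by (simp add: power2_eq_square algebra_simps)
        then have "(v + y)^2 / 2 \<le> (norm (w + of_real s))^2" unfolding n1 using v y by simp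
        then have q: "((v + y)^2 / 2)^2 \<le> ((norm (w + of_real s))^2)^2" by (rule power_mono) simp
        have "y^2 * ((v + y)^4 / 4) \<le> (norm (w + of_real s))^2 * (norm (w + of_real s))^4"
          using q n3 y by (intro mult_mono power_mono) (auto simp: power_divide simp flip: power_mult)
        also have "\<dots> = (norm (w + of_real s))^3 * (norm (w + of_real s))^3" by (simp flip: power_add)
        also have "\<dots> \<le> (norm (w + of_real s))^3 * (norm (w + of_real s + 1))^3"
          using n2 by (intro mult_left_mono power_mono) auto
        finally have b: "y^2 * ((v + y)^4 / 4) \<le> (norm (w + of_real s))^3 * (norm (w + of_real s + 1))^3" .
        have "norm (T' s) = 1 / (6 * ((norm (w + of_real s))^3 * (norm (w + of_real s + 1))^3))"
          by (simp add: T'_def norm_divide norm_mult norm_power mult.assoc)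
        also have "\<dots> \<le> 1 / (6 * (y^2 * ((v + y)^4 / 4)))"
          using b y v by (intro frac_le mult_left_mono) auto
        also have "\<dots> = 2 / (3 * y^2 * (u + s + y)^4)" by (simp add: v_def)
        finally show ?thesis .
      qed
    qed
    also have "\<phi> (real N) \<le> 0" using u y by (simp add: \<phi>_def)
    finally show ?thesis by (simp add: \<phi>_def)
  qed
  have "(\<lambda>N. norm (digamma_defect (w + of_nat N) - digamma_defect w)) \<longlonglongrightarrow> norm (0 - digamma_defect w)"
    using u by (intro tendsto_norm tendsto_diff tendsto_const digamma_defect_tendsto_0) (simp add: w_def)
  then have "norm (0 - digamma_defect w) \<le> 2 / (9 * y^2 * (u + y)^3)"
    by (rule LIMSEQ_le_const2) (use step in \<open>auto intro!: exI[of _ 1]\<close>)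
  then show ?thesis by (simp add: w_def)
qed

text \<open>Compares 1 / v^3 with 1 / ((v-1) v (v+1)), which telescopes.\<close>

lemma sum_inverse_cubes_le:
  fixes x :: real
  assumes "x > 1"
  shows "(\<Sum>k<n. 1 / (x + real k)^3) \<le> 1 / (2 * (x - 1) * x)"
proof -
  have "(\<Sum>k<n. 1 / (x + real k)^3) \<le> 1 / (2 * (x - 1) * x) - 1 / (2 * (x + real n - 1) * (x + real n))"
  proof (induction n)
    case (Suc n)
    define v where "v = x + real n"
    have v: "v > 1" using assms by (simp add: v_def)
    have "v * ((v - 1) * (v + 1)) \<le> v * (v * v)" using v by (intro mult_left_mono) (auto simp: algebra_simps)
    then have "1 / v^3 \<le> 1 / (v * ((v - 1) * (v + 1)))"
      using v by (intro divide_left_mono) (auto simp: eval_nat_numeral intro!: mult_pos_pos)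
    also have "\<dots> = 1 / (2 * (v - 1) * v) - 1 / (2 * v * (v + 1))"
      using v by (simp add: divide_simps)
    finally show ?case using Suc by (simp add: v_def add_ac)
  qed simp
  also have "\<dots> \<le> 1 / (2 * (x - 1) * x)" using assms by simp
  finally show ?thesis .
qed

text \<open>The defects at z, z + 1, ... telescope, and comparison with the limit formula for the
  digamma function leaves exactly their infinite sum as the error.\<close>

lemma digamma_approx_error:
  assumes u: "u > 0" and y: "u + y > 1" "y > 0"
  shows "norm (Digamma (Complex u y) - digamma_approx (Complex u y)) \<le> 1 / (9 * y^2 * (u + y - 1) * (u + y))"
proof -
  define z where "z = Complex u y"
  have z0: "z \<noteq> 0" "Re z > 0" using u by (auto simp: z_def complex_eq_iff)
  have tel: "digamma_approx (z + of_nat m) - digamma_approx z = (\<Sum>k<m. digamma_defect (z + of_nat k) + inverse (z + of_nat k))" for m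
  proof (induction m)
    case (Suc m)
    have e: "digamma_defect (z + of_nat m) + inverse (z + of_nat m) = digamma_approx (z + of_nat (Suc m)) - digamma_approx (z + of_nat m)"
      by (simp add: digamma_defect_def inverse_eq_divide add_ac)
    show ?case unfolding sum.lessThan_Suc Suc.IH[symmetric] e by simp
  qed simp
  have D: "(\<lambda>m. of_real (ln (real m)) - (\<Sum>k<m. inverse (z + of_nat k))) \<longlonglongrightarrow> Digamma z"
    by (rule Digamma_LIMSEQ[OF z0(1)])
  have A: "(\<lambda>m. of_real (ln (real m)) - digamma_approx (z + of_nat m)) \<longlonglongrightarrow> 0"
    by (rule digamma_approx_tendsto_ln[OF z0(2)])
  have "(\<lambda>m. (of_real (ln (real m)) - (\<Sum>k<m. inverse (z + of_nat k))) - digamma_approx z - (of_real (ln (real m)) - digamma_approx (z + of_nat m)))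
      \<longlonglongrightarrow> Digamma z - digamma_approx z - 0"
    by (intro tendsto_diff D A tendsto_const)
  moreover have "(of_real (ln (real m)) - (\<Sum>k<m. inverse (z + of_nat k))) - digamma_approx z - (of_real (ln (real m)) - digamma_approx (z + of_nat m))
      = (\<Sum>k<m. digamma_defect (z + of_nat k))" for m
    using tel[of m] by (simp add: sum.distrib algebra_simps)
  ultimately have lim: "(\<lambda>m. \<Sum>k<m. digamma_defect (z + of_nat k)) \<longlonglongrightarrow> Digamma z - digamma_approx z" by simp
  have "norm (\<Sum>k<m. digamma_defect (z + of_nat k)) \<le> 1 / (9 * y^2 * (u + y - 1) * (u + y))" for m
  proof -
    have "norm (\<Sum>k<m. digamma_defect (z + of_nat k)) \<le> (\<Sum>k<m. 2 / (9 * y^2) * (1 / (u + y + real k)^3))"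
    proof (rule sum_norm_le)
      fix k
      have "z + of_nat k = Complex (u + real k) y" by (simp add: z_def complex_eq_iff)
      then show "norm (digamma_defect (z + of_nat k)) \<le> 2 / (9 * y^2) * (1 / (u + y + real k)^3)"
        using digamma_defect_bound[of "u + real k" y] u y by (simp add: add_ac)
    qed
    also have "\<dots> = 2 / (9 * y^2) * (\<Sum>k<m. 1 / (u + y + real k)^3)" by (simp only: sum_distrib_left)
    also have "\<dots> \<le> 2 / (9 * y^2) * (1 / (2 * (u + y - 1) * (u + y)))"
      by (intro mult_left_mono sum_inverse_cubes_le) (use y in auto)
    also have "2 / (9 * Y) * (1 / (2 * P * Q)) = 1 / (9 * Y * P * Q)" for Y P Q :: real by simp
    finally show ?thesis .
  qed
  then show ?thesis using Lim_bounded[OF tendsto_norm[OF lim], of 0] unfolding z_def by blast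
qed

section \<open>Bounds for the derivative of \<theta> on [7, \<infinity>)\<close>

definition RS_theta_deriv :: "real \<Rightarrow> real" where
  "RS_theta_deriv t = (Re (Digamma (Complex (1/4) (t/2))) - ln pi) / 2"

lemma RS_theta_has_derivative: "(RS_theta has_real_derivative RS_theta_deriv t) (at t within A)"
proof -
  have e: "1/4 + \<i> * of_real t / 2 = Complex (1/4) (t/2)" for t by (simp add: complex_eq_iff)
  have "(ln_Gamma has_field_derivative Digamma (Complex (1/4) (t/2))) (at (1/4 + \<i> * of_real t / 2))"
    unfolding e by (rule has_field_derivative_ln_Gamma_complex) (simp add: complex_nonpos_Reals_iff)
  moreover have "((\<lambda>t. 1/4 + \<i> * of_real t / 2) has_vector_derivative \<i> / 2) (at t)"
    by (auto intro!: derivative_eq_intros simp: has_vector_derivative_def scaleR_conv_of_real)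
  ultimately have "((\<lambda>t. ln_Gamma (1/4 + \<i> * of_real t / 2)) has_vector_derivative \<i> / 2 * Digamma (Complex (1/4) (t/2))) (at t)"
    using field_vector_diff_chain_at by (fastforce simp: o_def)
  from bounded_linear.has_vector_derivative[OF bounded_linear_Im this]
  have "((\<lambda>t. Im (ln_Gamma (1/4 + \<i> * of_real t / 2))) has_real_derivative Re (Digamma (Complex (1/4) (t/2))) / 2) (at t)"
    by (simp add: has_real_derivative_iff_has_vector_derivative)
  moreover have "((\<lambda>t. t * ln pi / 2) has_real_derivative ln pi / 2) (at t)"
    by (auto intro!: derivative_eq_intros)
  ultimately have "((\<lambda>t. Im (ln_Gamma (1/4 + \<i> * of_real t / 2)) - t * ln pi / 2) has_real_derivative Re (Digamma (Complex (1/4) (t/2))) / 2 - ln pi / 2) (at t)"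
    by (rule DERIV_diff)
  then show ?thesis
    unfolding RS_theta_def[abs_def] RS_theta_deriv_def diff_divide_distrib by (rule has_field_derivative_at_within)
qed

lemma continuous_on_RS_theta [continuous_intros]: "continuous_on A RS_theta"
  by (rule DERIV_continuous_on[OF RS_theta_has_derivative])

lemma pi_bounds: "157/50 \<le> pi" "pi \<le> 63/20"
  using pi_approx by (auto simp: abs_le_iff)

text \<open>With z = 1/4 + i y, y = t/2 and q = |z|^2, the approximation has real part ln q / 2 -
  1/(8q) + (y^2 - 1/16)/(12 q^2). For the upper bound the last term is absorbed by the one before
  it, for the lower bound it is dropped.\<close>

lemma RS_theta_deriv_bounds:
  assumes t: "t \<ge> 7"
  shows "2 * RS_theta_deriv t \<le> ln (t / (2 * pi)) + 0.2 / t^2" and "2 * RS_theta_deriv t \<ge> 1 / 20"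
proof -
  define y where "y = t / 2"
  have y: "y \<ge> 7/2" using t by (simp add: y_def)
  have y2: "y^2 \<ge> 49/4" using power_mono[OF y, of 2] by (simp add: power2_eq_square)
  define q where "q = 1/16 + y^2"
  have q: "q > 0" "q \<ge> y^2" using y2 by (auto simp: q_def)
  define z where "z = Complex (1/4) y"
  have nz: "(Re z)^2 + (Im z)^2 = q" by (simp add: z_def q_def power2_eq_square)
  have z0: "z \<noteq> 0" by (simp add: z_def complex_eq_iff)
  have "1 / (2 * z) = of_real (1/2) * (1 / z)" by simp
  then have "Re (1 / (2 * z)) = Re (1 / z) / 2" by (simp only: times_complex.sel Re_complex_of_real Im_complex_of_real)
  also have "Re (1 / z) = 1 / (4 * q)" unfolding Re_divide nz by (simp add: z_def)
  finally have r1: "Re (1 / (2 * z)) = 1 / (8 * q)" by simp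
  have "(Re (z^2))^2 + (Im (z^2))^2 = (norm (z^2))^2" by (rule cmod_power2[symmetric])
  also have "\<dots> = ((norm z)^2)^2" by (simp add: norm_power)
  also have "\<dots> = q^2" unfolding cmod_power2 nz ..
  finally have nz2: "(Re (z^2))^2 + (Im (z^2))^2 = q^2" .
  have "1 / (12 * z^2) = of_real (1/12) * (1 / z^2)" by simp
  then have "Re (1 / (12 * z^2)) = Re (1 / z^2) / 12" by (simp only: times_complex.sel Re_complex_of_real Im_complex_of_real)
  also have "Re (1 / z^2) = (1/16 - y^2) / q^2" unfolding Re_divide nz2 by (simp add: z_def Re_power2 power2_eq_square)
  finally have r2: "Re (1 / (12 * z^2)) = - ((y^2 - 1/16) / (12 * q^2))" by (simp add: minus_divide_left mult.commute)
  have "norm z = sqrt q" unfolding cmod_def nz ..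
  then have "Re (Ln z) = ln q / 2" using z0 q by (simp add: ln_sqrt)
  then have R: "Re (digamma_approx z) = ln q / 2 - 1 / (8 * q) + (y^2 - 1/16) / (12 * q^2)"
    unfolding digamma_approx_def by (simp only: minus_complex.sel r1 r2)
  \<comment> \<open>At y = 7/2 the factor 9 (y - 3/4) (y + 1/4) is about 92.8, hence at least 80
    from there on, and 1/80 = 0.0125.\<close>
  have err: "\<bar>Re (Digamma z) - Re (digamma_approx z)\<bar> \<le> 0.0125 / y^2"
  proof -
    have "\<bar>Re (Digamma z - digamma_approx z)\<bar> \<le> norm (Digamma z - digamma_approx z)" by (rule abs_Re_le_cmod)
    also have "\<dots> \<le> 1 / (9 * y^2 * (1/4 + y - 1) * (1/4 + y))" unfolding z_def by (rule digamma_approx_error) (use y in auto)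
    also have "\<dots> \<le> 1 / (80 * y^2)"
    proof (rule divide_left_mono)
      have "(1/4 + y - 1) * (1/4 + y) \<ge> (11/4) * (15/4)" using y by (intro mult_mono) auto
      then have "9 * ((1/4 + y - 1) * (1/4 + y)) \<ge> 80" by simp
      from mult_left_mono[OF this, of "y^2"] show "80 * y^2 \<le> 9 * y^2 * (1/4 + y - 1) * (1/4 + y)" by (simp add: mult_ac)
      show "0 < 9 * y\<^sup>2 * (1 / 4 + y - 1) * (1 / 4 + y) * (80 * y\<^sup>2)" using y by (intro mult_pos_pos) auto
    qed simp
    finally show ?thesis by simp
  qed
  have lnq: "ln q = 2 * ln y + ln (1 + 1 / (16 * y^2))"
  proof -
    have "q = y^2 * (1 + 1 / (16 * y^2))" using y by (simp add: q_def distrib_left)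
    moreover have "1 + 1 / (16 * y^2) > 0" by (simp add: add_pos_nonneg)
    then have "1 + 1 / (16 * y^2) \<noteq> 0" by linarith
    ultimately have "ln q = ln (y^2) + ln (1 + 1 / (16 * y^2))" using y by (simp add: ln_mult)
    then show ?thesis using y by (simp add: ln_realpow)
  qed
  have split: "2 * RS_theta_deriv t = Re (Digamma z) - ln pi" by (simp add: RS_theta_deriv_def z_def y_def)
  have lnt: "ln (t / (2 * pi)) = ln y - ln pi" using y by (simp add: y_def ln_div ln_mult)
  show "2 * RS_theta_deriv t \<le> ln (t / (2 * pi)) + 0.2 / t^2"
  proof -
    have "ln (1 + 1 / (16 * y^2)) \<le> 1 / (16 * y^2)" by (rule ln_add_one_self_le_self) simp
    moreover have "(y^2 - 1/16) / (12 * q^2) \<le> 1 / (8 * q)"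
    proof -
      have "(y^2 - 1/16) / (12 * q^2) \<le> q / (12 * q^2)" by (intro divide_right_mono) (auto simp: q_def)
      also have "\<dots> = 1 / (12 * q)" using q by (simp add: power2_eq_square)
      also have "\<dots> \<le> 1 / (8 * q)" using q by (intro divide_left_mono) auto
      finally show ?thesis .
    qed
    moreover have "1 / (32 * y^2) = 1 / (16 * y^2) / 2" by simp
    moreover have "(2 * L + A) / 2 - D + C \<le> L + E" if "A \<le> B" "C \<le> D" "E = B / 2" for A B C D E L :: real
      using that by (simp add: add_divide_distrib)
    ultimately have "Re (digamma_approx z) \<le> ln y + 1 / (32 * y^2)" unfolding R lnq by blast
    then have "Re (Digamma z) \<le> ln y + 1 / (32 * y^2) + 0.0125 / y^2" using err by linarith
    \<comment> \<open>Here 1/32 + 1/80 = 7/160 < 1/20.\<close>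
    also have "\<dots> \<le> ln y + 0.05 / y^2" using y by (simp add: field_simps)
    also have "0.05 / y^2 = 0.2 / t^2" by (simp add: y_def power_divide)
    finally show ?thesis unfolding split lnt by simp
  qed
  show "2 * RS_theta_deriv t \<ge> 1 / 20"
  proof -
    have "ln (1 + 1 / (16 * y^2)) \<ge> 0" by simp
    moreover have "(y^2 - 1/16) / (12 * q^2) \<ge> 0" using y2 by simp
    moreover have "1 / (8 * q) \<le> 1 / 98" using q y2 by (intro divide_left_mono) auto
    moreover have "L - E \<le> (2 * L + A) / 2 - D + C" if "0 \<le> A" "0 \<le> C" "D \<le> E" for A C D E L :: real
      using that by (simp add: add_divide_distrib)
    ultimately have "Re (digamma_approx z) \<ge> ln y - 1 / 98" unfolding R lnq by blast
    moreover have "0.0125 / y^2 \<le> 0.0125 / (49/4)" using y2 by (intro divide_left_mono) auto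
    ultimately have "Re (Digamma z) \<ge> ln y - 1 / 98 - 0.0125 / (49/4)" using err by linarith
    moreover have "ln y - ln pi \<ge> 1 / 10"
    proof -
      have "ln (pi / y) \<le> pi / y - 1" using y by (intro ln_le_minus_one) auto
      moreover have "pi / y \<le> (63/20) / (7/2)" using pi_bounds y by (intro frac_le) auto
      moreover have "ln (pi / y) = ln pi - ln y" using y by (simp add: ln_div)
      moreover have "B - A \<ge> 1 / 10" if "X \<le> P - 1" "P \<le> (63/20) / (7/2)" "X = A - B" for X P A B :: real
        using that by simp
      ultimately show ?thesis by blast
    qed
    ultimately show ?thesis unfolding split by simp
  qed
qed

section \<open>The value of \<theta> at 7\<close>

text \<open>\<open>G\<close> is a primitive of arctan(y / v), which is convex for v > 0, so the
  trapezoidal rule overestimates the integral.\<close>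

lemma arctan_trapezoid:
  fixes u y :: real
  assumes u: "u > 0" and y: "y > 0"
  defines "G \<equiv> \<lambda>u. u * arctan (y / u) + y / 2 * ln (u^2 + y^2)"
  shows "G (u + 1) - G u \<le> (arctan (y / u) + arctan (y / (u + 1))) / 2"
proof -
  define f where "f = (\<lambda>v. arctan (y / v))"
  define f' where "f' = (\<lambda>v. - y / (v^2 + y^2))"
  have fd: "(f has_real_derivative f' v) (at v)" if "v > 0" for v
  proof -
    have "(f has_real_derivative - y / (v * v) / (1 + (y / v)^2)) (at v)"
      unfolding f_def using that by (auto intro!: derivative_eq_intros simp: divide_inverse mult_ac)
    also have "- y / (v * v) / (1 + (y / v)^2) = f' v"
      using that y by (simp add: f'_def power2_eq_square divide_simps add_pos_pos)
    finally show ?thesis .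
  qed
  have Gd: "(G has_real_derivative f v) (at v)" if "v > 0" for v
  proof -
    have pos: "v^2 + y^2 > 0" using y by (simp add: add_nonneg_pos)
    have sq: "((\<lambda>u. u^2 + y^2) has_real_derivative 2 * v) (at v)" by (auto intro!: derivative_eq_intros)
    have "((\<lambda>u. u * f u + y / 2 * ln (u^2 + y^2)) has_real_derivative (1 * f v + f' v * v) + y / 2 * (1 / (v^2 + y^2) * (2 * v))) (at v)"
      by (intro DERIV_add DERIV_mult DERIV_ident fd[OF that] DERIV_cmult DERIV_chain2[OF DERIV_ln_divide[OF pos] sq])
    then have "(G has_real_derivative (1 * f v + f' v * v) + y / 2 * (1 / (v^2 + y^2) * (2 * v))) (at v)"
      by (simp only: G_def f_def)
    then show ?thesis by (simp add: f'_def)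
  qed
  define E where "E = (\<lambda>h. h * (f u + f (u + h)) / 2 - G (u + h) + G u)"
  have "E 0 \<le> E 1"
  proof (rule DERIV_nonneg_imp_nondecreasing[where f = E and a = 0 and b = 1])
    fix h :: real assume h: "0 \<le> h" "h \<le> 1"
    have uh: "u + h > 0" using u h by simp
    have fh: "((\<lambda>h. f (u + h)) has_real_derivative f' (u + h)) (at h)"
      using DERIV_shift[of f "f' (u + h)" h u] fd[OF uh] by (simp add: add.commute)
    have Gh: "((\<lambda>h. G (u + h)) has_real_derivative f (u + h)) (at h)"
      using DERIV_shift[of G "f (u + h)" h u] Gd[OF uh] by (simp add: add.commute)
    have "(E has_real_derivative (1 * (f u + f (u + h)) + f' (u + h) * h) / 2 - f (u + h)) (at h)"
      unfolding E_def by (auto intro!: derivative_eq_intros fh Gh)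
    moreover have "(1 * (f u + f (u + h)) + f' (u + h) * h) / 2 - f (u + h) \<ge> 0"
    proof (cases "h = 0")
      case False
      then obtain \<xi> where \<xi>: "u < \<xi>" "\<xi> < u + h" "f (u + h) - f u = (u + h - u) * f' \<xi>"
        using MVT2[of u "u + h" f f'] fd u h by (metis add_less_same_cancel1 less_add_same_cancel1 less_le less_le_trans)
      have "f' \<xi> \<le> f' (u + h)"
      proof -
        have "\<xi>^2 \<le> (u + h)^2" using \<xi> u by (intro power_mono) auto
        then have "y / ((u + h)^2 + y^2) \<le> y / (\<xi>^2 + y^2)" using y by (intro divide_left_mono mult_pos_pos) (auto simp: add_nonneg_pos)
        then show ?thesis by (simp add: f'_def)
      qed
      then have "f (u + h) - f u \<le> h * f' (u + h)" using \<xi>(3) h by (simp add: mult_left_mono)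
      then show ?thesis by (simp add: field_simps)
    qed simp
    ultimately show "\<exists>z. (E has_real_derivative z) (at h) \<and> 0 \<le> z" by blast
  qed simp
  then have "0 \<le> (f u + f (u + 1)) / 2 - G (u + 1) + G u" by (simp add: E_def)
  then show ?thesis unfolding f_def by linarith
qed

text \<open>Guarantees that the Gram point of index -1 exists in [7, \<infinity>). The argument of
  \<Gamma>(1/4 + 7i/2) is the limit of y ln n minus a sum of arctangents, which
  \<open>arctan_trapezoid\<close> compares with an integral.\<close>

lemma RS_theta_7: "RS_theta 7 \<le> - pi"
proof -
  define y :: real where "y = 7/2"
  define z where "z = 1/4 + \<i> * of_real 7 / 2"
  have z: "Re z = 1/4" "Im z = y" by (simp_all add: z_def y_def)
  define f where "f = (\<lambda>k. arctan (y / (1/4 + real k)))"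
  define G where "G = (\<lambda>u. u * arctan (y / u) + y / 2 * ln (u^2 + y^2))"
  have "(\<lambda>n. Im (ln_Gamma_series z n)) \<longlonglongrightarrow> Im (ln_Gamma z)"
    by (intro tendsto_Im ln_Gamma_complex_LIMSEQ) (auto simp: z elim!: nonpos_Ints_cases dest!: arg_cong[where f = Im] simp: y_def)
  moreover have "Im (ln_Gamma_series z n) \<le> y * ln (real n) - G (1/4 + real n) + G (1/4) - f 0 / 2" if n: "n > 0" for n
  proof -
    have argf: "Im (Ln (z / of_nat k + 1)) = f k" if "k > 0" for k
    proof -
      have r: "Re (z / of_nat k + 1) = (1/4 + real k) / real k" using that by (simp add: z Re_divide_of_nat field_simps)
      have i: "Im (z / of_nat k + 1) = y / real k" by (simp add: z Im_divide_of_nat)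
      have p: "Re (z / of_nat k + 1) > 0" unfolding r using that by simp
      then have "z / of_nat k + 1 \<noteq> 0" by (metis less_irrefl zero_complex.sel(1))
      then have "Im (Ln (z / of_nat k + 1)) = arctan (Im (z / of_nat k + 1) / Re (z / of_nat k + 1))"
        by (subst Im_Ln_eq) (use p in simp_all)
      then show ?thesis unfolding r i f_def using that by simp
    qed
    have "z \<noteq> 0" using z by auto
    then have arg0: "Im (Ln z) = f 0" by (subst Im_Ln_eq) (simp_all add: z f_def)
    have "Im (ln_Gamma_series z n) = y * ln (real n) - f 0 - (\<Sum>k=1..n. f k)"
    proof -
      have "Im (z * ln (of_nat n)) = y * ln (real n)" using n Ln_of_real[of "real n"] by (simp add: z)
      moreover have "(\<Sum>k=1..n. Im (Ln (z / of_nat k + 1))) = (\<Sum>k=1..n. f k)" using argf by (intro sum.cong) auto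
      ultimately show ?thesis unfolding ln_Gamma_series_def by (simp add: arg0)
    qed
    moreover have "(\<Sum>k=1..n. f k) = (\<Sum>k<n. f (Suc k))" by (rule sum.reindex_bij_witness[of _ Suc "\<lambda>k. k - 1"]) auto
    moreover have "G (1/4 + real n) - G (1/4) \<le> (\<Sum>k<n. f (Suc k)) + (f 0 - f n) / 2"
    proof (induction n)
      case (Suc n)
      have "G (1/4 + real n + 1) - G (1/4 + real n) \<le> (f n + f (Suc n)) / 2"
        using arctan_trapezoid[of "1/4 + real n" y] by (simp add: G_def f_def y_def add_ac)
      then show ?case using Suc by (simp add: add_ac) (simp add: field_simps)?
    qed simp
    moreover have "f n \<ge> 0" by (simp add: f_def y_def)
    ultimately show ?thesis by (simp add: field_simps)
  qed
  \<comment> \<open>In \<open>G\<close> the arctangent term tends to y, and the logarithm cancels y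
    ln n.\<close>
  moreover have "(\<lambda>n. y * ln (real n) - G (1/4 + real n) + G (1/4) - f 0 / 2) \<longlonglongrightarrow> - y + G (1/4) - f 0 / 2"
  proof -
    have "(\<lambda>n. y * ln (real n) - G (1/4 + real n)) \<longlonglongrightarrow> - y"
      unfolding G_def y_def by real_asymp
    then show ?thesis by (intro tendsto_intros)
  qed
  ultimately have "Im (ln_Gamma z) \<le> - y + G (1/4) - f 0 / 2"
    by (intro LIMSEQ_le[where X = "\<lambda>n. Im (ln_Gamma_series z n)"]) (auto intro!: exI[of _ 1])
  then have "RS_theta 7 \<le> - y + G (1/4) - f 0 / 2 - 7 * ln pi / 2" by (simp add: RS_theta_def z_def)
  also have "G (1/4) = f 0 / 4 + 7/4 * ln (197/16)" by (simp add: G_def f_def y_def power2_eq_square)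
  finally have 1: "RS_theta 7 \<le> 7/4 * (ln (197/16) - 2 * ln pi) - 7/2 - f 0 / 4" by (simp add: y_def algebra_simps diff_divide_distrib)
  \<comment> \<open>The value is arctan 14, but arctan 1 suffices: 7/16 - 7/2 - pi/16 < -
    pi.\<close>
  have "f 0 \<ge> arctan 1" unfolding f_def y_def by (intro arctan_monotone') auto
  then have 2: "f 0 \<ge> pi / 4" by (simp add: arctan_one)
  have "ln (197/16) - 2 * ln pi = ln (197/16 / pi^2)" by (simp add: ln_div ln_mult ln_realpow)
  also have "\<dots> \<le> 197/16 / pi^2 - 1" by (intro ln_le_minus_one) simp
  also have "197/16 / pi^2 \<le> 197/16 / (157/50)^2"
    using pi_bounds by (intro divide_left_mono power_mono) auto
  finally have 3: "ln (197/16) - 2 * ln pi \<le> 1/4" by (simp add: power2_eq_square)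
  define X where "X = ln (197/16) - 2 * ln pi"
  have "RS_theta 7 \<le> 7/4 * X - 7/2 - f 0 / 4" "X \<le> 1/4" using 1 3 by (simp_all only: X_def)
  then show ?thesis using 2 pi_bounds by linarith
qed

section \<open>Existence and order of the Gram points\<close>

lemma RS_theta_strict_mono:
  assumes "7 \<le> s" "s < t"
  shows "RS_theta s < RS_theta t"
proof (rule DERIV_pos_imp_increasing[OF assms(2)])
  fix x assume "s \<le> x"
  then show "\<exists>y. (RS_theta has_real_derivative y) (at x) \<and> 0 < y"
    using RS_theta_deriv_bounds(2)[of x] assms by (intro exI[of _ "RS_theta_deriv x"] conjI RS_theta_has_derivative) auto
qed

lemma gram_exists_unique:
  assumes "n \<ge> -1"
  shows "\<exists>!t. t \<ge> 7 \<and> RS_theta t = pi * of_int n"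
proof -
  \<comment> \<open>Beyond 7 the slope of \<theta> is at least 1/40, so \<theta> has reached pi n at
    b.\<close>
  define b where "b = 7 + 40 * (pi * of_int n - RS_theta 7)"
  have n7: "RS_theta 7 \<le> pi * of_int n"
  proof -
    have "pi * (-1) \<le> pi * of_int n" using assms by (intro mult_left_mono) auto
    then show ?thesis using RS_theta_7 by simp
  qed
  have b: "b \<ge> 7" using n7 by (simp add: b_def)
  have "RS_theta 7 - 7 / 40 \<le> RS_theta b - b / 40"
  proof (rule DERIV_nonneg_imp_nondecreasing[OF b])
    fix x :: real assume "7 \<le> x"
    then show "\<exists>y. ((\<lambda>x. RS_theta x - x / 40) has_real_derivative y) (at x) \<and> 0 \<le> y"
      using RS_theta_deriv_bounds(2)[of x]
      by (intro exI[of _ "RS_theta_deriv x - 1 / 40"] conjI) (auto intro!: derivative_eq_intros RS_theta_has_derivative)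
  qed
  then have "pi * of_int n \<le> RS_theta b" by (simp add: b_def field_simps)
  then obtain t where "7 \<le> t" "RS_theta t = pi * of_int n"
    using IVT'[of RS_theta 7 "pi * of_int n" b] n7 b continuous_on_RS_theta by auto
  moreover have "s = t" if "7 \<le> s" "7 \<le> t" "RS_theta s = RS_theta t" for s t
    using RS_theta_strict_mono[of s t] RS_theta_strict_mono[of t s] that by (cases s t rule: linorder_cases) auto
  ultimately show ?thesis by metis
qed

lemma gram_props:
  assumes "n \<ge> -1"
  shows "gram n \<ge> 7" "RS_theta (gram n) = pi * of_int n"
  using theI'[OF gram_exists_unique[OF assms]] unfolding gram_def by auto

lemma gram_less:
  assumes "-1 \<le> m" "m < n"
  shows "gram m < gram n"
proof (rule ccontr)
  assume "\<not> gram m < gram n"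
  then have "RS_theta (gram n) \<le> RS_theta (gram m)"
    using RS_theta_strict_mono[of "gram n" "gram m"] gram_props[of n] assms by (cases "gram n = gram m") auto
  then show False using gram_props[of m] gram_props[of n] assms by simp
qed

section \<open>Gram blocks\<close>

lemma finite_zeros_ordinate_in:
  assumes "A \<subseteq> {- t..t}"
  shows "finite {s. xi s = 0 \<and> Im s \<in> A}"
proof (rule finite_subset[OF _ finite_xi_zeros_below[of t]])
  have "\<bar>x\<bar> \<le> t" if "x \<in> A" for x
    using subsetD[OF assms that] by (simp add: abs_le_iff)
  then show "{s. xi s = 0 \<and> Im s \<in> A} \<subseteq> {s. xi s = 0 \<and> \<bar>Im s\<bar> \<le> t}" by blast
qed

text \<open>The parameter t bounds the ordinates and thereby makes the index set finite; a sum over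
  an infinite set would be 0.\<close>

lemma zero_count_mono:
  assumes "A \<subseteq> B" "B \<subseteq> {- t..t}"
  shows "zero_count A \<le> zero_count B"
  unfolding zero_count_def
proof (rule sum_mono2[OF finite_zeros_ordinate_in[OF assms(2)]])
  show "0 \<le> zorder zeta s" if "s \<in> {s. xi s = 0 \<and> Im s \<in> B} - {s. xi s = 0 \<and> Im s \<in> A}" for s
    using zorder_zeta_pos[of s] that by simp
qed (use assms in auto)

lemma zero_count_Un:
  assumes "A \<inter> B = {}" "A \<union> B \<subseteq> {- t..t}"
  shows "zero_count (A \<union> B) = zero_count A + zero_count B"
proof -
  have "{s. xi s = 0 \<and> Im s \<in> A \<union> B} = {s. xi s = 0 \<and> Im s \<in> A} \<union> {s. xi s = 0 \<and> Im s \<in> B}" by auto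
  then show ?thesis
    unfolding zero_count_def using assms
    by (simp add: sum.union_disjoint[OF finite_zeros_ordinate_in[of A t] finite_zeros_ordinate_in[of B t]] disjoint_iff)
qed

lemma zero_count_eq_0I: "(\<And>s. xi s = 0 \<Longrightarrow> Im s \<notin> A) \<Longrightarrow> zero_count A = 0"
  unfolding zero_count_def by (intro sum.neutral) auto

lemma zero_count_pos:
  assumes "xi s = 0" "Im s \<in> A" "A \<subseteq> {- t..t}"
  shows "zero_count A \<ge> 1"
proof -
  have "(\<Sum>s\<in>{s}. zorder zeta s) \<le> zero_count A"
    unfolding zero_count_def
    by (rule sum_mono2[OF finite_zeros_ordinate_in[OF assms(3)]]) (use assms zorder_zeta_pos in force)+
  then show ?thesis using zorder_zeta_pos[OF assms(1)] by simp
qed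

lemma N_zeros_eq:
  assumes "t > 0"
  shows "N_zeros t = (of_int (zero_count {0<..<t}) + of_int (zero_count {0<..t})) / 2"
proof -
  have iff: "0 < Re s \<and> Re s < 1 \<and> zeta s = 0 \<longleftrightarrow> xi s = 0" if "Im s > 0" for s
    using that xi_zero_in_strip[of s] xi_zero_iff_zeta_zero[of s] by auto
  have "{s. 0 < Re s \<and> Re s < 1 \<and> 0 < Im s \<and> Im s < t \<and> zeta s = 0} = {s. xi s = 0 \<and> Im s \<in> {0<..<t}}"
    "{s. 0 < Re s \<and> Re s < 1 \<and> 0 < Im s \<and> Im s \<le> t \<and> zeta s = 0} = {s. xi s = 0 \<and> Im s \<in> {0<..t}}"
    using iff by auto
  then show ?thesis unfolding N_zeros_def zero_count_def by (simp add: add_divide_distrib)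
qed

lemma zeta_ordinate_iff: "t > 0 \<Longrightarrow> zeta_ordinate t \<longleftrightarrow> (\<exists>s. xi s = 0 \<and> Im s = t)"
  unfolding zeta_ordinate_def using xi_zero_iff_zeta_zero by (metis less_irrefl)

lemma zero_count_closed_eq_open:
  assumes "t > 0" "\<not> zeta_ordinate t"
  shows "zero_count {0<..t} = zero_count {0<..<t}"
proof -
  have "{s. xi s = 0 \<and> Im s \<in> {0<..t}} = {s. xi s = 0 \<and> Im s \<in> {0<..<t}}"
    using assms zeta_ordinate_iff[OF assms(1)] by (auto simp: less_le)
  then show ?thesis by (simp add: zero_count_def)
qed

section \<open>S as a counting function minus \<theta> / pi, and its integral\<close>

lemma S_eq:
  assumes "t > 0" "\<not> zeta_ordinate t"
  shows "S t = of_int (zero_count {0<..<t}) - 1 - RS_theta t / pi"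
  using riemann_von_mangoldt(1)[of t] assms zeta_ordinate_iff[of t] by (auto simp: S_def)

text \<open>
  Two functions that agree with \<open>S\<close> off the ordinates, so that the values of \<open>S\<close> at ordinates,
  which are one-sided limits, never have to be computed.
\<close>

definition S_right :: "real \<Rightarrow> real" where
  "S_right t = of_int (zero_count {0<..t}) - 1 - RS_theta t / pi"

definition S_left :: "real \<Rightarrow> real" where
  "S_left t = of_int (zero_count {0<..<t}) - 1 - RS_theta t / pi"

lemma finite_ordinates: "finite {t. 0 < t \<and> t \<le> b \<and> zeta_ordinate t}"
proof (rule finite_subset)
  show "finite (Im ` {s. xi s = 0 \<and> \<bar>Im s\<bar> \<le> b})" by (intro finite_imageI finite_xi_zeros_below)
  show "{t. 0 < t \<and> t \<le> b \<and> zeta_ordinate t} \<subseteq> Im ` {s. xi s = 0 \<and> \<bar>Im s\<bar> \<le> b}"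
  proof
    fix t assume t: "t \<in> {t. 0 < t \<and> t \<le> b \<and> zeta_ordinate t}"
    then obtain s where "xi s = 0" "Im s = t" using zeta_ordinate_iff by auto
    then show "t \<in> Im ` {s. xi s = 0 \<and> \<bar>Im s\<bar> \<le> b}" using t by (intro image_eqI[of _ _ s]) auto
  qed
qed

text \<open>A zero count is monotone in its endpoint, hence integrable, and \<theta> is
  continuous.\<close>

lemma S_right_left_integrable:
  assumes "0 \<le> a"
  shows "S_right integrable_on {a..b}" "S_left integrable_on {a..b}"
proof -
  have th: "(\<lambda>t. 1 + RS_theta t / pi) integrable_on {a..b}"
    by (intro integrable_continuous_real continuous_intros) auto
  have "mono_on {a..b} (\<lambda>t. real_of_int (zero_count {0<..t}))"
    by (intro mono_onI of_int_le_iff[THEN iffD2] zero_count_mono[where t = "\<bar>b\<bar>"]) auto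
  from integrable_diff[OF integrable_on_mono_on[OF this] th] show "S_right integrable_on {a..b}"
    by (simp add: S_right_def[abs_def] diff_diff_eq)
  have "mono_on {a..b} (\<lambda>t. real_of_int (zero_count {0<..<t}))"
    by (intro mono_onI of_int_le_iff[THEN iffD2] zero_count_mono[where t = "\<bar>b\<bar>"]) auto
  from integrable_diff[OF integrable_on_mono_on[OF this] th] show "S_left integrable_on {a..b}"
    by (simp add: S_left_def[abs_def] diff_diff_eq)
qed

lemma S_integrable:
  assumes "0 \<le> a"
  shows "S integrable_on {a..b}" "integral {a..b} S = integral {a..b} S_right" "integral {a..b} S = integral {a..b} S_left"
proof -
  let ?F = "insert 0 {t. 0 < t \<and> t \<le> b \<and> zeta_ordinate t}"
  have fin: "finite ?F" using finite_ordinates by simp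
  have r: "S t = S_right t" and l: "S t = S_left t" if "t \<in> {a..b} - ?F" for t
    using S_eq[of t] zero_count_closed_eq_open[of t] that assms by (auto simp: S_right_def S_left_def)
  show "S integrable_on {a..b}"
    by (rule integrable_spike_finite[OF fin r S_right_left_integrable(1)[OF assms]])
  show "integral {a..b} S = integral {a..b} S_right"
    by (rule integral_spike[OF negligible_finite[OF fin], symmetric]) (use r in auto)
  show "integral {a..b} S = integral {a..b} S_left"
    by (rule integral_spike[OF negligible_finite[OF fin], symmetric]) (use l in auto)
qed

lemma S_integral_combine:
  assumes "0 \<le> a" "a \<le> b" "b \<le> c"
  shows "integral {a..c} S = integral {a..b} S + integral {b..c} S"
  using Henstock_Kurzweil_Integration.integral_combine[OF assms(2,3) S_integrable(1)[OF assms(1)]] by simp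

lemma S1_diff:
  assumes "0 \<le> a" "a \<le> b"
  shows "S1 b - S1 a = integral {a..b} S"
  unfolding S1_def using S_integral_combine[of 0 a b] assms by simp

section \<open>Parity of the zero count at Gram points\<close>

text \<open>Off the ordinates pi S(u) = pi (N - 1) - \<theta>(u) is an argument of \<zeta>(1/2 + i
  u); the parity of N - 1 becomes the sign in front of cos \<theta>.\<close>

lemma zeta_critical_cos:
  assumes "u > 0" "\<not> zeta_ordinate u"
  shows "Re (zeta (Complex (1/2) u)) = norm (zeta (Complex (1/2) u)) *
     ((if even (zero_count {0<..<u} - 1) then 1 else - 1) * cos (RS_theta u))"
proof -
  have nz: "xi s = 0 \<Longrightarrow> Im s \<noteq> u" for s using assms zeta_ordinate_iff by blast
  note * = riemann_von_mangoldt[OF assms(1) nz]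
  have "pi * S_generic u = pi * of_int (zero_count {0<..<u} - 1) - RS_theta u"
    using *(1) by (simp add: field_simps)
  then have "cos (pi * S_generic u) = (if even (zero_count {0<..<u} - 1) then 1 else - 1) * cos (RS_theta u)"
    by (simp only: cos_diff cos_npi_int sin_npi_int mult_zero_left add_0_right)
  then show ?thesis using arg_cong[OF *(2), of Re] by simp
qed

text \<open>cos \<theta>(u) is only required to have the sign of (-1)^j, so that the statement
  applies in a neighbourhood of a Gram point.\<close>

lemma parity_of_count:
  assumes "u > 0" "\<not> zeta_ordinate u" "Re (zeta (Complex (1/2) u)) > 0" "cos (RS_theta u) * cos (pi * of_int j) > 0"
  shows "even (zero_count {0<..<u} - j - 1)"
proof -
  have "(if even (zero_count {0<..<u} - 1) then 1 else - 1) * cos (RS_theta u) > 0"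
    using assms(3) unfolding zeta_critical_cos[OF assms(1,2)] by (simp add: zero_less_mult_iff)
  then have "even (zero_count {0<..<u} - 1) \<longleftrightarrow> even j"
    using assms(4) by (auto simp: zero_less_mult_iff split: if_splits)
  then show ?thesis by (auto simp: algebra_simps)
qed

lemma half_plus_i: "1/2 + \<i> * of_real t = Complex (1/2) t"
  by (simp add: complex_eq_iff)

text \<open>The argument formula may fail at g itself, since a zero off the line can have ordinate
  g. By continuity the signs of \<zeta> and of cos \<theta> persist at nearby points: some u > g
  yields the count including g, some v < g the one excluding it.\<close>

lemma parity_at_gram:
  assumes j: "j \<ge> -1" and pos: "Re (zeta (1/2 + \<i> * of_real (gram j))) > 0"
  shows "even (zero_count {0<..gram j} - j - 1)" "even (zero_count {0<..<gram j} - j - 1)"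
proof -
  define g where "g = gram j"
  have g: "g \<ge> 7" "RS_theta g = pi * of_int j" using gram_props[OF j] by (simp_all add: g_def)
  let ?Z = "Im ` {s. xi s = 0 \<and> \<bar>Im s\<bar> \<le> g + 1}"
  have "finite ?Z" by (intro finite_imageI finite_xi_zeros_below)
  \<comment> \<open>A radius within which g is the only possible ordinate.\<close>
  from finite_set_avoid[OF this, of g] obtain d where d: "d > 0" "\<And>x. x \<in> ?Z \<Longrightarrow> x \<noteq> g \<Longrightarrow> d \<le> dist g x" by blast
  have no: "Im s = g" if "xi s = 0" "\<bar>Im s - g\<bar> < d" "\<bar>Im s - g\<bar> < 1" for s
  proof (rule ccontr)
    assume "Im s \<noteq> g"
    moreover have "Im s \<in> ?Z" using that g by auto
    ultimately show False using d(2)[of "Im s"] that by (simp add: dist_real_def abs_minus_commute)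
  qed
  have cont: "isCont zeta (Complex (1/2) g)"
    by (rule zeta_isCont) (use g in \<open>auto simp: complex_eq_iff\<close>)
  have "((\<lambda>u. Complex (1/2) u) \<longlongrightarrow> Complex (1/2) g) (at g)" by (intro tendsto_Complex tendsto_const tendsto_ident_at)
  from isCont_tendsto_compose[OF cont this] have "((\<lambda>u. Re (zeta (Complex (1/2) u))) \<longlongrightarrow> Re (zeta (Complex (1/2) g))) (at g)"
    by (intro tendsto_Re)
  then have e1: "eventually (\<lambda>u. Re (zeta (Complex (1/2) u)) > 0) (at g)"
    using pos unfolding half_plus_i g_def[symmetric] by (rule order_tendstoD(1))
  have "isCont RS_theta g" by (rule DERIV_isCont[OF RS_theta_has_derivative])
  then have "((\<lambda>u. cos (RS_theta u) * cos (pi * of_int j)) \<longlongrightarrow> cos (RS_theta g) * cos (pi * of_int j)) (at g)"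
    by (intro tendsto_intros) (simp add: isCont_def)
  moreover have "cos (RS_theta g) * cos (pi * of_int j) > 0" unfolding g(2) by simp
  ultimately have e2: "eventually (\<lambda>u. cos (RS_theta u) * cos (pi * of_int j) > 0) (at g)" by (rule order_tendstoD(1))
  have e3: "eventually (\<lambda>u. dist u g < min d 1) (at g)" using d(1) unfolding eventually_at by (intro exI[of _ "min d 1"]) auto
  define P where "P = (\<lambda>u. Re (zeta (Complex (1/2) u)) > 0 \<and> cos (RS_theta u) * cos (pi * of_int j) > 0 \<and> dist u g < min d 1)"
  have P: "eventually P (at g)" unfolding P_def using e1 e2 e3 by eventually_elim auto
  have key: "even (zero_count {0<..<u} - j - 1)" if "P u" "u \<noteq> g" for u
  proof (rule parity_of_count)
    show u: "u > 0" using that g by (auto simp: P_def dist_real_def)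
    show "\<not> zeta_ordinate u" using no that zeta_ordinate_iff[OF u] by (auto simp: P_def dist_real_def)
  qed (use that in \<open>auto simp: P_def\<close>)
  have "eventually P (at_right g)" "eventually P (at_left g)"
    using P by (auto simp: eventually_at_split)
  then have "eventually (\<lambda>u. P u \<and> u > g) (at_right g)" "eventually (\<lambda>u. P u \<and> u < g) (at_left g)"
    by (auto simp: eventually_at_filter elim: eventually_mono)
  then obtain u v where u: "P u" "u > g" and v: "P v" "v < g"
    using eventually_happens'[OF trivial_limit_at_right_real] eventually_happens'[OF trivial_limit_at_left_real] by blast
  have "zero_count {0<..<u} = zero_count ({0<..g} \<union> {g<..<u})" using u g by (intro arg_cong[of _ _ zero_count]) auto
  also have "\<dots> = zero_count {0<..g} + zero_count {g<..<u}" using u g by (intro zero_count_Un[of _ _ u]) auto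
  also have "zero_count {g<..<u} = 0"
    by (rule zero_count_eq_0I) (use no u in \<open>force simp: P_def dist_real_def\<close>)
  finally show "even (zero_count {0<..gram j} - j - 1)" using key[of u] u by (simp add: g_def)
  have v0: "v > 0" using v g by (auto simp: P_def dist_real_def)
  have "zero_count {0<..<g} = zero_count ({0<..<v} \<union> {v..<g})" using v v0 by (intro arg_cong[of _ _ zero_count]) auto
  also have "\<dots> = zero_count {0<..<v} + zero_count {v..<g}" using v v0 by (intro zero_count_Un[of _ _ g]) auto
  also have "zero_count {v..<g} = 0"
    by (rule zero_count_eq_0I) (use no v in \<open>force simp: P_def dist_real_def\<close>)
  finally show "even (zero_count {0<..<gram j} - j - 1)" using key[of v] v by (simp add: g_def)
qed

text \<open>A converse to \<open>parity_at_gram\<close> off the ordinates, where |\<zeta>| > 0 and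
  the sign is (-1)^(N - 1) cos (pi j) = 1. Inside a block it contradicts the sign condition.\<close>

lemma gram_sign_nonordinate:
  assumes j: "j \<ge> -1" and no: "\<not> zeta_ordinate (gram j)" and ev: "even (zero_count {0<..<gram j} - j - 1)"
  shows "Re (zeta (1/2 + \<i> * of_real (gram j))) > 0"
proof -
  note g = gram_props[OF j]
  have "zeta (Complex (1/2) (gram j)) \<noteq> 0" using no by (auto simp: zeta_ordinate_def)
  moreover have "(if even (zero_count {0<..<gram j} - 1) then 1 else - 1) * cos (RS_theta (gram j)) = (1::real)"
    unfolding g(2) using ev by (auto simp: algebra_simps)
  ultimately show ?thesis
    unfolding half_plus_i using zeta_critical_cos[of "gram j"] no g by simp
qed

section \<open>The integral of S over a Gram interval\<close>

text \<open>
  To bound an integral of \<open>\<kappa> - \<theta>(t) / \<pi>\<close> over a Gram interval when \<open>\<theta>' \<le> D\<close>, the integrand is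
  multiplied by \<open>\<theta>' / D \<le> 1\<close>, which makes it the derivative of a quadratic polynomial in \<open>\<theta>\<close>.
\<close>

lemma has_integral_theta_weighted:
  assumes j: "j \<ge> -1" and D: "D > 0"
  shows "((\<lambda>t. (\<kappa> - RS_theta t / pi) * (RS_theta_deriv t / D)) has_integral
     pi * (\<kappa> - of_int j - 1/2) / D) {gram j..gram (j + 1)}"
proof -
  define F where "F = (\<lambda>t. (\<kappa> * RS_theta t - (RS_theta t)^2 / (2 * pi)) / D)"
  have "((\<lambda>t. (\<kappa> - RS_theta t / pi) * (RS_theta_deriv t / D)) has_integral
     F (gram (j + 1)) - F (gram j)) {gram j..gram (j + 1)}"
  proof (rule fundamental_theorem_of_calculus)
    fix t
    have "(F has_real_derivative (\<kappa> * RS_theta_deriv t - (2 * RS_theta t * RS_theta_deriv t) / (2 * pi)) / D)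
        (at t within {gram j..gram (j + 1)})"
      unfolding F_def using D by (auto intro!: derivative_eq_intros RS_theta_has_derivative)
    also have "(\<kappa> * RS_theta_deriv t - (2 * RS_theta t * RS_theta_deriv t) / (2 * pi)) / D
        = (\<kappa> - RS_theta t / pi) * (RS_theta_deriv t / D)"
      using D by (simp add: field_simps)
    finally show "(F has_vector_derivative (\<kappa> - RS_theta t / pi) * (RS_theta_deriv t / D))
        (at t within {gram j..gram (j + 1)})"
      by (simp add: has_real_derivative_iff_has_vector_derivative)
  qed (use gram_less[of j "j + 1"] j in simp)
  moreover have "RS_theta (gram (j + 1)) = pi * (of_int j + 1)" "RS_theta (gram j) = pi * of_int j"
    using gram_props[of j] gram_props[of "j + 1"] j by simp_all
  then have "F (gram (j + 1)) - F (gram j) = pi * (\<kappa> - of_int j - 1/2) / D"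
    unfolding F_def using D by (simp add: field_simps power2_eq_square)
  ultimately show ?thesis by simp
qed

text \<open>Across the interval \<theta> / pi - j runs from 0 to 1 while the counts are monotone. In
  the first and third claims S is at least j + 2 - \<theta> / pi, respectively at most j - 1 -
  \<theta> / pi, almost everywhere, and the weighted integrals are pi (2 - 1/2) / D and - pi (1 +
  1/2) / D. Lower bounds use \<open>S_right\<close>, upper bounds \<open>S_left\<close>.\<close>

lemma S_gram_interval_bounds:
  fixes j :: int and D :: real
  assumes j: "j \<ge> -1" and D: "D > 0" "\<And>t. gram j \<le> t \<Longrightarrow> t \<le> gram (j + 1) \<Longrightarrow> RS_theta_deriv t \<le> D"
  defines "a \<equiv> gram j" and "b \<equiv> gram (j + 1)"
  shows "zero_count {0<..a} \<ge> j + 3 \<Longrightarrow> integral {a..b} S \<ge> 3 * pi / (2 * D)"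
    and "zero_count {0<..a} \<ge> j + 2 \<Longrightarrow> integral {a..b} S \<ge> 0"
    and "zero_count {0<..<b} \<le> j \<Longrightarrow> integral {a..b} S \<le> - (3 * pi / (2 * D))"
    and "zero_count {0<..<b} \<le> j + 1 \<Longrightarrow> integral {a..b} S \<le> 0"
proof -
  have a: "a \<ge> 7" "RS_theta a = pi * of_int j" using gram_props[OF j] by (simp_all add: a_def)
  have b: "b \<ge> 7" "RS_theta b = pi * (of_int j + 1)" using gram_props[of "j + 1"] j by (simp_all add: b_def)
  have ab: "a < b" unfolding a_def b_def using j by (intro gram_less) auto
  have th: "pi * of_int j \<le> RS_theta t" "RS_theta t \<le> pi * (of_int j + 1)" if "t \<in> {a..b}" for t
    using RS_theta_strict_mono[of a t] RS_theta_strict_mono[of t b] that a b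
    by (cases "t = a"; cases "t = b"; force)+
  have thp: "of_int j \<le> RS_theta t / pi" "RS_theta t / pi \<le> of_int j + 1" if "t \<in> {a..b}" for t
    using th[OF that] by (simp_all add: field_simps)
  have rD: "0 \<le> RS_theta_deriv t" "RS_theta_deriv t / D \<le> 1" if "t \<in> {a..b}" for t
    using RS_theta_deriv_bounds(2)[of t] D that a by (auto simp: a_def b_def)
  have right_mono: "zero_count {0<..a} \<le> zero_count {0<..t}" if "t \<in> {a..b}" for t
    using that a by (intro zero_count_mono[where t = t]) auto
  have left_mono: "zero_count {0<..<t} \<le> zero_count {0<..<b}" if "t \<in> {a..b}" for t
    using that a by (intro zero_count_mono[where t = b]) auto
  have iS: "S_right integrable_on {a..b}" "S_left integrable_on {a..b}" "integral {a..b} S = integral {a..b} S_right" "integral {a..b} S = integral {a..b} S_left"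
    using S_right_left_integrable[of a b] S_integrable[of a b] a by auto
  show "integral {a..b} S \<ge> 0" if "zero_count {0<..a} \<ge> j + 2"
    unfolding iS(3)
  proof (rule integral_nonneg[OF iS(1)])
    fix t assume t: "t \<in> {a..b}"
    have "of_int (zero_count {0<..t}) \<ge> real_of_int (j + 2)" using that right_mono[OF t] by (simp only: of_int_le_iff)
    then show "0 \<le> S_right t" using thp[OF t] by (simp add: S_right_def)
  qed
  show "integral {a..b} S \<le> 0" if "zero_count {0<..<b} \<le> j + 1"
  proof -
    have "integral {a..b} S_left \<le> integral {a..b} (\<lambda>t. 0)"
    proof (rule integral_le[OF iS(2)])
      fix t assume t: "t \<in> {a..b}"
      have "of_int (zero_count {0<..<t}) \<le> real_of_int (j + 1)" using that left_mono[OF t] by (simp only: of_int_le_iff)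
      then show "S_left t \<le> 0" using thp[OF t] by (simp add: S_left_def)
    qed (rule integrable_0)
    then show ?thesis by (simp add: iS(4))
  qed
  show "integral {a..b} S \<ge> 3 * pi / (2 * D)" if "zero_count {0<..a} \<ge> j + 3"
  proof -
    have F: "((\<lambda>t. (of_int j + 2 - RS_theta t / pi) * (RS_theta_deriv t / D)) has_integral 3 * pi / (2 * D)) {a..b}"
      using has_integral_theta_weighted[OF j D(1), of "of_int j + 2"] by (simp add: a_def b_def mult.commute)
    have "3 * pi / (2 * D) \<le> integral {a..b} S_right"
    proof (rule has_integral_le[OF F integrable_integral[OF iS(1)]])
      fix t assume t: "t \<in> {a..b}"
      have "of_int (zero_count {0<..t}) \<ge> real_of_int (j + 3)" using that right_mono[OF t] by (simp only: of_int_le_iff)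
      then have "of_int j + 2 - RS_theta t / pi \<le> S_right t" by (simp add: S_right_def)
      moreover have "(of_int j + 2 - RS_theta t / pi) * (RS_theta_deriv t / D) \<le> of_int j + 2 - RS_theta t / pi"
        using thp[OF t] rD[OF t] by (intro mult_left_le) auto
      ultimately show "(of_int j + 2 - RS_theta t / pi) * (RS_theta_deriv t / D) \<le> S_right t" by linarith
    qed
    then show ?thesis unfolding iS(3) .
  qed
  show "integral {a..b} S \<le> - (3 * pi / (2 * D))" if "zero_count {0<..<b} \<le> j"
  proof -
    have F: "((\<lambda>t. (of_int j - 1 - RS_theta t / pi) * (RS_theta_deriv t / D)) has_integral - (3 * pi / (2 * D))) {a..b}"
      using has_integral_theta_weighted[OF j D(1), of "of_int j - 1"] by (simp add: a_def b_def mult.commute)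
    have "integral {a..b} S_left \<le> - (3 * pi / (2 * D))"
    proof (rule has_integral_le[OF integrable_integral[OF iS(2)] F])
      fix t assume t: "t \<in> {a..b}"
      have "of_int (zero_count {0<..<t}) \<le> real_of_int j" using that left_mono[OF t] by (simp only: of_int_le_iff)
      then have "S_left t \<le> of_int j - 1 - RS_theta t / pi" by (simp add: S_left_def)
      \<comment> \<open>The integrand is negative here, so the comparison by the factor
        \<open>RS_theta_deriv t / D \<le> 1\<close> is made for its negative.\<close>
      moreover have "(1 + RS_theta t / pi - of_int j) * (RS_theta_deriv t / D) \<le> 1 + RS_theta t / pi - of_int j"
        using thp[OF t] rD[OF t] by (intro mult_left_le) auto
      then have "of_int j - 1 - RS_theta t / pi \<le> (of_int j - 1 - RS_theta t / pi) * (RS_theta_deriv t / D)"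
        by (simp add: algebra_simps)
      ultimately show "S_left t \<le> (of_int j - 1 - RS_theta t / pi) * (RS_theta_deriv t / D)" by linarith
    qed
    then show ?thesis unfolding iS(4) .
  qed
qed

section \<open>Zeros and the integral of S in one block\<close>

text \<open>\<zeta> is positive at the left end, so all zeros supplied by the rule lie in the open
  interval, which can be appended to either kind of count. Zeros off the line can only increase the
  count.\<close>

lemma rosser_zero_count:
  assumes block: "gram_block m l" and rosser: "rosser_rule m l"
  shows "zero_count {gram m<..<gram (m + int l)} \<ge> int l"
proof -
  let ?R = "{t \<in> {gram m..<gram (m + int l)}. RS_Z t = 0}"
  have m: "m \<ge> -1" using block by (simp add: gram_block_def)
  have g7: "gram m \<ge> 7" by (rule gram_props(1)[OF m])
  have Z: "RS_Z t = 0 \<longleftrightarrow> zeta (Complex (1/2) t) = 0" for t by (simp add: RS_Z_def half_plus_i)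
  have inj: "inj_on (\<lambda>t. Complex (1/2) t) ?R" by (auto simp: inj_on_def)
  have "int l \<le> (\<Sum>t\<in>?R. zorder zeta (Complex (1/2) t))"
    using rosser by (simp add: rosser_rule_def half_plus_i)
  also have "\<dots> = (\<Sum>s\<in>(\<lambda>t. Complex (1/2) t) ` ?R. zorder zeta s)" by (simp only: sum.reindex[OF inj] o_def)
  also have "\<dots> \<le> zero_count {gram m<..<gram (m + int l)}"
    unfolding zero_count_def
  proof (rule sum_mono2)
    show "finite {s. xi s = 0 \<and> Im s \<in> {gram m<..<gram (m + int l)}}"
      by (rule finite_zeros_ordinate_in[of _ "gram (m + int l)"]) (use g7 in auto)
    show "(\<lambda>t. Complex (1/2) t) ` ?R \<subseteq> {s. xi s = 0 \<and> Im s \<in> {gram m<..<gram (m + int l)}}"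
    proof safe
      fix t assume t: "t \<in> {gram m..<gram (m + int l)}" "RS_Z t = 0"
      have "Re (zeta (Complex (1/2) (gram m))) > 0" using block by (simp add: gram_block_def half_plus_i)
      then have "t \<noteq> gram m" using t(2) Z by auto
      then show "Im (Complex (1/2) t) \<in> {gram m<..<gram (m + int l)}" using t by auto
      show "xi (Complex (1/2) t) = 0" using t Z g7 by (subst xi_zero_iff_zeta_zero) auto
    qed
    show "0 \<le> zorder zeta s" if "s \<in> {s. xi s = 0 \<and> Im s \<in> {gram m<..<gram (m + int l)}} - (\<lambda>t. Complex (1/2) t) ` ?R" for s
      using zorder_zeta_pos[of s] that by simp
  qed
  finally show ?thesis .
qed

text \<open>The difference between the count and the Gram index does not drop from one end of a
  block to the next.\<close>

lemma block_gain:
  assumes block: "gram_block m l" and rosser: "rosser_rule m l"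
  shows "zero_count {0<..gram (m + int l)} \<ge> zero_count {0<..gram m} + int l"
    and "zero_count {0<..<gram (m + int l)} \<ge> zero_count {0<..<gram m} + int l"
proof -
  have ml: "m \<ge> -1" "l \<ge> 1" using block by (simp_all add: gram_block_def)
  let ?a = "gram m" and ?b = "gram (m + int l)"
  have ab: "?a < ?b" using ml by (intro gram_less) auto
  have a7: "?a \<ge> 7" by (rule gram_props(1)[OF ml(1)])
  have "zero_count {0<..?a} + zero_count {?a<..<?b} = zero_count ({0<..?a} \<union> {?a<..<?b})"
    using ab a7 by (intro zero_count_Un[where t = ?b, symmetric]) auto
  also have "\<dots> \<le> zero_count {0<..?b}" using ab a7 by (intro zero_count_mono[where t = ?b]) auto
  finally show "zero_count {0<..?b} \<ge> zero_count {0<..?a} + int l" using rosser_zero_count[OF assms] by linarith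
  have "zero_count {0<..<?a} + zero_count {?a<..<?b} = zero_count ({0<..<?a} \<union> {?a<..<?b})"
    using ab a7 by (intro zero_count_Un[where t = ?b, symmetric]) auto
  also have "\<dots> \<le> zero_count {0<..<?b}" using ab a7 by (intro zero_count_mono[where t = ?b]) auto
  finally show "zero_count {0<..<?b} \<ge> zero_count {0<..<?a} + int l" using rosser_zero_count[OF assms] by linarith
qed

text \<open>On the first Gram interval an excess of two zeros yields the whole gain. On the others
  an excess of one keeps the integral nonnegative; that it persists is the second half of the
  induction claim.\<close>

lemma block_integral_lower:
  assumes block: "gram_block m l" and start: "zero_count {0<..gram m} \<ge> m + 3"
    and D: "D > 0" "\<And>t. gram m \<le> t \<Longrightarrow> t \<le> gram (m + int l) \<Longrightarrow> RS_theta_deriv t \<le> D"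
  shows "integral {gram m..gram (m + int l)} S \<ge> 3 * pi / (2 * D)"
proof -
  have ml: "m \<ge> -1" "l \<ge> 1" using block by (simp_all add: gram_block_def)
  have g7: "gram i \<ge> 7" if "i \<ge> m" for i using gram_props(1)[of i] that ml by simp
  have gle: "gram i \<le> gram k" if "m \<le> i" "i \<le> k" for i k
    using gram_less[of i k] that ml by (cases "i = k") auto
  \<comment> \<open>The claim on the count stops before i = l, since it rests on \<zeta> \<le> 0 at
    the interior Gram points.\<close>
  have "integral {gram m..gram (m + int i)} S \<ge> 3 * pi / (2 * D) \<and> (i < l \<longrightarrow> zero_count {0<..gram (m + int i)} \<ge> m + int i + 2)"
    if "1 \<le> i" "i \<le> l" for i
    using that
  proof (induction i rule: nat_induct_at_least)
    case base
    have "integral {gram m..gram (m + 1)} S \<ge> 3 * pi / (2 * D)"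
      by (rule S_gram_interval_bounds(1)[OF ml(1) D(1) _ start]) (use D(2) gle[of "m + 1" "m + int l"] ml in force)
    moreover have "zero_count {0<..gram m} \<le> zero_count {0<..gram (m + 1)}"
      using gle[of m "m + 1"] g7[of m] by (intro zero_count_mono[where t = "gram (m + 1)"]) auto
    ultimately show ?case using start by simp
  next
    case (Suc i)
    define j where "j = m + int i"
    have j: "j \<ge> -1" "m \<le> j" using ml by (simp_all add: j_def)
    have j1: "m + int (Suc i) = j + 1" by (simp add: j_def)
    have IH: "integral {gram m..gram j} S \<ge> 3 * pi / (2 * D)" "zero_count {0<..gram j} \<ge> j + 2"
      using Suc by (auto simp: j_def)
    have gg: "gram j < gram (j + 1)" using j by (intro gram_less) auto
    have "integral {gram j..gram (j + 1)} S \<ge> 0"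
      by (rule S_gram_interval_bounds(2)[OF j(1) D(1) _ IH(2)])
         (use D(2) gle[of m j] gle[of "j + 1" "m + int l"] Suc.prems j in \<open>force simp: j_def\<close>)
    moreover have "integral {gram m..gram (j + 1)} S = integral {gram m..gram j} S + integral {gram j..gram (j + 1)} S"
      using gle[of m j] gg g7[of m] j by (intro S_integral_combine) auto
    ultimately have 1: "integral {gram m..gram (j + 1)} S \<ge> 3 * pi / (2 * D)" using IH(1) by linarith
    \<comment> \<open>Without a zero between \<open>g\<^sub>j\<close> and \<open>g\<^sub>j\<^sub>+\<^sub>1\<close>, the parity of the count would make \<open>\<zeta>\<close> positive at \<open>g\<^sub>j\<^sub>+\<^sub>1\<close>.\<close>
    have 2: "zero_count {0<..gram (j + 1)} \<ge> j + 1 + 2" if il: "Suc i < l"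
    proof (rule ccontr)
      assume neg: "\<not> zero_count {0<..gram (j + 1)} \<ge> j + 1 + 2"
      have split: "zero_count {0<..gram (j + 1)} = zero_count {0<..gram j} + zero_count {gram j<..gram (j + 1)}"
      proof -
        have "{0<..gram (j + 1)} = {0<..gram j} \<union> {gram j<..gram (j + 1)}" using gg g7[OF j(2)] by auto
        then show ?thesis using gg g7[OF j(2)] by (simp only:) (intro zero_count_Un[where t = "gram (j + 1)"]; auto)
      qed
      have none: "Im s \<notin> {gram j<..gram (j + 1)}" if "xi s = 0" for s
      proof
        assume "Im s \<in> {gram j<..gram (j + 1)}"
        then have "zero_count {gram j<..gram (j + 1)} \<ge> 1"
          using gg g7[OF j(2)] by (intro zero_count_pos[OF that _, where t = "gram (j + 1)"]) auto
        then show False using neg split IH(2) by linarith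
      qed
      have "zero_count {gram j<..gram (j + 1)} = 0" by (rule zero_count_eq_0I[OF none])
      then have eq: "zero_count {0<..gram (j + 1)} = j + 2" using neg split IH(2) by linarith
      have pos: "gram (j + 1) > 0" using g7[of "j + 1"] j by simp
      have no: "\<not> zeta_ordinate (gram (j + 1))" using none gg unfolding zeta_ordinate_iff[OF pos] by force
      have "Re (zeta (1/2 + \<i> * of_real (gram (j + 1)))) > 0"
        by (rule gram_sign_nonordinate[OF _ no]) (use eq zero_count_closed_eq_open[OF pos no] j in simp_all)
      moreover have "Re (zeta (1/2 + \<i> * of_real (gram (j + 1)))) \<le> 0"
        using block il unfolding gram_block_def by (simp add: j_def)
      ultimately show False by simp
    qed
    show ?case unfolding j1 using 1 2 by (simp add: j_def)
  qed
  from this[of l] show ?thesis using ml by simp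
qed

text \<open>The mirror image of \<open>block_integral_lower\<close>, run from the right end: a
  deficit of two zeros on the last Gram interval, of at least one on the others.\<close>

lemma block_integral_upper:
  assumes block: "gram_block m l" and finish: "zero_count {0<..<gram (m + int l)} \<le> m + int l - 1"
    and D: "D > 0" "\<And>t. gram m \<le> t \<Longrightarrow> t \<le> gram (m + int l) \<Longrightarrow> RS_theta_deriv t \<le> D"
  shows "integral {gram m..gram (m + int l)} S \<le> - (3 * pi / (2 * D))"
proof -
  have ml: "m \<ge> -1" "l \<ge> 1" using block by (simp_all add: gram_block_def)
  define p where "p = m + int l"
  have g7: "gram i \<ge> 7" if "i \<ge> m" for i using gram_props(1)[of i] that ml by simp
  have gle: "gram i \<le> gram k" if "m \<le> i" "i \<le> k" for i k
    using gram_less[of i k] that ml by (cases "i = k") auto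
  have "integral {gram (p - int i)..gram p} S \<le> - (3 * pi / (2 * D)) \<and> (i < l \<longrightarrow> zero_count {0<..<gram (p - int i)} \<le> p - int i)"
    if "1 \<le> i" "i \<le> l" for i
    using that
  proof (induction i rule: nat_induct_at_least)
    case base
    have p1: "p - 1 \<ge> -1" "m \<le> p - 1" using ml by (simp_all add: p_def)
    have "integral {gram (p - 1)..gram (p - 1 + 1)} S \<le> - (3 * pi / (2 * D))"
      by (rule S_gram_interval_bounds(3)[OF p1(1) D(1)]) (use D(2) gle[of m "p - 1"] finish p1 in \<open>force simp: p_def\<close>)+
    moreover have "zero_count {0<..<gram (p - 1)} \<le> zero_count {0<..<gram p}"
      using gle[of "p - 1" p] g7[of p] p1 by (intro zero_count_mono[where t = "gram p"]) auto
    ultimately show ?case using finish by (simp add: p_def)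
  next
    case (Suc i)
    define j where "j = p - int (Suc i)"
    have j: "j \<ge> -1" "m \<le> j" "j + 1 \<le> p" using ml Suc.prems by (simp_all add: j_def p_def)
    have j1: "p - int i = j + 1" by (simp add: j_def)
    have IH: "integral {gram (j + 1)..gram p} S \<le> - (3 * pi / (2 * D))" "zero_count {0<..<gram (j + 1)} \<le> j + 1"
      using Suc unfolding j1 by auto
    have gg: "gram j < gram (j + 1)" using j by (intro gram_less) auto
    have "integral {gram j..gram (j + 1)} S \<le> 0"
      by (rule S_gram_interval_bounds(4)[OF j(1) D(1) _ IH(2)])
         (use D(2) gle[of m j] gle[of "j + 1" p] j in \<open>force simp: p_def\<close>)
    moreover have "integral {gram j..gram p} S = integral {gram j..gram (j + 1)} S + integral {gram (j + 1)..gram p} S"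
      using gle[of "j + 1" p] gg g7[of j] j by (intro S_integral_combine) auto
    ultimately have 1: "integral {gram j..gram p} S \<le> - (3 * pi / (2 * D))" using IH(1) by linarith
    \<comment> \<open>Otherwise the count below the j-th Gram point is exactly j + 1, whose parity
      makes \<zeta> positive there, against the sign condition in the interior of the block.\<close>
    have 2: "zero_count {0<..<gram j} \<le> j" if il: "Suc i < l"
    proof (rule ccontr)
      assume neg: "\<not> zero_count {0<..<gram j} \<le> j"
      have split: "zero_count {0<..<gram (j + 1)} = zero_count {0<..<gram j} + zero_count {gram j..<gram (j + 1)}"
      proof -
        have "{0<..<gram (j + 1)} = {0<..<gram j} \<union> {gram j..<gram (j + 1)}" using gg g7[OF j(2)] by auto
        then show ?thesis using gg g7[OF j(2)] by (simp only:) (intro zero_count_Un[where t = "gram (j + 1)"]; auto)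
      qed
      have none: "Im s \<notin> {gram j..<gram (j + 1)}" if "xi s = 0" for s
      proof
        assume "Im s \<in> {gram j..<gram (j + 1)}"
        then have "zero_count {gram j..<gram (j + 1)} \<ge> 1"
          using gg g7[OF j(2)] by (intro zero_count_pos[OF that _, where t = "gram (j + 1)"]) auto
        then show False using neg split IH(2) by linarith
      qed
      have "zero_count {gram j..<gram (j + 1)} = 0" by (rule zero_count_eq_0I[OF none])
      then have eq: "zero_count {0<..<gram j} = j + 1" using neg split IH(2) by linarith
      have pos: "gram j > 0" using g7[of j] j by simp
      have no: "\<not> zeta_ordinate (gram j)" using none gg unfolding zeta_ordinate_iff[OF pos] by force
      have "Re (zeta (1/2 + \<i> * of_real (gram j))) > 0"
        by (rule gram_sign_nonordinate[OF j(1) no]) (simp add: eq)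
      moreover have "Re (zeta (1/2 + \<i> * of_real (gram j))) \<le> 0"
        using block il unfolding gram_block_def by (simp add: j_def p_def)
      ultimately show False by simp
    qed
    show ?case using 1 2 by (simp add: j_def)
  qed
  from this[of l] show ?thesis using ml by (simp add: p_def)
qed

section \<open>Combining the blocks\<close>

text \<open>ln x + 0.2 / x^2 increases on [7, \<infinity>), so the bound for \<theta>' is largest at
  the right end; and 0.2 < 0.048 * 9 < 0.048 pi^2.\<close>

lemma RS_theta_deriv_le_endpoint:
  assumes "7 \<le> t" "t \<le> g"
  shows "RS_theta_deriv t \<le> (ln (g / (2 * pi)) + 0.048 * pi\<^sup>2 / g\<^sup>2) / 2"
proof -
  have "ln t + 1/5 / t^2 \<le> ln g + 1/5 / g^2"
  proof (rule DERIV_nonneg_imp_nondecreasing[OF assms(2), where f = "\<lambda>x. ln x + 1/5 / x^2"])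
    fix x assume x: "t \<le> x" "x \<le> g"
    have "((\<lambda>x. ln x + 1/5 / x^2) has_real_derivative 1 / x + (- (1/5 * (2 * x))) / (x^2)^2) (at x)"
      using x assms by (auto intro!: derivative_eq_intros simp: power2_eq_square)
    moreover have "1 / x + (- (1/5 * (2 * x))) / (x^2)^2 \<ge> 0"
    proof -
      have "2/5 \<le> x^2" using power_mono[of 7 x 2] x assms by simp
      then have "2/5 * x \<le> x^2 * x" using x assms by (intro mult_right_mono) auto
      then have "(1/5 * (2 * x)) / (x^2)^2 \<le> (x^2 * x) / (x^2)^2" by (intro divide_right_mono) auto
      also have "\<dots> = 1 / x" using x assms by (simp add: power2_eq_square)
      finally show ?thesis by simp
    qed
    ultimately show "\<exists>y. ((\<lambda>x. ln x + 1/5 / x^2) has_real_derivative y) (at x) \<and> 0 \<le> y" by blast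
  qed
  moreover have "1/5 / g^2 \<le> 0.048 * pi\<^sup>2 / g\<^sup>2"
    using power_mono[OF less_imp_le[OF pi_gt3], of 2] by (intro divide_right_mono) auto
  moreover have "ln (x / (2 * pi)) = ln x - ln (2 * pi)" if "x > 0" for x using that by (simp add: ln_div)
  ultimately have "ln (t / (2 * pi)) + 0.2 / t^2 \<le> ln (g / (2 * pi)) + 0.048 * pi\<^sup>2 / g\<^sup>2" using assms by simp
  then show ?thesis using RS_theta_deriv_bounds(1)[OF assms(1)] by simp
qed

theorem theorem2p3:
  fixes t0 a b c :: real and K :: nat and n p :: int
    and m :: "nat \<Rightarrow> int" and l :: "nat \<Rightarrow> nat"
  assumes "t0 > 1" and "a > 0" and "b > 0" and "c > 0"
    and S1_bound: "\<And>t1 t2. t2 > t1 \<Longrightarrow> t1 \<ge> t0 \<Longrightarrow>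
           \<bar>S1 t2 - S1 t1\<bar> \<le> a + b * ln (ln t2) + c * ln t2"
    and "n \<ge> -1"
    and blocks: "\<And>k. k < K \<Longrightarrow> gram_block (m k) (l k)"
    and consecutive: "\<And>k. k < K \<Longrightarrow> m (Suc k) = m k + int (l k)"
    and union: "m 0 = n" "m K = p"
    and rosser: "\<And>k. k < K \<Longrightarrow> rosser_rule (m k) (l k)"
    and "gram n \<ge> t0"
    and "real K > 1 / (3 * pi) * (ln (gram p / (2 * pi)) + 0.048 * pi\<^sup>2 / (gram p)\<^sup>2)
                    * (a + b * ln (ln (gram p)) + c * ln (gram p))"
  shows "N_zeros (gram n) \<le> of_int n + 1 \<and> N_zeros (gram p) \<ge> of_int p + 1"
proof -
  have step: "m k + 1 \<le> m (Suc k)" if "k < K" for k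
    using consecutive[OF that] blocks[OF that] by (simp add: gram_block_def)
  have mono: "m i \<le> m k" if "i \<le> k" "k \<le> K" for i k
    using that
  proof (induction k rule: dec_induct)
    case (step k)
    then show ?case using \<open>\<And>k. k < K \<Longrightarrow> m k + 1 \<le> m (Suc k)\<close>[of k] by simp
  qed simp
  have m_ge: "m k \<ge> -1" if "k \<le> K" for k using mono[of 0 k] that union \<open>n \<ge> -1\<close> by simp
  have p_ge: "p \<ge> -1" using m_ge[of K] union by simp
  define g where "g = gram p"
  have g7: "g \<ge> 7" using gram_props(1)[OF p_ge] by (simp add: g_def)
  have gle: "gram i \<le> gram k" if "-1 \<le> i" "i \<le> k" for i k
    using gram_less[of i k] that by (cases "i = k") auto
  define B where "B = ln (g / (2 * pi)) + 0.048 * pi\<^sup>2 / g\<^sup>2"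
  define D where "D = B / 2"
  define A where "A = a + b * ln (ln g) + c * ln g"
  have Dbd: "RS_theta_deriv t \<le> D" if "7 \<le> t" "t \<le> g" for t
    using RS_theta_deriv_le_endpoint[OF that] by (simp add: D_def B_def)
  have Dpos: "D > 0" using Dbd[of 7] RS_theta_deriv_bounds(2)[of 7] g7 by simp
  \<comment> \<open>Makes ln ln g nonnegative, so that \<open>A\<close> is positive.\<close>
  have lng: "ln g \<ge> 1"
  proof -
    have "exp 1 \<le> (3::real)" by (rule exp_le)
    then show ?thesis using g7 by (subst ln_ge_iff) auto
  qed
  have Apos: "A > 0" unfolding A_def using assms(2-4) lng
    by (intro add_pos_pos add_pos_nonneg mult_nonneg_nonneg mult_pos_pos) auto
  \<comment> \<open>The gain of one block. As D = B / 2, it equals 3 pi / B, and the hypothesis on K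
    becomes K L > A.\<close>
  define L where "L = 3 * pi / (2 * D)"
  have Kbig: "real K * L > A"
  proof -
    have "real K > 1 / (3 * pi) * B * A" using assms(13) by (simp add: B_def A_def g_def)
    then have "3 * pi / B * (1 / (3 * pi) * B * A) < 3 * pi / B * real K" using Dpos by (intro mult_strict_left_mono) (auto simp: D_def)
    moreover have "3 * pi / B * (1 / (3 * pi) * B * A) = A" using Dpos by (simp add: D_def)
    ultimately show ?thesis by (simp add: L_def D_def mult.commute)
  qed
  have K0: "K > 0"
  proof (rule ccontr)
    assume "\<not> K > 0"
    then show False using Kbig Apos by simp
  qed
  have np: "n < p"
  proof -
    have "m 0 + 1 \<le> m 1" using step[OF K0] by simp
    moreover have "m 1 \<le> m K" using K0 by (intro mono) auto
    ultimately show ?thesis using union by simp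
  qed
  have gn: "gram n \<ge> 7" "gram n < g" using gram_props(1)[OF \<open>n \<ge> -1\<close>] gram_less[OF \<open>n \<ge> -1\<close> np] by (simp_all add: g_def)
  have int: "\<bar>integral {gram n..g} S\<bar> \<le> A"
    using S1_bound[OF gn(2) \<open>gram n \<ge> t0\<close>] S1_diff[of "gram n" g] gn by (simp add: A_def)
  have Dblock: "RS_theta_deriv t \<le> D" if "k < K" "gram (m k) \<le> t" "t \<le> gram (m k + int (l k))" for k t
  proof (rule Dbd)
    show "7 \<le> t" using gram_props(1)[OF m_ge[of k]] that by simp
    have "gram (m (Suc k)) \<le> gram (m K)" using that by (intro gle m_ge mono) auto
    then show "t \<le> g" using that consecutive[of k] union by (simp add: g_def)
  qed
  have comb: "integral {gram i..gram k} S = integral {gram i..gram j} S + integral {gram j..gram k} S"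
    if "-1 \<le> i" "i \<le> j" "j \<le> k" for i j k
    using gle[of i j] gle[of j k] gram_props(1)[of i] that by (intro S_integral_combine) auto
  have lower: "N_zeros (gram n) \<le> of_int n + 1"
  proof (rule ccontr)
    assume "\<not> N_zeros (gram n) \<le> of_int n + 1"
    moreover have "zero_count {0<..<gram n} \<le> zero_count {0<..gram n}"
      using gn by (intro zero_count_mono[where t = "gram n"]) auto
    \<comment> \<open>N is the mean of the two counts, hence at most the larger one.\<close>
    then have "N_zeros (gram n) \<le> of_int (zero_count {0<..gram n})"
      using N_zeros_eq[of "gram n"] gn by simp
    ultimately have "of_int (zero_count {0<..gram n}) > real_of_int (n + 1)" by simp
    then have "zero_count {0<..gram n} > n + 1" by (simp only: of_int_less_iff)
    \<comment> \<open>Parity excludes the value n + 2.\<close>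
    moreover have "even (zero_count {0<..gram n} - n - 1)"
      using blocks[OF K0] union by (intro parity_at_gram(1) \<open>n \<ge> -1\<close>) (simp add: gram_block_def)
    ultimately have start: "zero_count {0<..gram n} \<ge> n + 3" by presburger
    have "zero_count {0<..gram (m k)} \<ge> m k + 3 \<and> integral {gram n..gram (m k)} S \<ge> real k * L" if "k \<le> K" for k
      using that
    proof (induction k)
      case 0
      then show ?case using start union by simp
    next
      case (Suc k)
      have k: "k < K" using Suc.prems by simp
      note cons = consecutive[OF k]
      have IH: "zero_count {0<..gram (m k)} \<ge> m k + 3" "integral {gram n..gram (m k)} S \<ge> real k * L"
        using Suc by auto
      have "integral {gram (m k)..gram (m (Suc k))} S \<ge> L"
        unfolding cons L_def by (rule block_integral_lower[OF blocks[OF k] IH(1) Dpos Dblock[OF k]])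
      moreover have "integral {gram n..gram (m (Suc k))} S = integral {gram n..gram (m k)} S + integral {gram (m k)..gram (m (Suc k))} S"
        using mono[of 0 k] mono[of k "Suc k"] k union \<open>n \<ge> -1\<close> by (intro comb) auto
      moreover have "zero_count {0<..gram (m (Suc k))} \<ge> m (Suc k) + 3"
        using block_gain(1)[OF blocks[OF k] rosser[OF k]] IH(1) unfolding cons by linarith
      ultimately show ?case using IH(2) by (simp add: distrib_right)
    qed
    from this[of K] have "integral {gram n..g} S \<ge> real K * L" using union by (simp add: g_def)
    then show False using int Kbig by linarith
  qed
  have upper: "N_zeros (gram p) \<ge> of_int p + 1"
  proof (rule ccontr)
    assume "\<not> N_zeros (gram p) \<ge> of_int p + 1"
    moreover have "zero_count {0<..<gram p} \<le> zero_count {0<..gram p}"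
      using g7 by (intro zero_count_mono[where t = "gram p"]) (auto simp: g_def)
    then have "N_zeros (gram p) \<ge> of_int (zero_count {0<..<gram p})"
      using N_zeros_eq[of "gram p"] g7 by (simp add: g_def)
    ultimately have "of_int (zero_count {0<..<gram p}) < real_of_int (p + 1)" by simp
    then have "zero_count {0<..<gram p} < p + 1" by (simp only: of_int_less_iff)
    moreover have "even (zero_count {0<..<gram p} - p - 1)"
    proof (rule parity_at_gram(2)[OF p_ge])
      \<comment> \<open>p is the right end of the last block, where \<zeta> is positive.\<close>
      have "gram_block (m (K - 1)) (l (K - 1))" "m (K - 1) + int (l (K - 1)) = p"
        using blocks[of "K - 1"] consecutive[of "K - 1"] K0 union by auto
      then show "0 < Re (zeta (1/2 + \<i> * of_real (gram p)))" by (auto simp: gram_block_def)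
    qed
    ultimately have finish: "zero_count {0<..<gram p} \<le> p - 1" by presburger
    \<comment> \<open>Here i is the number of blocks already traversed from the right.\<close>
    have "zero_count {0<..<gram (m (K - i))} \<le> m (K - i) - 1 \<and> integral {gram (m (K - i))..gram p} S \<le> - (real i * L)" if "i \<le> K" for i
      using that
    proof (induction i)
      case 0
      then show ?case using finish union by simp
    next
      case (Suc i)
      define k where "k = K - Suc i"
      have k: "k < K" "Suc k = K - i" using Suc.prems by (auto simp: k_def)
      note cons = consecutive[OF k(1)]
      have IH: "zero_count {0<..<gram (m (Suc k))} \<le> m (Suc k) - 1" "integral {gram (m (Suc k))..gram p} S \<le> - (real i * L)"
        using Suc unfolding k(2) by auto
      have "integral {gram (m k)..gram (m (Suc k))} S \<le> - L"
        unfolding cons L_def by (rule block_integral_upper[OF blocks[OF k(1)] IH(1)[unfolded cons] Dpos Dblock[OF k(1)]])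
      moreover have "integral {gram (m k)..gram p} S = integral {gram (m k)..gram (m (Suc k))} S + integral {gram (m (Suc k))..gram p} S"
        using mono[of "Suc k" K] mono[of k "Suc k"] k union m_ge[of k] by (intro comb) auto
      moreover have "zero_count {0<..<gram (m k)} \<le> m k - 1"
        using block_gain(2)[OF blocks[OF k(1)] rosser[OF k(1)]] IH(1) unfolding cons by linarith
      ultimately show ?case using IH(2) unfolding k_def[symmetric] by (simp add: distrib_right)
    qed
    from this[of K] have "integral {gram n..g} S \<le> - (real K * L)" using union by (simp add: g_def)
    then show False using int Kbig by linarith
  qed
  show ?thesis using lower upper by blast
qed

end
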